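(* Let $k\ge0$, $\theta\in\{0,1,-1\}$, and let $\zeta=\{\zeta_F\}_{F\in\mathcal F_h}$ be non-negative constants. Let $\boldsymbol Z_h^{\mathrm{div}}=\{\boldsymbol v_h\in\boldsymbol V_h^{\mathrm{div}}:\nabla\cdot\boldsymbol v_h=0\}$. Then for all $\boldsymbol u_h,\boldsymbol v_h\in\boldsymbol Z_h^{\mathrm{div}}$, $$c_h^1(\boldsymbol u_h;\boldsymbol u_h,\boldsymbol v_h)=c_h^2(\boldsymbol u_h;\boldsymbol u_h,\boldsymbol v_h)=(\boldsymbol u_h\cdot\nabla_h\boldsymbol u_h,\boldsymbol v_h)-\langle(\boldsymbol u_h\cdot\boldsymbol n)[\![\boldsymbol u_h]\!],\{\!\{\boldsymbol v_h\}\!\}\rangle_{\mathcal F_h^i}+\langle\zeta|\boldsymbol u_h\cdot\boldsymbol n|[\![\boldsymbol u_h]\!],[\![\boldsymbol v_h]\!]\rangle_{\mathcal F_h^i}.$$ Consequently the two schemes obtained with $c_h=c_h^1$ and $c_h=c_h^2$ yield the same numerical velocities when the velocity is $H(\mathrm{div})$-conforming: a function $\boldsymbol u_h:[0,T]\to\boldsymbol V_h^{\mathrm{div}}$ is the velocity component of a solution $(\boldsymbol u_h(t),P_h(t))\in\boldsymbol V_h^{\mathrm{div}}\times Q_h$, $t\in(0,T]$, of $$(\partial_t\boldsymbol u_h,\boldsymbol v_h)+c_h(\boldsymbol u_h;\boldsymbol u_h,\boldsymbol v_h)-(\nabla\cdot\boldsymbol v_h,P_h)=0\quad\forall\boldsymbol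 v_h\in\boldsymbol V_h^{\mathrm{div}},\qquad(\nabla\cdot\boldsymbol u_h,q_h)=0\quad\forall q_h\in Q_h,$$ with $c_h=c_h^1$ if and only if it is the velocity component of a solution (with a possibly different $P_h$) with $c_h=c_h^2$.
   Context: **Mesh.** $\mathcal T_h$ is a conforming shape-regular simplicial mesh of a bounded polyhedral domain $\Omega\subset\mathbb R^d$, $d\in\{2,3\}$; $\mathcal F_h$ is its set of faces, $\mathcal F_h^i$ the interior faces, $\mathcal F_h^\partial$ the boundary faces. Each $F\in\mathcal F_h^i$ carries a fixed unit normal $\boldsymbol n_F$ pointing from one adjacent element $K^+$ to the other, $K^-$; for $F\in\mathcal F_h^\partial$, $\boldsymbol n_F$ is the outward unit normal to $\partial\Omega$. $\boldsymbol n|_F:=\boldsymbol n_F$. For a scalar- or vector-valued piecewise smooth $\phi$: on interior faces $[\![\phi]\!]=\phi|_{K^+}-\phi|_{K^-}$ and $\{\!\{\phi\}\!\}=\frac12(\phi|_{K^+}+\phi|_{K^-})$; on a boundary face of $K$, $[\![\phi]\!]=\{\!\{\phi\}\!\}=\phi|_K$. $(\cdot,\cdot)$ is the $L^2(\Omega)$ inner product, $\langle\cdot,\cdot\rangle_F$ the $L^2(F)$ inner product, $\langle\cdot,\cdot\rangle_{\mathcal F_h}=\sum_{F\in\mathcal F_h}\langle\cdot,\cdot\rangle_F$, $\langle\cdot,\cdot\rangle_{\mathcal F_h^i}=\sum_{F\in\mathcal F_h^i}\langle\cdot,\cdot\rangle_F$. $\nabla_h$, $\nabla_h\cdot$ are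 the elementwise gradient and divergence; $\boldsymbol\beta\cdot\nabla_h\boldsymbol v=(\boldsymbol\beta\cdot\nabla_h)\boldsymbol v$, i.e. $(\boldsymbol\beta\cdot\nabla_h\boldsymbol v)_i=\sum_j\beta_j\partial_jv_i$. **Spaces.** With $\mathcal P_j(K)$ the polynomials of degree at most $j$ on $K$: $Q_h=\{q\in L^2(\Omega):\int_\Omega q=0,\ q|_K\in\mathcal P_k(K)\ \forall K\in\mathcal T_h\}$; $\boldsymbol V_h^{\mathrm{div}}=\{\boldsymbol v\in H(\mathrm{div};\Omega):\boldsymbol v|_K\in\boldsymbol{\mathcal Q}_k(K)\ \forall K\in\mathcal T_h,\ \boldsymbol v\cdot\boldsymbol n|_{\partial\Omega}=0\}$, where either $\boldsymbol{\mathcal Q}_k(K)=[\mathcal P_k(K)]^d+\mathcal P_k(K)\boldsymbol x$ for all $K$ (Raviart–Thomas) or $\boldsymbol{\mathcal Q}_k(K)=[\mathcal P_{k+1}(K)]^d$ for all $K$ (Brezzi–Douglas–Marini). It is well known that $\nabla\cdot\boldsymbol V_h^{\mathrm{div}}=Q_h$. For $\boldsymbol v\in\boldsymbol V_h^{\mathrm{div}}$ the normal component $\boldsymbol v\cdot\boldsymbol n$ is single-valued on interior faces. **Forms.** $$\begin{aligned}c_h^1(\boldsymbol u;\boldsymbol u,\boldsymbol v)=&(\boldsymbol u\cdot\nabla_h\boldsymbol u,\boldsymbol v)+\tfrac12((\nabla_h\cdot\boldsymbol u)\boldsymbol u,\boldsymbol v)-\langle(\{\!\{\boldsymbol u\}\!\}\cdot\boldsymbol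 n)[\![\boldsymbol u]\!],\{\!\{\boldsymbol v\}\!\}\rangle_{\mathcal F_h^i}-\tfrac12\langle[\![\boldsymbol u]\!]\cdot\boldsymbol n,\{\!\{\boldsymbol u\cdot\boldsymbol v\}\!\}\rangle_{\mathcal F_h^i}\\&+\langle\zeta|\{\!\{\boldsymbol u\}\!\}\cdot\boldsymbol n|[\![\boldsymbol u]\!],[\![\boldsymbol v]\!]\rangle_{\mathcal F_h}+\theta\langle(\{\!\{\boldsymbol v\}\!\}\cdot\boldsymbol n)[\![\boldsymbol u]\!],\{\!\{\boldsymbol u\}\!\}\rangle_{\mathcal F_h^i}+\tfrac\theta2\langle[\![\boldsymbol v]\!]\cdot\boldsymbol n,\{\!\{\boldsymbol u\cdot\boldsymbol u\}\!\}\rangle_{\mathcal F_h^i}\\&-\theta(\boldsymbol v\cdot\nabla_h\boldsymbol u,\boldsymbol u)-\tfrac\theta2((\nabla_h\cdot\boldsymbol v)\boldsymbol u,\boldsymbol u),\end{aligned}$$ $$\begin{aligned}c_h^2(\boldsymbol u;\boldsymbol u,\boldsymbol v)=&(\boldsymbol u\cdot\nabla_h\boldsymbol u,\boldsymbol v)+\tfrac{1-\theta}2((\nabla_h\cdot\boldsymbol u)\boldsymbol u,\boldsymbol v)-\langle(\{\!\{\boldsymbol u\}\!\}\cdot\boldsymbol n)[\![\boldsymbol u]\!],\{\!\{\boldsymbol v\}\!\}\rangle_{\mathcal F_h^i}-\tfrac{1-\theta}2\langle[\![\boldsymbol u]\!]\cdot\boldsymbol n,\{\!\{\boldsymbol u\cdot\boldsymbol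 v\}\!\}\rangle_{\mathcal F_h^i}\\&+\langle\zeta|\{\!\{\boldsymbol u\}\!\}\cdot\boldsymbol n|[\![\boldsymbol u]\!],[\![\boldsymbol v]\!]\rangle_{\mathcal F_h}+\theta\langle(\{\!\{\boldsymbol v\}\!\}\cdot\boldsymbol n)[\![\boldsymbol u]\!],\{\!\{\boldsymbol u\}\!\}\rangle_{\mathcal F_h^i}-\theta(\boldsymbol v\cdot\nabla_h\boldsymbol u,\boldsymbol u).\end{aligned}$$ Here $\zeta|_F=\zeta_F$. **Regularity convention.** A semi-discrete solution means that $t\mapsto\boldsymbol u_h(t)$ is continuous on $[0,T]$ and differentiable on $(0,T]$ as a map into $\boldsymbol V_h^{\mathrm{div}}$. *)

theory Defs
  imports "HOL-Analysis.Analysis"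
begin

definition L2 :: "'a::euclidean_space set \<Rightarrow> ('a \<Rightarrow> 'b::euclidean_space) set" where
  "L2 \<Omega> = {f. f \<in> borel_measurable (lebesgue_on \<Omega>) \<and> integrable (lebesgue_on \<Omega>) (\<lambda>x. (norm (f x))\<^sup>2)}"

definition L2_inner :: "'a::euclidean_space set \<Rightarrow> ('a \<Rightarrow> 'b::euclidean_space) \<Rightarrow> ('a \<Rightarrow> 'b) \<Rightarrow> real" where
  "L2_inner \<Omega> f g = (LINT x|lebesgue_on \<Omega>. f x \<bullet> g x)"

definition L2_norm :: "'a::euclidean_space set \<Rightarrow> ('a \<Rightarrow> 'b::euclidean_space) \<Rightarrow> real" where
  "L2_norm \<Omega> f = sqrt (L2_inner \<Omega> f f)"

primrec C_k :: "nat \<Rightarrow> ('a::euclidean_space \<Rightarrow> real) \<Rightarrow> bool" where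
  "C_k 0 f \<longleftrightarrow> continuous_on UNIV f"
| "C_k (Suc m) f \<longleftrightarrow> (\<forall>x. f differentiable (at x)) \<and>
     (\<forall>b\<in>Basis. C_k m (\<lambda>x. frechet_derivative f (at x) b))"

definition test_function :: "'a::euclidean_space set \<Rightarrow> ('a \<Rightarrow> real) \<Rightarrow> bool" where
  "test_function \<Omega> \<phi> \<longleftrightarrow> (\<forall>m. C_k m \<phi>) \<and> (\<exists>C. compact C \<and> C \<subseteq> \<Omega> \<and> (\<forall>x. x \<notin> C \<longrightarrow> \<phi> x = 0))"

text \<open>The integrand on the left is the inner product of \<open>v\<close> with the gradient of \<open>\<phi>\<close>.\<close>

definition has_weak_div :: "'a::euclidean_space set \<Rightarrow> ('a \<Rightarrow> 'a) \<Rightarrow> ('a \<Rightarrow> real) \<Rightarrow> bool" where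
  "has_weak_div \<Omega> v g \<longleftrightarrow> g \<in> L2 \<Omega> \<and>
     (\<forall>\<phi>. test_function \<Omega> \<phi> \<longrightarrow>
        (LINT x|lebesgue_on \<Omega>. frechet_derivative \<phi> (at x) (v x)) = - (LINT x|lebesgue_on \<Omega>. g x * \<phi> x))"

definition Hdiv :: "'a::euclidean_space set \<Rightarrow> ('a \<Rightarrow> 'a) set" where
  "Hdiv \<Omega> = {v \<in> L2 \<Omega>. \<exists>g. has_weak_div \<Omega> v g}"

text \<open>The weak divergence is determined up to a null set.\<close>

definition weak_div :: "'a::euclidean_space set \<Rightarrow> ('a \<Rightarrow> 'a) \<Rightarrow> 'a \<Rightarrow> real" where
  "weak_div \<Omega> v = (SOME g. has_weak_div \<Omega> v g)"

text \<open>
  The two cells adjacent to an interior face \<open>F\<close> are \<open>cell_plus M F\<close> and \<open>cell_minus M F\<close>; for a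
  boundary face, \<open>cell_plus M F\<close> is the only adjacent cell and \<open>cell_minus M F\<close> is irrelevant.
\<close>

record 'a mesh =
  region :: "'a set"
  cells :: "'a set set"
  face_normal :: "'a set \<Rightarrow> 'a"
  cell_plus :: "'a set \<Rightarrow> 'a set"
  cell_minus :: "'a set \<Rightarrow> 'a set"

definition faces :: "'a::euclidean_space mesh \<Rightarrow> 'a set set" where
  "faces M = {F. \<exists>K\<in>cells M. F facet_of K}"

definition interior_faces :: "'a::euclidean_space mesh \<Rightarrow> 'a set set" where
  "interior_faces M = {F. \<exists>K\<in>cells M. \<exists>K'\<in>cells M. K \<noteq> K' \<and> F facet_of K \<and> F facet_of K'}"

definition boundary_faces :: "'a::euclidean_space mesh \<Rightarrow> 'a set set" where
  "boundary_faces M = faces M - interior_faces M"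

text \<open>For a full-dimensional simplex \<open>K\<close> and a facet \<open>F\<close> of \<open>K\<close> this determines \<open>n\<close> uniquely.\<close>

definition outward_unit_normal :: "'a::euclidean_space set \<Rightarrow> 'a set \<Rightarrow> 'a \<Rightarrow> bool" where
  "outward_unit_normal K F n \<longleftrightarrow> norm n = 1 \<and> (\<forall>x\<in>F. \<forall>y\<in>K. (y - x) \<bullet> n \<le> 0)"

text \<open>
  The equation \<open>region M = interior (closure (region M))\<close> excludes slit domains: the mesh only sees
  the closure of the domain, and an unshared facet has to be the same as a facet on the boundary.
\<close>

definition conforming_simplicial_mesh :: "'a::euclidean_space mesh \<Rightarrow> bool" where
  "conforming_simplicial_mesh M \<longleftrightarrow>
     region M \<noteq> {} \<and> open (region M) \<and> connected (region M) \<and> bounded (region M) \<and>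
     region M = interior (closure (region M)) \<and>
     finite (cells M) \<and> (\<forall>K\<in>cells M. int DIM('a) simplex K) \<and>
     \<Union> (cells M) = closure (region M) \<and>
     (\<forall>K\<in>cells M. \<forall>K'\<in>cells M. (K \<inter> K') face_of K \<and> (K \<inter> K') face_of K') \<and>
     (\<forall>F\<in>faces M. cell_plus M F \<in> cells M \<and> F facet_of cell_plus M F \<and>
        outward_unit_normal (cell_plus M F) F (face_normal M F)) \<and>
     (\<forall>F\<in>interior_faces M. cell_minus M F \<in> cells M \<and> F facet_of cell_minus M F \<and>
        cell_minus M F \<noteq> cell_plus M F)"

definition shape_regular :: "real \<Rightarrow> 'a::euclidean_space mesh \<Rightarrow> bool" where
  "shape_regular \<sigma> M \<longleftrightarrow>
     (\<forall>K\<in>cells M. \<exists>x r. 0 < r \<and> cball x r \<subseteq> K \<and> diameter K \<le> \<sigma> * r)"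

text \<open>
  A piecewise smooth function is a function on the whole space whose values on the mesh skeleton, a
  null set, are irrelevant; its restriction to a cell is extended to the facets by continuity.
\<close>

definition trace :: "'a::euclidean_space set \<Rightarrow> ('a \<Rightarrow> 'b::euclidean_space) \<Rightarrow> 'a \<Rightarrow> 'b" where
  "trace K v x = Lim (at x within interior K) v"

definition jump ::
  "'a::euclidean_space mesh \<Rightarrow> ('a \<Rightarrow> 'b::euclidean_space) \<Rightarrow> 'a set \<Rightarrow> 'a \<Rightarrow> 'b" where
  "jump M v F x =
     (if F \<in> interior_faces M then trace (cell_plus M F) v x - trace (cell_minus M F) v x
      else trace (cell_plus M F) v x)"

definition avg ::
  "'a::euclidean_space mesh \<Rightarrow> ('a \<Rightarrow> 'b::euclidean_space) \<Rightarrow> 'a set \<Rightarrow> 'a \<Rightarrow> 'b" where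
  "avg M v F x =
     (if F \<in> interior_faces M
      then (1/2) *\<^sub>R (trace (cell_plus M F) v x + trace (cell_minus M F) v x)
      else trace (cell_plus M F) v x)"

text \<open>The common value on \<open>F\<close> of the normal components from the adjacent cells.\<close>

definition normal_comp :: "'a::euclidean_space mesh \<Rightarrow> ('a \<Rightarrow> 'a) \<Rightarrow> 'a set \<Rightarrow> 'a \<Rightarrow> real" where
  "normal_comp M v F x =
     (THE a. \<forall>K\<in>cells M. F facet_of K \<longrightarrow> trace K v x \<bullet> face_normal M F = a)"

text \<open>
  The surface measure on \<open>F\<close>: the measure of a subset \<open>A\<close> of \<open>F\<close> is the Lebesgue measure of the
  right prism of height 1 over \<open>A\<close>, which by Fubini is the \<open>(d - 1)\<close>-dimensional Lebesgue measure
  of \<open>A\<close> in the hyperplane spanned by \<open>F\<close>. The map \<open>closest_point (affine hull F)\<close> is the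
  orthogonal projection onto that hyperplane.
\<close>

definition face_measure :: "'a::euclidean_space mesh \<Rightarrow> 'a set \<Rightarrow> 'a measure" where
  "face_measure M F =
     distr (lebesgue_on {x + s *\<^sub>R face_normal M F |x s. x \<in> F \<and> 0 \<le> s \<and> s \<le> 1})
       (restrict_space borel F) (closest_point (affine hull F))"

definition faces_inner ::
  "'a::euclidean_space mesh \<Rightarrow> 'a set set \<Rightarrow>
   ('a set \<Rightarrow> 'a \<Rightarrow> 'b::euclidean_space) \<Rightarrow> ('a set \<Rightarrow> 'a \<Rightarrow> 'b) \<Rightarrow> real" where
  "faces_inner M \<F> f g = (\<Sum>F\<in>\<F>. LINT x|face_measure M F. f F x \<bullet> g F x)"

text \<open>\<open>conv M \<beta> v\<close> is \<open>(\<beta> \<cdot> \<nabla>\<^sub>h) v\<close>, the elementwise derivative of \<open>v\<close> in direction \<open>\<beta>\<close>.\<close>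

definition broken_deriv :: "'a::euclidean_space mesh \<Rightarrow> ('a \<Rightarrow> 'a) \<Rightarrow> 'a \<Rightarrow> 'a \<Rightarrow> 'a" where
  "broken_deriv M v x h =
     (if \<exists>K\<in>cells M. x \<in> interior K then frechet_derivative v (at x) h else 0)"

definition conv :: "'a::euclidean_space mesh \<Rightarrow> ('a \<Rightarrow> 'a) \<Rightarrow> ('a \<Rightarrow> 'a) \<Rightarrow> 'a \<Rightarrow> 'a" where
  "conv M \<beta> v x = broken_deriv M v x (\<beta> x)"

definition broken_div :: "'a::euclidean_space mesh \<Rightarrow> ('a \<Rightarrow> 'a) \<Rightarrow> 'a \<Rightarrow> real" where
  "broken_div M v x = (\<Sum>b\<in>Basis. broken_deriv M v x b \<bullet> b)"

text \<open>Polynomial functions of total degree at most \<open>j\<close>, as linear combinations of monomials.\<close>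

definition multi_indices :: "nat \<Rightarrow> ('a::euclidean_space \<Rightarrow> nat) set" where
  "multi_indices j = {\<alpha>. (\<forall>b. b \<notin> Basis \<longrightarrow> \<alpha> b = 0) \<and> (\<Sum>b\<in>Basis. \<alpha> b) \<le> j}"

definition poly_space :: "nat \<Rightarrow> ('a::euclidean_space \<Rightarrow> real) set" where
  "poly_space j =
     {p. \<exists>c. \<forall>x. p x = (\<Sum>\<alpha>\<in>multi_indices j. c \<alpha> * (\<Prod>b\<in>Basis. (x \<bullet> b) ^ \<alpha> b))}"

definition vec_poly_space :: "nat \<Rightarrow> ('a::euclidean_space \<Rightarrow> 'a) set" where
  "vec_poly_space j = {w. \<forall>b\<in>Basis. (\<lambda>x. w x \<bullet> b) \<in> poly_space j}"

datatype hdiv_family = Raviart_Thomas | Brezzi_Douglas_Marini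

fun local_space :: "hdiv_family \<Rightarrow> nat \<Rightarrow> ('a::euclidean_space \<Rightarrow> 'a) set" where
  "local_space Raviart_Thomas k =
     {(\<lambda>x. w x + q x *\<^sub>R x) |w q. w \<in> vec_poly_space k \<and> q \<in> poly_space k}"
| "local_space Brezzi_Douglas_Marini k = vec_poly_space (k + 1)"

definition Q_h :: "'a::euclidean_space mesh \<Rightarrow> nat \<Rightarrow> ('a \<Rightarrow> real) set" where
  "Q_h M k = {q \<in> L2 (region M). (LINT x|lebesgue_on (region M). q x) = 0 \<and>
     (\<forall>K\<in>cells M. \<exists>p\<in>poly_space k. \<forall>x\<in>interior K. q x = p x)}"

definition V_div :: "'a::euclidean_space mesh \<Rightarrow> hdiv_family \<Rightarrow> nat \<Rightarrow> ('a \<Rightarrow> 'a) set" where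
  "V_div M fam k = {v \<in> Hdiv (region M).
     (\<forall>K\<in>cells M. \<exists>w\<in>local_space fam k. \<forall>x\<in>interior K. v x = w x) \<and>
     (\<forall>F\<in>boundary_faces M. \<forall>x\<in>F. trace (cell_plus M F) v x \<bullet> face_normal M F = 0)}"

definition Z_div :: "'a::euclidean_space mesh \<Rightarrow> hdiv_family \<Rightarrow> nat \<Rightarrow> ('a \<Rightarrow> 'a) set" where
  "Z_div M fam k = {v \<in> V_div M fam k. has_weak_div (region M) v (\<lambda>x. 0)}"

text \<open>\<open>c1 M \<zeta> \<theta> u v\<close> and \<open>c2 M \<zeta> \<theta> u v\<close> are \<open>c\<^sub>h\<^sup>1(u; u, v)\<close> and \<open>c\<^sub>h\<^sup>2(u; u, v)\<close>.\<close>

definition c1 :: "'a::euclidean_space mesh \<Rightarrow> ('a set \<Rightarrow> real) \<Rightarrow> real \<Rightarrow>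
    ('a \<Rightarrow> 'a) \<Rightarrow> ('a \<Rightarrow> 'a) \<Rightarrow> real" where
  "c1 M \<zeta> \<theta> u v =
     L2_inner (region M) (conv M u u) v
   + 1/2 * L2_inner (region M) (\<lambda>x. broken_div M u x *\<^sub>R u x) v
   - faces_inner M (interior_faces M)
       (\<lambda>F x. (avg M u F x \<bullet> face_normal M F) *\<^sub>R jump M u F x) (avg M v)
   - 1/2 * faces_inner M (interior_faces M)
       (\<lambda>F x. jump M u F x \<bullet> face_normal M F) (avg M (\<lambda>x. u x \<bullet> v x))
   + faces_inner M (faces M)
       (\<lambda>F x. (\<zeta> F * \<bar>avg M u F x \<bullet> face_normal M F\<bar>) *\<^sub>R jump M u F x) (jump M v)
   + \<theta> * faces_inner M (interior_faces M)
       (\<lambda>F x. (avg M v F x \<bullet> face_normal M F) *\<^sub>R jump M u F x) (avg M u)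
   + \<theta>/2 * faces_inner M (interior_faces M)
       (\<lambda>F x. jump M v F x \<bullet> face_normal M F) (avg M (\<lambda>x. u x \<bullet> u x))
   - \<theta> * L2_inner (region M) (conv M v u) u
   - \<theta>/2 * L2_inner (region M) (\<lambda>x. broken_div M v x *\<^sub>R u x) u"

definition c2 :: "'a::euclidean_space mesh \<Rightarrow> ('a set \<Rightarrow> real) \<Rightarrow> real \<Rightarrow>
    ('a \<Rightarrow> 'a) \<Rightarrow> ('a \<Rightarrow> 'a) \<Rightarrow> real" where
  "c2 M \<zeta> \<theta> u v =
     L2_inner (region M) (conv M u u) v
   + (1 - \<theta>)/2 * L2_inner (region M) (\<lambda>x. broken_div M u x *\<^sub>R u x) v
   - faces_inner M (interior_faces M)
       (\<lambda>F x. (avg M u F x \<bullet> face_normal M F) *\<^sub>R jump M u F x) (avg M v)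
   - (1 - \<theta>)/2 * faces_inner M (interior_faces M)
       (\<lambda>F x. jump M u F x \<bullet> face_normal M F) (avg M (\<lambda>x. u x \<bullet> v x))
   + faces_inner M (faces M)
       (\<lambda>F x. (\<zeta> F * \<bar>avg M u F x \<bullet> face_normal M F\<bar>) *\<^sub>R jump M u F x) (jump M v)
   + \<theta> * faces_inner M (interior_faces M)
       (\<lambda>F x. (avg M v F x \<bullet> face_normal M F) *\<^sub>R jump M u F x) (avg M u)
   - \<theta> * L2_inner (region M) (conv M v u) u"

text \<open>
  The space \<open>V_div\<close> is finite-dimensional (modulo null functions), so its topology is the one given
  by the \<open>L2\<close> norm. At \<open>t = T\<close> the time derivative is one-sided.
\<close>

definition time_continuous :: "'a::euclidean_space set \<Rightarrow> real \<Rightarrow> (real \<Rightarrow> 'a \<Rightarrow> 'a) \<Rightarrow> bool" where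
  "time_continuous \<Omega> T u \<longleftrightarrow> (\<forall>t\<in>{0..T}.
     ((\<lambda>s. L2_norm \<Omega> (\<lambda>x. u s x - u t x)) \<longlongrightarrow> 0) (at t within {0..T}))"

definition has_time_deriv :: "'a::euclidean_space set \<Rightarrow> real \<Rightarrow> (real \<Rightarrow> 'a \<Rightarrow> 'a) \<Rightarrow>
    ('a \<Rightarrow> 'a) \<Rightarrow> real \<Rightarrow> bool" where
  "has_time_deriv \<Omega> T u w t \<longleftrightarrow>
     ((\<lambda>s. L2_norm \<Omega> (\<lambda>x. (1 / (s - t)) *\<^sub>R (u s x - u t x) - w x)) \<longlongrightarrow> 0) (at t within {0..T})"

definition semidiscrete_solution :: "'a::euclidean_space mesh \<Rightarrow> hdiv_family \<Rightarrow> nat \<Rightarrow> real \<Rightarrow>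
    (('a \<Rightarrow> 'a) \<Rightarrow> ('a \<Rightarrow> 'a) \<Rightarrow> real) \<Rightarrow>
    (real \<Rightarrow> 'a \<Rightarrow> 'a) \<Rightarrow> (real \<Rightarrow> 'a \<Rightarrow> real) \<Rightarrow> bool" where
  "semidiscrete_solution M fam k T c u P \<longleftrightarrow>
     (\<forall>t\<in>{0..T}. u t \<in> V_div M fam k) \<and> time_continuous (region M) T u \<and>
     (\<forall>t\<in>{0<..T}. P t \<in> Q_h M k \<and>
        (\<exists>w\<in>V_div M fam k. has_time_deriv (region M) T u w t \<and>
           (\<forall>v\<in>V_div M fam k.
              L2_inner (region M) w v + c (u t) v
                - L2_inner (region M) (weak_div (region M) v) (P t) = 0)) \<and>
        (\<forall>q\<in>Q_h M k. L2_inner (region M) (weak_div (region M) (u t)) q = 0))"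

end

theory Submission
  imports Defs
begin

text \<open>
  Everything rests on two properties of an \<open>H(div)\<close>-conforming field \<open>v\<close> with elementwise polynomial
  values: its normal component is continuous across interior faces (\<open>normal_continuous\<close>), and its weak
  divergence acts on piecewise smooth functions like the elementwise divergence
  (\<open>weak_div_broken_div\<close>). If \<open>u\<close> and \<open>v\<close> are divergence free, all terms with a divergence or a normal
  jump vanish from both forms, and the two \<open>\<theta>\<close>-terms that are left cancel: elementwise,
  \<open>(v \<cdot> \<nabla>u) \<cdot> u\<close> is the divergence of \<open>\<bar>u\<bar>\<^sup>2/2 v\<close>, and the jump of \<open>\<bar>u\<bar>\<^sup>2/2\<close> is \<open>[u] \<cdot> {u}\<close>, so that the
  divergence theorem on the cells turns the volume term into the face term (\<open>convective_energy\<close>).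

  If only \<open>u\<close> is divergence free, the forms differ by \<open>\<theta>/2 (\<nabla> \<cdot> v, \<bar>u\<bar>\<^sup>2)\<close> (\<open>c1_c2\<close>). This is a pressure
  term: since \<open>\<nabla> \<cdot> v\<close> lies in \<open>Q_h\<close>, the function \<open>\<bar>u\<bar>\<^sup>2\<close> may be replaced by its \<open>L2\<close> projection onto
  \<open>Q_h\<close>, and a multiple of that projection is added to the pressure (\<open>solution_transfer\<close>). That the
  velocity of a solution is divergence free follows by testing with its own divergence, an element
  of \<open>Q_h\<close> (\<open>Z_divI\<close>).

  The analytic tool is the divergence theorem on a polytope \<open>K\<close>, with surface integrals expressed as
  volume integrals over prisms of height 1. Its proof rests on translation invariance and dominated
  convergence. For a Lipschitz cutoff \<open>\<chi>\<^sub>m\<close> that rises from 0 on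
  the boundary of \<open>K\<close> to 1 at distance \<open>1/m\<close> from the facets, the integral of \<open>\<partial>\<^sub>e (\<chi>\<^sub>m f)\<close> is zero, as
  a limit of difference quotients (\<open>cutoff_integral\<close>). This expresses the integral of \<open>\<chi>\<^sub>m \<partial>\<^sub>e f\<close> by
  \<open>m\<close> times the integral of \<open>f\<close> over the layers of thickness \<open>1/m\<close> along the facets. Cutting the prism
  of height 1 into \<open>m\<close> slices and translating each of them into the layer turns the latter into an
  integral over the prism (\<open>unfold_layer\<close>), where the limit \<open>m \<rightarrow> \<infinity>\<close> can be taken pointwise.

  Both properties of \<open>v\<close> are then obtained with explicit test functions that are built from
  \<open>exp (- 1 / x)\<close>: bumps concentrating on a piece of a face, respectively exhausting a cell.
\<close>

section \<open>Smooth functions\<close>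

abbreviation partial :: "'a::euclidean_space \<Rightarrow> ('a \<Rightarrow> real) \<Rightarrow> 'a \<Rightarrow> real" where
  "partial b f x \<equiv> frechet_derivative f (at x) b"

definition smooth_function :: "('a::euclidean_space \<Rightarrow> real) \<Rightarrow> bool" where
  "smooth_function f \<longleftrightarrow> (\<forall>m. C_k m f)"

lemma frechet_derivative_eq: "(f has_derivative f') (at x) \<Longrightarrow> frechet_derivative f (at x) = f'"
  using frechet_derivative_at by metis

lemma C_k_continuous: "C_k m f \<Longrightarrow> continuous_on UNIV f"
  by (cases m) (auto intro!: continuous_at_imp_continuous_on differentiable_imp_continuous_within)

lemma C_k_Suc_imp: "C_k (Suc m) f \<Longrightarrow> C_k m f"
proof (induction m arbitrary: f)
  case 0
  then show ?case using C_k_continuous[of "Suc 0" f] by simp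
next
  case (Suc m)
  then show ?case by simp
qed

lemma C_k_const [simp]: "C_k m (\<lambda>x. c)"
  by (induction m arbitrary: c) auto

lemma C_k_add: "C_k m f \<Longrightarrow> C_k m g \<Longrightarrow> C_k m (\<lambda>x. f x + g x)"
proof (induction m arbitrary: f g)
  case 0
  then show ?case by (auto intro: continuous_on_add)
next
  case (Suc m)
  have "frechet_derivative (\<lambda>x. f x + g x) (at x)
     = (\<lambda>h. frechet_derivative f (at x) h + frechet_derivative g (at x) h)" for x
    using Suc.prems by (auto intro!: frechet_derivative_eq has_derivative_add simp: frechet_derivative_works[symmetric])
  then show ?case using Suc by auto
qed

lemma C_k_mult: "C_k m f \<Longrightarrow> C_k m g \<Longrightarrow> C_k m (\<lambda>x. f x * g x)"
proof (induction m arbitrary: f g)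
  case 0
  then show ?case by (auto intro: continuous_on_mult)
next
  case (Suc m)
  have "frechet_derivative (\<lambda>x. f x * g x) (at x)
     = (\<lambda>h. f x * frechet_derivative g (at x) h + frechet_derivative f (at x) h * g x)" for x
    using Suc.prems by (auto intro!: frechet_derivative_eq has_derivative_mult simp: frechet_derivative_works[symmetric])
  then show ?case using Suc C_k_Suc_imp[of m f] C_k_Suc_imp[of m g] by (auto intro!: C_k_add)
qed

lemma smooth_functionD:
  assumes "smooth_function f"
  shows "continuous_on UNIV f" "f differentiable (at x)"
  using assms C_k_continuous unfolding smooth_function_def by (blast, metis C_k.simps(2))

lemma smooth_has_derivative:
  "smooth_function f \<Longrightarrow> (f has_derivative frechet_derivative f (at x)) (at x)"
  using smooth_functionD(2) frechet_derivative_works by blast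

lemma smooth_const [simp]: "smooth_function (\<lambda>x. c)"
  by (simp add: smooth_function_def)

lemma smooth_add: "smooth_function f \<Longrightarrow> smooth_function g \<Longrightarrow> smooth_function (\<lambda>x. f x + g x)"
  by (simp add: smooth_function_def C_k_add)

lemma smooth_mult: "smooth_function f \<Longrightarrow> smooth_function g \<Longrightarrow> smooth_function (\<lambda>x. f x * g x)"
  by (simp add: smooth_function_def C_k_mult)

lemma smooth_uminus: "smooth_function f \<Longrightarrow> smooth_function (\<lambda>x. - f x)"
  using smooth_mult[of "\<lambda>x. -1" f] by simp

lemma smooth_diff: "smooth_function f \<Longrightarrow> smooth_function g \<Longrightarrow> smooth_function (\<lambda>x. f x - g x)"
  using smooth_add[OF _ smooth_uminus, of f g] by simp

lemma smooth_sum: "(\<And>i. i \<in> I \<Longrightarrow> smooth_function (f i)) \<Longrightarrow> smooth_function (\<lambda>x. \<Sum>i\<in>I. f i x)"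
  by (induction I rule: infinite_finite_induct) (auto intro: smooth_add)

lemma smooth_prod: "(\<And>i. i \<in> I \<Longrightarrow> smooth_function (f i)) \<Longrightarrow> smooth_function (\<lambda>x. \<Prod>i\<in>I. f i x)"
  by (induction I rule: infinite_finite_induct) (auto intro: smooth_mult)

lemma smooth_power: "smooth_function f \<Longrightarrow> smooth_function (\<lambda>x. f x ^ n)"
  by (induction n) (auto intro: smooth_mult)

lemma smooth_inner: "smooth_function (\<lambda>x. x \<bullet> c)"
proof -
  have "C_k m (\<lambda>x. x \<bullet> c)" for m
  proof (cases m)
    case 0
    then show ?thesis by (auto intro!: continuous_intros)
  next
    case (Suc k)
    have d: "((\<lambda>x. x \<bullet> c) has_derivative (\<lambda>h. h \<bullet> c)) (at x)" for x :: 'a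
      by (auto intro!: derivative_eq_intros)
    then have "frechet_derivative (\<lambda>x. x \<bullet> c) (at x) = (\<lambda>h. h \<bullet> c)" for x :: 'a
      by (rule frechet_derivative_eq)
    then show ?thesis using Suc d by (auto simp: differentiable_def)
  qed
  then show ?thesis by (simp add: smooth_function_def)
qed

lemma smooth_norm_sq: "smooth_function (\<lambda>x :: 'a::euclidean_space. (norm (x - p))\<^sup>2)"
proof -
  have "(\<lambda>x :: 'a. (norm (x - p))\<^sup>2) = (\<lambda>x. \<Sum>b\<in>Basis. (x \<bullet> b - p \<bullet> b) ^ 2)"
    by (rule ext, subst power2_norm_eq_inner, subst euclidean_inner) (simp add: inner_diff_left power2_eq_square)
  then show ?thesis by (auto intro!: smooth_sum smooth_power smooth_diff smooth_inner)
qed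

lemma smooth_partial: "smooth_function f \<Longrightarrow> b \<in> Basis \<Longrightarrow> smooth_function (\<lambda>x. partial b f x)"
  unfolding smooth_function_def by (metis C_k.simps(2))

lemma frechet_derivative_basis_sum:
  fixes f :: "'a::euclidean_space \<Rightarrow> 'b::real_normed_vector"
  assumes "f differentiable (at x)"
  shows "frechet_derivative f (at x) h = (\<Sum>b\<in>Basis. (h \<bullet> b) *\<^sub>R frechet_derivative f (at x) b)"
proof -
  interpret linear "frechet_derivative f (at x)"
    using assms by (rule linear_frechet_derivative)
  have "frechet_derivative f (at x) h = frechet_derivative f (at x) (\<Sum>b\<in>Basis. (h \<bullet> b) *\<^sub>R b)"
    by (simp add: euclidean_representation)
  then show ?thesis by (simp add: sum scaleR)
qed

lemma line_DERIV:
  assumes "smooth_function f"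
  shows "((\<lambda>t. f (x + t *\<^sub>R e)) has_real_derivative partial e f (x + t *\<^sub>R e)) (at t)"
proof -
  have "((\<lambda>t. x + t *\<^sub>R e) has_derivative (\<lambda>h. h *\<^sub>R e)) (at t)"
    by (auto intro!: derivative_eq_intros)
  from has_derivative_compose[OF this smooth_has_derivative[OF assms]]
  have *: "((\<lambda>t. f (x + t *\<^sub>R e)) has_derivative (\<lambda>h. frechet_derivative f (at (x + t *\<^sub>R e)) (h *\<^sub>R e))) (at t)" .
  have "linear (frechet_derivative f (at (x + t *\<^sub>R e)))"
    using smooth_functionD(2)[OF assms] linear_frechet_derivative by blast
  then have "(\<lambda>h. frechet_derivative f (at (x + t *\<^sub>R e)) (h *\<^sub>R e)) = (*) (partial e f (x + t *\<^sub>R e))"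
    by (auto simp: linear_scale)
  with * show ?thesis by (simp add: has_field_derivative_def)
qed

lemma smooth_bounded_on_cball:
  assumes "smooth_function f"
  obtains C where "C \<ge> 0" "\<And>x. x \<in> cball 0 R \<Longrightarrow> \<bar>f x\<bar> \<le> C"
proof -
  have "compact (f ` cball 0 R)"
    using smooth_functionD(1)[OF assms] continuous_on_subset compact_continuous_image compact_cball
    by (metis subset_UNIV)
  then have "bounded (f ` cball 0 R)" by (rule compact_imp_bounded)
  then obtain C where "C > 0" "\<forall>y\<in>f ` cball 0 R. norm y \<le> C" using bounded_pos by blast
  then show ?thesis by (intro that[of C]) auto
qed

lemma smooth_measurable: "smooth_function f \<Longrightarrow> f \<in> borel_measurable borel"
  by (simp add: borel_measurable_continuous_onI smooth_functionD(1))

text \<open>The smooth step \<open>exp (- 1 / x)\<close> (for \<open>p = 1\<close>); the polynomial factor makes the family closed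
  under differentiation.\<close>

definition flat_step :: "real poly \<Rightarrow> real \<Rightarrow> real" where
  "flat_step p x = (if x > 0 then poly p (1 / x) * exp (- (1 / x)) else 0)"

lemma flat_step_tendsto_0: "((\<lambda>x. poly p (1 / x) * exp (- (1 / x))) \<longlongrightarrow> 0) (at_right (0::real))"
proof -
  have "((\<lambda>y. poly p y * exp (- y)) \<longlongrightarrow> 0) (at_top :: real filter)"
  proof -
    have "((\<lambda>y. \<Sum>i\<le>degree p. coeff p i * (y ^ i / exp y)) \<longlongrightarrow> (\<Sum>i\<le>degree p. coeff p i * 0)) (at_top :: real filter)"
      by (intro tendsto_sum tendsto_mult tendsto_const tendsto_power_div_exp_0)
    then show ?thesis
      by (simp add: poly_altdef exp_minus divide_inverse sum_distrib_right mult.assoc)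
  qed
  from filterlim_compose[OF this filterlim_inverse_at_top_right]
  show ?thesis by (simp add: divide_inverse)
qed

text \<open>
  Every derivative of \<open>exp (- 1 / x)\<close> is a polynomial in \<open>1 / x\<close> times the same exponential, which
  beats every such polynomial at the origin; this is why the family is indexed by polynomials.
\<close>

lemma flat_step_DERIV:
  "(flat_step p has_real_derivative flat_step ([:0, 0, 1:] * (p - pderiv p)) x) (at x)"
proof (cases "x = 0")
  case True
  let ?q = "[:0, 1:] * p"
  have 1: "((\<lambda>h. flat_step p h / h) \<longlongrightarrow> 0) (at_right 0)"
    using flat_step_tendsto_0[of ?q]
    by (rule Lim_transform_eventually)
       (auto simp: eventually_at_right_field flat_step_def intro!: exI[of _ 1])
  have 2: "((\<lambda>h. flat_step p h / h) \<longlongrightarrow> 0) (at_left 0)"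
    by (rule Lim_transform_eventually[OF tendsto_const])
       (auto simp: eventually_at_left_field flat_step_def intro!: exI[of _ "-1"])
  have "((\<lambda>h. (flat_step p (0 + h) - flat_step p 0) / h) \<longlongrightarrow> 0) (at 0)"
    using filterlim_split_at[OF 2 1] by (simp add: flat_step_def)
  then show ?thesis using True by (simp add: DERIV_def flat_step_def)
next
  case False
  show ?thesis
  proof (cases "x > 0")
    case True
    have "((\<lambda>x. poly p (1 / x) * exp (- (1 / x))) has_real_derivative
        flat_step ([:0, 0, 1:] * (p - pderiv p)) x) (at x)"
      using True
      by (auto intro!: derivative_eq_intros DERIV_chain'[OF _ poly_DERIV] simp: flat_step_def field_simps power2_eq_square)
    then show ?thesis
      by (rule has_field_derivative_transform_within_open[where S="{0<..}"])
         (use True in \<open>auto simp: flat_step_def\<close>)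
  next
    case F: False
    have "((\<lambda>x. 0) has_real_derivative flat_step ([:0, 0, 1:] * (p - pderiv p)) x) (at x)"
      using F False by (auto simp: flat_step_def)
    then show ?thesis
      by (rule has_field_derivative_transform_within_open[where S="{..<0}"])
         (use F False in \<open>auto simp: flat_step_def\<close>)
  qed
qed

lemma smooth_flat_step:
  fixes f :: "'a::euclidean_space \<Rightarrow> real"
  assumes f: "smooth_function f"
  shows "smooth_function (\<lambda>x. flat_step p (f x))"
proof -
  have d: "((\<lambda>x. flat_step p (f x)) has_derivative
     (\<lambda>h. flat_step ([:0, 0, 1:] * (p - pderiv p)) (f x) * frechet_derivative f (at x) h)) (at x)" for p x
    using has_derivative_compose[OF smooth_has_derivative[OF f, of x]
        flat_step_DERIV[of p "f x", unfolded has_field_derivative_def]]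
    by simp
  have "C_k m (\<lambda>x. flat_step p (f x))" for m p
  proof (induction m arbitrary: p)
    case 0
    have "continuous_on UNIV (\<lambda>x. flat_step p (f x))"
      using d by (meson continuous_at_imp_continuous_on has_derivative_continuous)
    then show ?case by simp
  next
    case (Suc m)
    show ?case
      using Suc d frechet_derivative_eq[OF d] smooth_partial[OF f]
      by (auto simp: differentiable_def smooth_function_def intro!: C_k_mult)
  qed
  then show ?thesis by (simp add: smooth_function_def)
qed

abbreviation smooth_step :: "real \<Rightarrow> real" where "smooth_step \<equiv> flat_step 1"

lemma smooth_step_simps:
  "smooth_step x = (if x > 0 then exp (- (1 / x)) else 0)"
  "0 \<le> smooth_step x" "smooth_step x \<le> 1" "\<bar>smooth_step x\<bar> \<le> 1" "0 < smooth_step x \<longleftrightarrow> 0 < x"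
  by (auto simp: flat_step_def)

text \<open>
  For fixed \<open>s\<close>, the functions vanish unless \<open>n s > 1\<close>. As a function of the distance \<open>s\<close> from the boundary
  this gives smooth cutoffs with support in the interior that tend to 1 there.
\<close>

lemma smooth_step_tendsto_1: "s > 0 \<Longrightarrow> (\<lambda>n. smooth_step (real n * s - 1)) \<longlonglongrightarrow> 1"
proof -
  assume s: "s > 0"
  have "filterlim (\<lambda>n. s * real n) at_top sequentially"
    using s filterlim_tendsto_pos_mult_at_top[OF tendsto_const _ filterlim_real_sequentially] by auto
  then have f: "filterlim (\<lambda>n. -1 + s * real n) at_top sequentially"
    by (rule filterlim_tendsto_add_at_top[OF tendsto_const])
  have "(\<lambda>n. exp (- (1 / (-1 + s * real n)))) \<longlonglongrightarrow> exp (- 0)"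
    by (intro tendsto_exp tendsto_minus) (use tendsto_divide_0[OF tendsto_const filterlim_at_top_imp_at_infinity[OF f]] in simp)
  then have "(\<lambda>n. exp (- (1 / (-1 + s * real n)))) \<longlonglongrightarrow> 1" by simp
  moreover have "eventually (\<lambda>n. -1 + s * real n > 0) sequentially"
    using f[unfolded filterlim_at_top_dense, rule_format, of 0] by simp
  ultimately show ?thesis
    by (elim Lim_transform_eventually, elim eventually_mono)
       (auto simp: smooth_step_simps mult.commute)
qed

section \<open>The divergence theorem for an intersection of half-spaces\<close>

lemma integral_lborel_translate:
  fixes f :: "'a::euclidean_space \<Rightarrow> real"
  assumes [measurable]: "f \<in> borel_measurable borel"
  shows "(LINT x|lborel. f (x + c)) = (LINT x|lborel. f x)"
proof -
  have "(LINT x|lborel. f x) = (LINT x|distr lborel borel ((+) c). f x)"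
    by (simp add: lborel_distr_plus)
  also have "\<dots> = (LINT x|lborel. f (c + x))"
    by (subst integral_distr) auto
  finally show ?thesis by (simp add: add.commute)
qed

lemma integrable_lborel_translate:
  fixes f :: "'a::euclidean_space \<Rightarrow> real"
  assumes "integrable lborel f"
  shows "integrable lborel (\<lambda>x. f (x + c))"
proof -
  have [measurable]: "f \<in> borel_measurable borel" using assms by auto
  have "integrable (distr lborel borel ((+) c)) f"
    using assms by (simp add: lborel_distr_plus)
  then show ?thesis
    by (subst (asm) integrable_distr_eq) (auto simp: add.commute)
qed

lemma integrable_dominated_on_cball:
  fixes f :: "'a::euclidean_space \<Rightarrow> real"
  assumes "f \<in> borel_measurable borel" "\<And>x. \<bar>f x\<bar> \<le> C * indicator (cball 0 R) x"
  shows "integrable lborel f"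
proof (rule Bochner_Integration.integrable_bound)
  show "integrable lborel (\<lambda>x::'a. C * indicator (cball 0 R) x)"
    by (auto intro!: integrable_mult_right integrable_real_indicator emeasure_lborel_cball_finite)
qed (use assms in \<open>auto intro!: AE_I2 intro: order_trans[OF _ abs_ge_self]\<close>)

lemma AE_not_hyperplane:
  fixes a :: "'a::euclidean_space"
  assumes "a \<noteq> 0 \<or> c \<noteq> 0"
  shows "AE x in lborel. a \<bullet> x \<noteq> c"
proof -
  have "negligible {x. a \<bullet> x = c}" using negligible_hyperplane assms by blast
  moreover have "{x. a \<bullet> x = c} \<in> sets borel" by (simp add: closed_hyperplane)
  ultimately have "{x. a \<bullet> x = c} \<in> null_sets lborel"
    by (simp add: negligible_iff_null_sets null_sets_completion_iff)
  then show ?thesis by (auto intro: AE_I'[where N="{x. a \<bullet> x = c}"])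
qed

definition ramp :: "real \<Rightarrow> real" where "ramp s = max 0 (min 1 s)"

lemma ramp_simps: "0 \<le> ramp s" "ramp s \<le> 1" "\<bar>ramp s\<bar> \<le> 1" "s \<le> 0 \<Longrightarrow> ramp s = 0" "1 \<le> s \<Longrightarrow> ramp s = 1"
  by (auto simp: ramp_def)

lemma ramp_lipschitz: "\<bar>ramp s - ramp t\<bar> \<le> \<bar>s - t\<bar>"
  by (auto simp: ramp_def min_def max_def)

lemma ramp_measurable [measurable]: "ramp \<in> borel_measurable borel"
  unfolding ramp_def[abs_def] by measurable

lemma ramp_DERIV:
  assumes "s \<noteq> 0" "s \<noteq> 1"
  shows "(ramp has_real_derivative (if 0 \<le> s \<and> s < 1 then 1 else 0)) (at s)"
proof -
  consider "s < 0" | "0 < s" "s < 1" | "1 < s" using assms by linarith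
  then show ?thesis
  proof cases
    case 1
    have "((\<lambda>x. 0) has_real_derivative (if 0 \<le> s \<and> s < 1 then 1 else 0)) (at s)"
      using 1 by simp
    then show ?thesis
      by (rule has_field_derivative_transform_within_open[where S="{..<0}"]) (use 1 in \<open>auto simp: ramp_def\<close>)
  next
    case 2
    have "((\<lambda>x. x) has_real_derivative (if 0 \<le> s \<and> s < 1 then 1 else 0)) (at s)"
      using 2 by simp
    then show ?thesis
      by (rule has_field_derivative_transform_within_open[where S="{0<..<1}"]) (use 2 in \<open>auto simp: ramp_def\<close>)
  next
    case 3
    have "((\<lambda>x. 1) has_real_derivative (if 0 \<le> s \<and> s < 1 then 1 else 0)) (at s)"
      using 3 by simp
    then show ?thesis
      by (rule has_field_derivative_transform_within_open[where S="{1<..}"]) (use 3 in \<open>auto simp: ramp_def\<close>)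
  qed
qed

text \<open>
  The layer of thickness \<open>1/m\<close> next to the hyperplane \<open>a \<bullet> x = \<beta>\<close> is translated by \<open>k/m\<close> along the
  normal for \<open>k < m\<close>. The translates fill the slab of height 1, and so the factor \<open>m\<close>, which
  would otherwise require a change of variables by scaling, is absorbed.
\<close>

lemma unfold_layer:
  fixes H :: "'a::euclidean_space \<Rightarrow> real"
  assumes H: "integrable lborel (\<lambda>x. if 0 \<le> \<beta> - a \<bullet> x \<and> \<beta> - a \<bullet> x < 1 / real m then H x else 0)"
    (is "integrable lborel ?L")
    and a: "norm a = 1"
  shows "real m * (LINT x|lborel. (if 0 \<le> \<beta> - a \<bullet> x \<and> \<beta> - a \<bullet> x < 1 / real m then H x else 0))
    = (LINT y|lborel. (\<Sum>k<m. (if real k / m \<le> \<beta> - a \<bullet> y \<and> \<beta> - a \<bullet> y < (real k + 1) / m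
           then H (y + (real k / m) *\<^sub>R a) else 0)))"
proof -
  have aa: "a \<bullet> a = 1" using a by (simp add: dot_square_norm)
  have sh: "?L (y + (real k / m) *\<^sub>R a) = (if real k / m \<le> \<beta> - a \<bullet> y \<and> \<beta> - a \<bullet> y < (real k + 1) / m
           then H (y + (real k / m) *\<^sub>R a) else 0)" for k y
    by (rule if_cong) (auto simp: inner_add_right aa add_divide_distrib)
  have "(LINT y|lborel. (\<Sum>k<m. ?L (y + (real k / m) *\<^sub>R a))) = (\<Sum>k<m. (LINT y|lborel. ?L (y + (real k / m) *\<^sub>R a)))"
    by (intro Bochner_Integration.integral_sum integrable_lborel_translate H)
  also have "\<dots> = (\<Sum>k<m. (LINT y|lborel. ?L y))"
    by (intro sum.cong refl integral_lborel_translate) (use H in auto)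
  finally have E: "(LINT y|lborel. (\<Sum>k<m. ?L (y + (real k / m) *\<^sub>R a))) = (\<Sum>k<m. (LINT y|lborel. ?L y))" .
  show ?thesis using E[symmetric] by (simp only: sh sum_constant card_lessThan)
qed

text \<open>
  At each point only the slice that contains it contributes.
\<close>

lemma sum_layers:
  fixes \<tau> :: real and G :: "nat \<Rightarrow> real"
  assumes m: "m > 0"
  shows "(\<Sum>k<m. (if real k / m \<le> \<tau> \<and> \<tau> < (real k + 1) / m then G k else 0))
     = (if 0 \<le> \<tau> \<and> \<tau> < 1 then G (nat \<lfloor>m * \<tau>\<rfloor>) else 0)"
proof -
  have iff: "real k / m \<le> \<tau> \<and> \<tau> < (real k + 1) / m \<longleftrightarrow> 0 \<le> \<tau> \<and> k = nat \<lfloor>m * \<tau>\<rfloor>" for k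
  proof
    assume h: "real k / m \<le> \<tau> \<and> \<tau> < (real k + 1) / m"
    then have "0 \<le> \<tau>" using order_trans[of 0 "real k / m" \<tau>] by simp
    moreover have "real k \<le> m * \<tau>" "m * \<tau> < real k + 1"
      using h m by (auto simp: field_simps)
    then have "\<lfloor>m * \<tau>\<rfloor> = int k" by (simp add: floor_eq_iff)
    ultimately show "0 \<le> \<tau> \<and> k = nat \<lfloor>m * \<tau>\<rfloor>" by simp
  next
    assume h: "0 \<le> \<tau> \<and> k = nat \<lfloor>m * \<tau>\<rfloor>"
    then have "real k = of_int \<lfloor>m * \<tau>\<rfloor>" using m by simp
    then have "real k \<le> m * \<tau>" "m * \<tau> < real k + 1" by linarith+
    then show "real k / m \<le> \<tau> \<and> \<tau> < (real k + 1) / m"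
      using m by (auto simp: field_simps)
  qed
  have lt: "nat \<lfloor>m * \<tau>\<rfloor> < m \<longleftrightarrow> \<tau> < 1" if "0 \<le> \<tau>"
  proof -
    have "nat \<lfloor>m * \<tau>\<rfloor> < m \<longleftrightarrow> \<lfloor>m * \<tau>\<rfloor> < int m" using m by linarith
    also have "\<dots> \<longleftrightarrow> m * \<tau> < m" by (simp add: floor_less_iff)
    also have "\<dots> \<longleftrightarrow> \<tau> < 1" using m by simp
    finally show ?thesis .
  qed
  show ?thesis
  proof (cases "0 \<le> \<tau> \<and> \<tau> < 1")
    case True
    then show ?thesis using lt by (simp add: iff)
  next
    case False
    then have "\<not> (real k / m \<le> \<tau> \<and> \<tau> < (real k + 1) / m)" if "k < m" for k
      using iff[of k] lt that by auto
    then show ?thesis using False by (intro trans[OF sum.neutral]) auto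
  qed
qed

text \<open>
  The map \<open>y + (b i - a i \<bullet> y) *\<^sub>R a i\<close> is the orthogonal projection onto the
  \<open>i\<close>-th hyperplane; the last assumption excludes repeated hyperplanes, so that almost
  no point projects onto two of them.
\<close>

locale halfspace_body =
  fixes I :: "'i set" and a :: "'i \<Rightarrow> 'a::euclidean_space" and b :: "'i \<Rightarrow> real"
  assumes finite_I: "finite I"
    and unit: "\<And>i. i \<in> I \<Longrightarrow> norm (a i) = 1"
    and bounded_body: "bounded {x. \<forall>i\<in>I. 0 \<le> b i - a i \<bullet> x}"
    and transversal: "\<And>i j. i \<in> I \<Longrightarrow> j \<in> I \<Longrightarrow> i \<noteq> j \<Longrightarrow>
        AE y in lborel. b j - a j \<bullet> (y + (b i - a i \<bullet> y) *\<^sub>R a i) \<noteq> 0"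
begin

definition slack :: "'i \<Rightarrow> 'a \<Rightarrow> real" where "slack i x = b i - a i \<bullet> x"
definition foot :: "'i \<Rightarrow> 'a \<Rightarrow> 'a" where "foot i x = x + slack i x *\<^sub>R a i"
definition body :: "'a set" where "body = {x. \<forall>i\<in>I. 0 \<le> slack i x}"

lemma slack_measurable [measurable]: "slack i \<in> borel_measurable borel"
  unfolding slack_def[abs_def] by measurable

lemma foot_measurable [measurable]: "foot i \<in> borel_measurable borel"
  unfolding foot_def[abs_def] by measurable

lemma body_measurable [measurable]: "body \<in> sets borel"
proof -
  have "body = (\<Inter>i\<in>I. {x. 0 \<le> slack i x}) \<inter> UNIV" by (auto simp: body_def)
  moreover have "closed {x. 0 \<le> slack i x}" for i
    unfolding slack_def by (intro closed_Collect_le continuous_intros)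
  ultimately show ?thesis by (metis borel_closed closed_INT closed_Int closed_UNIV)
qed

lemma AE_slack: "i \<in> I \<Longrightarrow> AE x in lborel. slack i x \<noteq> c"
proof -
  assume "i \<in> I"
  then have "a i \<noteq> 0" using unit[of i] by auto
  then have "AE x in lborel. a i \<bullet> x \<noteq> b i - c" by (intro AE_not_hyperplane) simp
  then show ?thesis by eventually_elim (auto simp: slack_def)
qed

definition cutoff :: "nat \<Rightarrow> 'a \<Rightarrow> real" where
  "cutoff m x = (\<Prod>i\<in>I. ramp (real m * slack i x))"

lemma cutoff_measurable [measurable]: "cutoff m \<in> borel_measurable borel"
  unfolding cutoff_def[abs_def] by measurable

lemma cutoff_bounds: "0 \<le> cutoff m x" "cutoff m x \<le> 1" "x \<notin> body \<Longrightarrow> cutoff m x = 0"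
proof -
  show "0 \<le> cutoff m x" "cutoff m x \<le> 1"
    by (auto simp: cutoff_def ramp_simps intro!: prod_nonneg prod_le_1)
  assume "x \<notin> body"
  then obtain i where "i \<in> I" "slack i x < 0" by (auto simp: body_def not_le)
  then show "cutoff m x = 0"
    unfolding cutoff_def using finite_I
    by (intro prod_zero) (auto intro!: bexI[of _ i] ramp_simps mult_nonneg_nonpos)
qed

text \<open>
  The cutoff need not be differentiable, so the difference quotients are bounded by its Lipschitz constant.
\<close>

lemma cutoff_lipschitz:
  "\<bar>cutoff m (x + t *\<^sub>R e) - cutoff m x\<bar> \<le> real m * \<bar>t\<bar> * (\<Sum>i\<in>I. \<bar>a i \<bullet> e\<bar>)"
proof -
  have "norm (cutoff m (x + t *\<^sub>R e) - cutoff m x)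
      \<le> (\<Sum>i\<in>I. norm (ramp (real m * slack i (x + t *\<^sub>R e)) - ramp (real m * slack i x)))"
    unfolding cutoff_def by (intro norm_prod_diff) (auto simp: ramp_simps)
  also have "\<dots> \<le> (\<Sum>i\<in>I. real m * \<bar>t\<bar> * \<bar>a i \<bullet> e\<bar>)"
  proof (intro sum_mono)
    fix i assume "i \<in> I"
    have "\<bar>ramp (real m * slack i (x + t *\<^sub>R e)) - ramp (real m * slack i x)\<bar>
       \<le> \<bar>real m * slack i (x + t *\<^sub>R e) - real m * slack i x\<bar>" by (rule ramp_lipschitz)
    also have "real m * slack i (x + t *\<^sub>R e) - real m * slack i x = - (real m * t * (a i \<bullet> e))"
      by (simp add: slack_def algebra_simps inner_add_right)
    finally show "norm (ramp (real m * slack i (x + t *\<^sub>R e)) - ramp (real m * slack i x)) \<le> real m * \<bar>t\<bar> * \<bar>a i \<bullet> e\<bar>"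
      by (simp add: abs_mult)
  qed
  finally show ?thesis by (simp add: sum_distrib_left)
qed

text \<open>
  The factor of \<open>- m (a i \<bullet> e)\<close> in the derivative of the cutoff in direction \<open>e\<close>: the derivative of
  the \<open>i\<close>-th ramp is supported in the layer along the \<open>i\<close>-th facet.
\<close>

definition layer :: "nat \<Rightarrow> 'i \<Rightarrow> 'a \<Rightarrow> real" where
  "layer m i x = (if 0 \<le> slack i x \<and> slack i x < 1 / real m
     then (\<Prod>j\<in>I - {i}. ramp (real m * slack j x)) else 0)"

lemma layer_measurable [measurable]: "layer m i \<in> borel_measurable borel"
  unfolding layer_def[abs_def] by measurable

lemma layer_bounds: "0 \<le> layer m i x" "layer m i x \<le> 1" "i \<in> I \<Longrightarrow> x \<notin> body \<Longrightarrow> layer m i x = 0"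
proof -
  show "0 \<le> layer m i x" "layer m i x \<le> 1"
    by (auto simp: layer_def ramp_simps intro!: prod_nonneg prod_le_1)
  assume i: "i \<in> I" "x \<notin> body"
  show "layer m i x = 0"
  proof (cases "slack i x < 0")
    case False
    then obtain j where "j \<in> I - {i}" "slack j x < 0" using i by (auto simp: body_def not_le)
    then have "(\<Prod>j\<in>I - {i}. ramp (real m * slack j x)) = 0"
      using finite_I by (intro prod_zero) (auto intro!: bexI[of _ j] ramp_simps mult_nonneg_nonpos)
    then show ?thesis by (simp add: layer_def)
  qed (simp add: layer_def)
qed

lemma cutoff_DERIV:
  assumes m: "m > 0" and nz: "\<And>i. i \<in> I \<Longrightarrow> slack i x \<noteq> 0 \<and> slack i x \<noteq> 1 / real m"
  shows "((\<lambda>t. cutoff m (x + t *\<^sub>R e)) has_real_derivative (- (\<Sum>i\<in>I. real m * (a i \<bullet> e) * layer m i x))) (at 0)"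
proof -
  have d: "((\<lambda>t. ramp (real m * slack i (x + t *\<^sub>R e))) has_derivative
     (*) ((if 0 \<le> slack i x \<and> slack i x < 1 / real m then 1 else 0) * (- real m * (a i \<bullet> e)))) (at 0)"
    if "i \<in> I" for i
  proof -
    have 1: "((\<lambda>t. real m * slack i (x + t *\<^sub>R e)) has_real_derivative (- real m * (a i \<bullet> e))) (at 0)"
      unfolding slack_def by (auto intro!: derivative_eq_intros simp: inner_add_right)
    have "real m * slack i x \<noteq> 0" "real m * slack i x \<noteq> 1"
      using nz[OF that] m by (auto simp: field_simps)
    from DERIV_chain2[OF ramp_DERIV[of "real m * slack i (x + 0 *\<^sub>R e)"] 1] this
    have "((\<lambda>t. ramp (real m * slack i (x + t *\<^sub>R e))) has_real_derivative
      (if 0 \<le> real m * slack i x \<and> real m * slack i x < 1 then 1 else 0) * (- real m * (a i \<bullet> e))) (at 0)"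
      by simp
    moreover have "0 \<le> real m * slack i x \<and> real m * slack i x < 1 \<longleftrightarrow> 0 \<le> slack i x \<and> slack i x < 1 / real m"
      using m by (simp add: field_simps zero_le_mult_iff)
    ultimately show ?thesis by (simp only: has_field_derivative_def)
  qed
  have "((\<lambda>t. cutoff m (x + t *\<^sub>R e)) has_derivative
     (\<lambda>h. \<Sum>i\<in>I. (if 0 \<le> slack i x \<and> slack i x < 1 / real m then 1 else 0) * (- real m * (a i \<bullet> e)) * h *
         (\<Prod>j\<in>I - {i}. ramp (real m * slack j (x + 0 *\<^sub>R e))))) (at 0)"
    unfolding cutoff_def by (rule has_derivative_prod[OF d])
  moreover have "(\<lambda>h. \<Sum>i\<in>I. (if 0 \<le> slack i x \<and> slack i x < 1 / real m then 1 else 0) * (- real m * (a i \<bullet> e)) * h *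
         (\<Prod>j\<in>I - {i}. ramp (real m * slack j (x + 0 *\<^sub>R e))))
     = (*) (- (\<Sum>i\<in>I. real m * (a i \<bullet> e) * layer m i x))"
    by (rule ext) (auto simp: layer_def sum_distrib_left sum_distrib_right sum_negf[symmetric] intro!: sum.cong)
  ultimately show ?thesis by (simp add: has_field_derivative_def)
qed

text \<open>
  The left and right sides are the two parts of \<open>\<partial>\<^sub>e (cutoff * f)\<close>, whose integral is zero: it is the limit of
  the integrals of the difference quotients, all of which vanish by translation invariance.
\<close>

lemma cutoff_integral:
  assumes f: "smooth_function f" and e: "e \<in> Basis" and m: "m > 0"
  shows "(LINT x|lborel. cutoff m x * partial e f x)
     = (\<Sum>i\<in>I. (a i \<bullet> e) * (real m * (LINT x|lborel. layer m i x * f x)))"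
proof -
  have "bounded body" using bounded_body by (simp add: body_def slack_def)
  then obtain B where B: "B > 0" "\<And>x. x \<in> body \<Longrightarrow> norm x \<le> B"
    by (meson bounded_pos)
  have fm [measurable]: "f \<in> borel_measurable borel" by (rule smooth_measurable[OF f])
  have f': "smooth_function (partial e f)" using smooth_partial[OF f e] .
  then have f'm [measurable]: "(\<lambda>x. partial e f x) \<in> borel_measurable borel" by (rule smooth_measurable)
  obtain C where C: "C \<ge> 0" "\<And>x. x \<in> cball 0 (B + 2) \<Longrightarrow> \<bar>f x\<bar> \<le> C"
    using smooth_bounded_on_cball[OF f] by blast
  obtain C' where C': "C' \<ge> 0" "\<And>x. x \<in> cball 0 (B + 2) \<Longrightarrow> \<bar>partial e f x\<bar> \<le> C'"
    using smooth_bounded_on_cball[OF f'] by blast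
  define L where "L = real m * (\<Sum>i\<in>I. \<bar>a i \<bullet> e\<bar>)"
  have L0: "L \<ge> 0" by (auto simp: L_def intro!: mult_nonneg_nonneg sum_nonneg)
  define g where "g x = cutoff m x * f x" for x
  have [measurable]: "g \<in> borel_measurable borel" unfolding g_def[abs_def] by measurable
  define t where "t n = inverse (real (Suc n))" for n
  have t: "0 < t n" "t n \<le> 1" for n by (auto simp: t_def field_simps)
  have g_int: "integrable lborel g"
  proof (rule integrable_dominated_on_cball[of _ C "B + 1"])
    show "\<bar>g x\<bar> \<le> C * indicator (cball 0 (B + 1)) x" for x
    proof (cases "x \<in> body")
      case True
      then have "norm x \<le> B" using B by blast
      moreover have "\<bar>cutoff m x\<bar> * \<bar>f x\<bar> \<le> 1 * C"
        using C(2)[of x] \<open>norm x \<le> B\<close> cutoff_bounds[where m=m and x=x] by (intro mult_mono) auto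
      ultimately show ?thesis by (simp add: g_def abs_mult indicator_def)
    qed (use cutoff_bounds C in \<open>auto simp: g_def\<close>)
  qed measurable
  define q where "q n x = (g (x + t n *\<^sub>R e) - g x) / t n" for n x
  define g' where "g' x = cutoff m x * partial e f x - (\<Sum>i\<in>I. (a i \<bullet> e) * (real m * (layer m i x * f x)))" for x
  have q0: "(LINT x|lborel. q n x) = 0" for n
    unfolding q_def using g_int integrable_lborel_translate[OF g_int] integral_lborel_translate[of g]
    by (simp add: integral_diff)
  have lip: "\<bar>q n x\<bar> \<le> (C' + C * L) * indicator (cball 0 (B + 1)) x" for n x
  proof (cases "norm x \<le> B + 1")
    case False
    have "norm x \<le> norm (x + t n *\<^sub>R e) + norm (t n *\<^sub>R e)"
      by (metis add_diff_cancel_right' norm_triangle_ineq4)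
    then have "norm (x + t n *\<^sub>R e) > B" using False t[of n] norm_Basis[OF e] by simp
    then have "x + t n *\<^sub>R e \<notin> body" "x \<notin> body" using B(2)[of "x + t n *\<^sub>R e"] B(2)[of x] False by auto
    then show ?thesis using False by (simp add: q_def g_def cutoff_bounds)
  next
    case True
    have seg: "x + s *\<^sub>R e \<in> cball 0 (B + 2)" if "0 \<le> s" "s \<le> t n" for s
    proof -
      have "norm (x + s *\<^sub>R e) \<le> norm x + \<bar>s\<bar> * norm e" using norm_triangle_ineq[of x "s *\<^sub>R e"] by simp
      also have "\<dots> \<le> B + 2" using True that t[of n] norm_Basis[OF e] by simp
      finally show ?thesis by simp
    qed
    obtain s where s: "0 < s" "s < t n"
      "f (x + t n *\<^sub>R e) - f (x + 0 *\<^sub>R e) = (t n - 0) * partial e f (x + s *\<^sub>R e)"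
      using MVT2[of 0 "t n" "\<lambda>t. f (x + t *\<^sub>R e)" "\<lambda>t. partial e f (x + t *\<^sub>R e)", OF t(1)]
        line_DERIV[OF f] by blast
    have 1: "\<bar>f (x + t n *\<^sub>R e) - f x\<bar> \<le> t n * C'"
      using s C'(2)[OF seg, of s] t[of n] by (simp add: abs_mult)
    have 2: "\<bar>cutoff m (x + t n *\<^sub>R e) - cutoff m x\<bar> \<le> t n * L"
      using cutoff_lipschitz[where m=m and x=x and t="t n" and e=e] t[of n] by (simp add: L_def mult_ac)
    have "g (x + t n *\<^sub>R e) - g x = cutoff m (x + t n *\<^sub>R e) * (f (x + t n *\<^sub>R e) - f x)
        + f x * (cutoff m (x + t n *\<^sub>R e) - cutoff m x)"
      by (simp add: g_def algebra_simps)
    also have "\<bar>\<dots>\<bar> \<le> 1 * (t n * C') + C * (t n * L)"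
    proof (intro order_trans[OF abs_triangle_ineq] add_mono)
      show "\<bar>cutoff m (x + t n *\<^sub>R e) * (f (x + t n *\<^sub>R e) - f x)\<bar> \<le> 1 * (t n * C')"
        unfolding abs_mult using 1 cutoff_bounds by (intro mult_mono) auto
      show "\<bar>f x * (cutoff m (x + t n *\<^sub>R e) - cutoff m x)\<bar> \<le> C * (t n * L)"
        unfolding abs_mult using 2 C seg[of 0] t[of n] by (intro mult_mono) auto
    qed
    finally have "\<bar>g (x + t n *\<^sub>R e) - g x\<bar> \<le> (C' + C * L) * t n" by (simp add: algebra_simps)
    then have "\<bar>q n x\<bar> \<le> C' + C * L" using t[of n] by (simp add: q_def field_simps)
    then show ?thesis using True by simp
  qed
  have lim: "AE x in lborel. (\<lambda>n. q n x) \<longlonglongrightarrow> g' x"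
  proof -
    have "AE x in lborel. \<forall>i\<in>I. slack i x \<noteq> 0 \<and> slack i x \<noteq> 1 / real m"
      using finite_I by (intro AE_finite_allI AE_conjI AE_slack) auto
    then show ?thesis
    proof eventually_elim
      case (elim x)
      have "((\<lambda>t. cutoff m (x + t *\<^sub>R e)) has_real_derivative (- (\<Sum>i\<in>I. real m * (a i \<bullet> e) * layer m i x))) (at 0)"
        using elim by (intro cutoff_DERIV m) auto
      from DERIV_mult[OF this line_DERIV[OF f, of x e 0]]
      have "((\<lambda>t. g (x + t *\<^sub>R e)) has_real_derivative g' x) (at 0)"
        by (simp add: g_def[abs_def] g'_def sum_distrib_left sum_distrib_right mult_ac add.commute)
      then have "((\<lambda>h. (g (x + h *\<^sub>R e) - g x) / h) \<longlongrightarrow> g' x) (at 0)" by (simp add: DERIV_def)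
      moreover have "filterlim t (at 0) sequentially"
        using LIMSEQ_inverse_real_of_nat by (auto simp: filterlim_at t_def[abs_def])
      ultimately show ?case unfolding q_def by (rule filterlim_compose)
    qed
  qed
  have lb: "\<bar>layer m i x * f x\<bar> \<le> C * indicator (cball 0 (B + 1)) x" if "i \<in> I" for i x
  proof (cases "x \<in> body")
    case True
    then have "norm x \<le> B" using B by blast
    moreover have "\<bar>layer m i x\<bar> * \<bar>f x\<bar> \<le> 1 * C"
      using C(2)[of x] \<open>norm x \<le> B\<close> layer_bounds[where m=m and i=i and x=x] by (intro mult_mono) auto
    ultimately show ?thesis by (simp add: abs_mult indicator_def)
  qed (use layer_bounds(3)[OF that] C in auto)
  have li: "integrable lborel (\<lambda>x. layer m i x * f x)" if "i \<in> I" for i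
    by (rule integrable_dominated_on_cball[OF _ lb[OF that]]) measurable
  have ci: "integrable lborel (\<lambda>x. cutoff m x * partial e f x)"
  proof (rule integrable_dominated_on_cball[of _ C' "B + 1"])
    show "\<bar>cutoff m x * partial e f x\<bar> \<le> C' * indicator (cball 0 (B + 1)) x" for x
    proof (cases "x \<in> body")
      case True
      then have "norm x \<le> B" using B by blast
      moreover have "\<bar>cutoff m x\<bar> * \<bar>partial e f x\<bar> \<le> 1 * C'"
        using C'(2)[of x] \<open>norm x \<le> B\<close> cutoff_bounds[where m=m and x=x] by (intro mult_mono) auto
      ultimately show ?thesis by (simp add: abs_mult indicator_def)
    qed (use cutoff_bounds C' in auto)
  qed measurable
  have g'm: "g' \<in> borel_measurable borel" unfolding g'_def[abs_def] by measurable
  have "(\<lambda>n. LINT x|lborel. q n x) \<longlonglongrightarrow> (LINT x|lborel. g' x)"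
  proof (rule integral_dominated_convergence[where w="\<lambda>x. (C' + C * L) * indicator (cball 0 (B + 1)) x"])
    show "integrable lborel (\<lambda>x::'a. (C' + C * L) * indicator (cball 0 (B + 1)) x)"
      by (auto intro!: integrable_mult_right integrable_real_indicator emeasure_lborel_cball_finite)
  qed (use g'm lim lip in \<open>auto simp: q_def\<close>)
  then have "(LINT x|lborel. g' x) = 0" by (simp add: q0 LIMSEQ_const_iff)
  moreover have "(LINT x|lborel. g' x) = (LINT x|lborel. cutoff m x * partial e f x)
      - (\<Sum>i\<in>I. (a i \<bullet> e) * (real m * (LINT x|lborel. layer m i x * f x)))"
  proof -
    have s: "integrable lborel (\<lambda>x. \<Sum>i\<in>I. (a i \<bullet> e) * (real m * (layer m i x * f x)))"
      by (intro Bochner_Integration.integrable_sum integrable_mult_right li)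
    have "(LINT x|lborel. (\<Sum>i\<in>I. (a i \<bullet> e) * (real m * (layer m i x * f x))))
       = (\<Sum>i\<in>I. (a i \<bullet> e) * (real m * (LINT x|lborel. layer m i x * f x)))"
      by (subst Bochner_Integration.integral_sum) (auto intro!: integrable_mult_right li)
    then show ?thesis unfolding g'_def Bochner_Integration.integral_diff[OF ci s] by simp
  qed
  ultimately show ?thesis by simp
qed

lemma ramp_tendsto: "s > 0 \<Longrightarrow> (\<lambda>n. ramp (real (Suc n) * s)) \<longlonglongrightarrow> 1"
proof -
  assume s: "s > 0"
  have "eventually (\<lambda>n. 1 / s \<le> real n) sequentially"
    by (rule eventually_ge_at_top[THEN eventually_compose_filterlim, OF filterlim_real_sequentially])
  then have "eventually (\<lambda>n. ramp (real (Suc n) * s) = 1) sequentially"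
    by eventually_elim (use s in \<open>auto simp: field_simps intro!: ramp_simps(5)\<close>)
  then show ?thesis by (rule tendsto_eventually)
qed

lemma ramp_tendsto_moving:
  assumes "z \<longlonglongrightarrow> z0" "0 < slack j z0"
  shows "(\<lambda>n. ramp (real (Suc n) * slack j (z n))) \<longlonglongrightarrow> 1"
proof -
  have l: "(\<lambda>n. slack j (z n)) \<longlonglongrightarrow> slack j z0"
    unfolding slack_def by (intro tendsto_intros assms)
  have "eventually (\<lambda>n. slack j z0 / 2 < slack j (z n)) sequentially"
    using l assms(2) by (intro order_tendstoD) auto
  moreover have "eventually (\<lambda>n. 2 / slack j z0 \<le> real n) sequentially"
    by (rule eventually_ge_at_top[THEN eventually_compose_filterlim, OF filterlim_real_sequentially])
  ultimately have "eventually (\<lambda>n. ramp (real (Suc n) * slack j (z n)) = 1) sequentially"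
  proof eventually_elim
    case (elim n)
    have "1 = (2 / slack j z0) * (slack j z0 / 2)" using assms(2) by simp
    also have "\<dots> \<le> real (Suc n) * slack j (z n)"
      using elim assms(2) by (intro mult_mono) auto
    finally show ?case by (rule ramp_simps(5))
  qed
  then show ?thesis by (rule tendsto_eventually)
qed

text \<open>
  After unfolding the layer onto the prism of height 1, the integrand at \<open>y\<close> is evaluated at a point
  \<open>S m y\<close> that lies at distance less than \<open>1/m\<close> from the hyperplane and above the same foot. It
  therefore tends to the foot of \<open>y\<close>, and the remaining ramps tend to the indicator function of the body.
\<close>

lemma layer_integral_tendsto:
  assumes f: "smooth_function f" and i: "i \<in> I"
  shows "(\<lambda>n. real (Suc n) * (LINT x|lborel. layer (Suc n) i x * f x))
     \<longlonglongrightarrow> (LINT y|lborel. (if 0 \<le> slack i y \<and> slack i y \<le> 1 \<and> foot i y \<in> body then f (foot i y) else 0))"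
proof -
  have "bounded body" using bounded_body by (simp add: body_def slack_def)
  then obtain B where B: "B > 0" "\<And>x. x \<in> body \<Longrightarrow> norm x \<le> B"
    by (meson bounded_pos)
  have fm [measurable]: "f \<in> borel_measurable borel" by (rule smooth_measurable[OF f])
  obtain C where C: "C \<ge> 0" "\<And>x. x \<in> cball 0 B \<Longrightarrow> \<bar>f x\<bar> \<le> C"
    using smooth_bounded_on_cball[OF f] by blast
  have fb: "\<bar>f x\<bar> \<le> C" if "x \<in> body" for x using C(2)[of x] B(2)[OF that] by simp
  have aa: "a i \<bullet> a i = 1" using unit[OF i] by (simp add: dot_square_norm)
  define H where "H m x = (\<Prod>j\<in>I - {i}. ramp (real m * slack j x)) * f x" for m x
  define S where "S m y = y + (real (nat \<lfloor>real m * slack i y\<rfloor>) / real m) *\<^sub>R a i" for m y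
  define G where "G m y = (\<Sum>k<m. (if real k / m \<le> b i - a i \<bullet> y \<and> b i - a i \<bullet> y < (real k + 1) / m
           then H m (y + (real k / m) *\<^sub>R a i) else 0))" for m y
  have G_eq: "G m y = (if 0 \<le> slack i y \<and> slack i y < 1 then H m (S m y) else 0)" if "m > 0" for m y
    unfolding G_def S_def slack_def
    by (subst sum_layers[OF that, of "b i - a i \<bullet> y" "\<lambda>k. H m (y + (real k / m) *\<^sub>R a i)"]) simp
  have HL: "(if 0 \<le> b i - a i \<bullet> x \<and> b i - a i \<bullet> x < 1 / real m then H m x else 0) = layer m i x * f x" for m x
    by (simp add: H_def layer_def slack_def)
  have lb: "\<bar>layer m i x * f x\<bar> \<le> C * indicator (cball 0 B) x" for m x
  proof (cases "x \<in> body")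
    case True
    have "\<bar>layer m i x\<bar> * \<bar>f x\<bar> \<le> 1 * C"
      using fb[OF True] layer_bounds[where m=m and i=i and x=x] by (intro mult_mono) auto
    then show ?thesis using B(2)[OF True] by (simp add: abs_mult indicator_def)
  qed (use layer_bounds i C in auto)
  have li: "integrable lborel (\<lambda>x. layer m i x * f x)" for m
    by (rule integrable_dominated_on_cball[OF _ lb]) measurable
  have int_eq: "real m * (LINT x|lborel. layer m i x * f x) = (LINT y|lborel. G m y)" for m
    using unfold_layer[of "b i" "a i" m "H m"] li[of m] unit[OF i] by (simp only: HL G_def)
  have S_slack: "0 \<le> slack i (S m y)" "slack i (S m y) < 1 / real m" "norm (S m y - y) \<le> 1"
    if "0 \<le> slack i y" "slack i y < 1" "m > 0" for m y
  proof -
    have r: "real (nat \<lfloor>real m * slack i y\<rfloor>) = of_int \<lfloor>real m * slack i y\<rfloor>" using that by simp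
    have s: "slack i (S m y) = slack i y - real (nat \<lfloor>real m * slack i y\<rfloor>) / real m"
      by (simp add: S_def slack_def inner_add_right aa)
    have "of_int \<lfloor>real m * slack i y\<rfloor> / real m \<le> slack i y" "slack i y < of_int \<lfloor>real m * slack i y\<rfloor> / real m + 1 / real m"
      using that(3) by (auto simp: field_simps) linarith+
    then show "0 \<le> slack i (S m y)" "slack i (S m y) < 1 / real m" by (simp_all add: s r)
    have "norm (S m y - y) = of_int \<lfloor>real m * slack i y\<rfloor> / real m"
      using that r unit[OF i] by (simp add: S_def)
    then show "norm (S m y - y) \<le> 1"
      using \<open>of_int \<lfloor>real m * slack i y\<rfloor> / real m \<le> slack i y\<close> that by linarith
  qed
  have H_layer: "H m (S m y) = layer m i (S m y) * f (S m y)" if "0 \<le> slack i y" "slack i y < 1" "m > 0" for m y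
    using S_slack[OF that] by (simp add: layer_def H_def)
  have G_bound: "\<bar>G m y\<bar> \<le> C * indicator (cball 0 (B + 1)) y" if "m > 0" for m y
  proof (cases "0 \<le> slack i y \<and> slack i y < 1")
    case True
    then have "G m y = layer m i (S m y) * f (S m y)" using G_eq[OF that] H_layer that by simp
    also have "\<bar>\<dots>\<bar> \<le> C * indicator (cball 0 B) (S m y)" by (rule lb)
    also have "\<dots> \<le> C * indicator (cball 0 (B + 1)) y"
    proof -
      have "norm y \<le> norm (S m y) + norm (S m y - y)"
        by (metis add_diff_cancel_left' diff_add_cancel norm_triangle_ineq4)
      then show ?thesis using S_slack(3)[of y m] True that C(1) by (auto simp: indicator_def)
    qed
    finally show ?thesis .
  qed (use G_eq[OF that] C in auto)
  have lim: "AE y in lborel. (\<lambda>n. G (Suc n) y) \<longlonglongrightarrow>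
      (if 0 \<le> slack i y \<and> slack i y \<le> 1 \<and> foot i y \<in> body then f (foot i y) else 0)"
  proof -
    have "AE y in lborel. \<forall>j\<in>I - {i}. slack j (foot i y) \<noteq> 0"
      using finite_I transversal[OF i] by (intro AE_finite_allI) (auto simp: slack_def foot_def)
    moreover have "AE y in lborel. slack i y \<noteq> 1" by (rule AE_slack[OF i])
    ultimately show ?thesis
    proof eventually_elim
      case (elim y)
      show ?case
      proof (cases "0 \<le> slack i y \<and> slack i y < 1")
        case True
        have Sl: "(\<lambda>n. S (Suc n) y) \<longlonglongrightarrow> foot i y"
        proof -
          have "(\<lambda>n. real (nat \<lfloor>real (Suc n) * slack i y\<rfloor>) / real (Suc n)) \<longlonglongrightarrow> slack i y"
          proof (rule tendsto_sandwich)
            show "(\<lambda>n. slack i y - inverse (real (Suc n))) \<longlonglongrightarrow> slack i y"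
              using tendsto_diff[OF tendsto_const LIMSEQ_inverse_real_of_nat, of "slack i y"] by simp
            show "(\<lambda>n. slack i y) \<longlonglongrightarrow> slack i y" by simp
            have "slack i y - inverse (real (Suc n)) \<le> real (nat \<lfloor>real (Suc n) * slack i y\<rfloor>) / real (Suc n)
                \<and> real (nat \<lfloor>real (Suc n) * slack i y\<rfloor>) / real (Suc n) \<le> slack i y" for n
            proof -
              have r: "real (nat \<lfloor>real (Suc n) * slack i y\<rfloor>) = of_int \<lfloor>real (Suc n) * slack i y\<rfloor>"
                using True by simp
              have "of_int \<lfloor>real (Suc n) * slack i y\<rfloor> \<le> real (Suc n) * slack i y"
                "real (Suc n) * slack i y - 1 \<le> of_int \<lfloor>real (Suc n) * slack i y\<rfloor>"
                by linarith+
              then have "(real (Suc n) * slack i y - 1) / real (Suc n) \<le> of_int \<lfloor>real (Suc n) * slack i y\<rfloor> / real (Suc n)"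
                "of_int \<lfloor>real (Suc n) * slack i y\<rfloor> / real (Suc n) \<le> (real (Suc n) * slack i y) / real (Suc n)"
                by (intro divide_right_mono; simp)+
              then show ?thesis unfolding r by (simp add: diff_divide_distrib inverse_eq_divide del: of_nat_Suc)
            qed
            then show "eventually (\<lambda>n. slack i y - inverse (real (Suc n)) \<le> real (nat \<lfloor>real (Suc n) * slack i y\<rfloor>) / real (Suc n)) sequentially"
              "eventually (\<lambda>n. real (nat \<lfloor>real (Suc n) * slack i y\<rfloor>) / real (Suc n) \<le> slack i y) sequentially"
              by auto
          qed
          then show ?thesis unfolding S_def foot_def by (intro tendsto_intros)
        qed
        have fl: "(\<lambda>n. f (S (Suc n) y)) \<longlonglongrightarrow> f (foot i y)"
          using smooth_functionD(1)[OF f] Sl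
          by (auto simp: continuous_on_eq_continuous_at intro: isCont_tendsto_compose)
        have si: "slack i (foot i y) = 0" by (simp add: foot_def slack_def inner_add_right aa)
        have "(\<lambda>n. H (Suc n) (S (Suc n) y)) \<longlonglongrightarrow> (if foot i y \<in> body then f (foot i y) else 0)"
        proof (cases "foot i y \<in> body")
          case True
          then have pos: "0 < slack j (foot i y)" if "j \<in> I - {i}" for j
            using elim that by (force simp: body_def)
          have "(\<lambda>n. (\<Prod>j\<in>I - {i}. ramp (real (Suc n) * slack j (S (Suc n) y)))) \<longlonglongrightarrow> (\<Prod>j\<in>I - {i}. 1)"
            by (intro tendsto_prod ramp_tendsto_moving[OF Sl] pos)
          from tendsto_mult[OF this fl] True show ?thesis by (simp add: H_def)
        next
          case False
          then obtain j where j: "j \<in> I - {i}" "slack j (foot i y) < 0"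
            using si by (force simp: body_def not_le)
          have "(\<lambda>n. slack j (S (Suc n) y)) \<longlonglongrightarrow> slack j (foot i y)"
            unfolding slack_def by (intro tendsto_intros Sl)
          then have "eventually (\<lambda>n. slack j (S (Suc n) y) < 0) sequentially"
            using j by (intro order_tendstoD) auto
          then have "eventually (\<lambda>n. H (Suc n) (S (Suc n) y) = 0) sequentially"
          proof eventually_elim
            case (elim n)
            have "ramp (real (Suc n) * slack j (S (Suc n) y)) = 0"
              using elim by (intro ramp_simps mult_nonneg_nonpos) auto
            then have "(\<Prod>j\<in>I - {i}. ramp (real (Suc n) * slack j (S (Suc n) y))) = 0"
              using j finite_I by (intro prod_zero) auto
            then show ?case by (simp add: H_def)
          qed
          then show ?thesis using False by (auto intro: tendsto_eventually)
        qed
        then show ?thesis using True by (simp add: G_eq)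
      next
        case False
        then have "\<not> (0 \<le> slack i y \<and> slack i y \<le> 1)" using elim by auto
        then have "(if 0 \<le> slack i y \<and> slack i y \<le> 1 \<and> foot i y \<in> body then f (foot i y) else 0) = 0" by auto
        moreover have "G (Suc n) y = 0" for n using False G_eq[of "Suc n" y] by auto
        ultimately show ?thesis by (simp only: tendsto_const)
      qed
    qed
  qed
  have Gm: "G m \<in> borel_measurable borel" for m
    unfolding G_def[abs_def] H_def by measurable
  have "(\<lambda>n. LINT y|lborel. G (Suc n) y) \<longlonglongrightarrow>
     (LINT y|lborel. (if 0 \<le> slack i y \<and> slack i y \<le> 1 \<and> foot i y \<in> body then f (foot i y) else 0))"
  proof (rule integral_dominated_convergence[where w="\<lambda>x. C * indicator (cball 0 (B + 1)) x"])
    show "integrable lborel (\<lambda>x::'a. C * indicator (cball 0 (B + 1)) x)"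
      by (auto intro!: integrable_mult_right integrable_real_indicator emeasure_lborel_cball_finite)
    show "AE x in lborel. norm (G (Suc n) x) \<le> C * indicator (cball 0 (B + 1)) x" for n
      using G_bound by auto
    show "(\<lambda>y. if 0 \<le> slack i y \<and> slack i y \<le> 1 \<and> foot i y \<in> body then f (foot i y) else 0) \<in> borel_measurable lborel"
      by measurable
  qed (use Gm lim in auto)
  then show ?thesis by (simp only: int_eq)
qed

lemma cutoff_integral_tendsto:
  assumes f: "smooth_function f"
  shows "(\<lambda>n. LINT x|lborel. cutoff (Suc n) x * f x) \<longlonglongrightarrow> (LINT x|lborel. indicator body x * f x)"
proof -
  have "bounded body" using bounded_body by (simp add: body_def slack_def)
  then obtain B where B: "B > 0" "\<And>x. x \<in> body \<Longrightarrow> norm x \<le> B"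
    by (meson bounded_pos)
  have fm [measurable]: "f \<in> borel_measurable borel" by (rule smooth_measurable[OF f])
  obtain C where C: "C \<ge> 0" "\<And>x. x \<in> cball 0 B \<Longrightarrow> \<bar>f x\<bar> \<le> C"
    using smooth_bounded_on_cball[OF f] by blast
  show ?thesis
  proof (rule integral_dominated_convergence[where w="\<lambda>x. C * indicator (cball 0 B) x"])
    show "integrable lborel (\<lambda>x::'a. C * indicator (cball 0 B) x)"
      by (auto intro!: integrable_mult_right integrable_real_indicator emeasure_lborel_cball_finite)
    have "\<bar>cutoff m x * f x\<bar> \<le> C * indicator (cball 0 B) x" for m x
    proof (cases "x \<in> body")
      case True
      have "\<bar>cutoff m x\<bar> * \<bar>f x\<bar> \<le> 1 * C"
        using C(2)[of x] B(2)[OF True] cutoff_bounds[where m=m and x=x] by (intro mult_mono) auto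
      then show ?thesis using B(2)[OF True] by (simp add: abs_mult indicator_def)
    qed (use cutoff_bounds C in auto)
    then show "AE x in lborel. norm (cutoff (Suc n) x * f x) \<le> C * indicator (cball 0 B) x" for n by simp
    have "AE x in lborel. \<forall>i\<in>I. slack i x \<noteq> 0"
      using finite_I by (intro AE_finite_allI AE_slack) auto
    then show "AE x in lborel. (\<lambda>n. cutoff (Suc n) x * f x) \<longlonglongrightarrow> indicator body x * f x"
    proof eventually_elim
      case (elim x)
      show ?case
      proof (cases "x \<in> body")
        case True
        then have "0 < slack i x" if "i \<in> I" for i using elim that by (force simp: body_def)
        then have "(\<lambda>n. cutoff (Suc n) x) \<longlonglongrightarrow> (\<Prod>i\<in>I. 1)"
          unfolding cutoff_def by (intro tendsto_prod ramp_tendsto)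
        then show ?thesis using True by (auto intro!: tendsto_eq_intros)
      qed (simp add: cutoff_bounds)
    qed
  qed measurable
qed

theorem divergence_halfspace_body:
  assumes f: "smooth_function f" and e: "e \<in> Basis"
  shows "(LINT x|lborel. indicator body x * partial e f x)
     = (\<Sum>i\<in>I. (a i \<bullet> e) * (LINT y|lborel.
          (if 0 \<le> slack i y \<and> slack i y \<le> 1 \<and> foot i y \<in> body then f (foot i y) else 0)))"
proof (rule LIMSEQ_unique)
  show "(\<lambda>n. LINT x|lborel. cutoff (Suc n) x * partial e f x) \<longlonglongrightarrow> (LINT x|lborel. indicator body x * partial e f x)"
    by (rule cutoff_integral_tendsto[OF smooth_partial[OF f e]])
  show "(\<lambda>n. LINT x|lborel. cutoff (Suc n) x * partial e f x) \<longlonglongrightarrow> (\<Sum>i\<in>I. (a i \<bullet> e) * (LINT y|lborel.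
          (if 0 \<le> slack i y \<and> slack i y \<le> 1 \<and> foot i y \<in> body then f (foot i y) else 0)))"
    unfolding cutoff_integral[OF f e zero_less_Suc]
    by (intro tendsto_sum tendsto_mult_left layer_integral_tendsto f)
qed

end

section \<open>Facets of full-dimensional polytopes\<close>

lemma closest_point_hyperplane:
  fixes n :: "'a::euclidean_space"
  assumes n: "norm n = 1"
  shows "closest_point {x. n \<bullet> x = c} y = y - (n \<bullet> y - c) *\<^sub>R n"
proof -
  have nn: "n \<bullet> n = 1" using n by (simp add: dot_square_norm)
  define p where "p = y - (n \<bullet> y - c) *\<^sub>R n"
  have p: "n \<bullet> p = c" by (simp add: p_def inner_diff_right nn)
  have "dist y p \<le> dist y z" if "n \<bullet> z = c" for z
  proof -
    have "dist y p = \<bar>n \<bullet> y - c\<bar>" by (simp add: p_def dist_norm n)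
    also have "\<dots> = \<bar>n \<bullet> (y - z)\<bar>" using that by (simp add: inner_diff_right)
    also have "\<dots> \<le> norm n * norm (y - z)" by (rule Cauchy_Schwarz_ineq2)
    finally show ?thesis by (simp add: dist_norm n)
  qed
  then have "p = closest_point {x. n \<bullet> x = c} y"
    using p by (intro closest_point_unique) (auto simp: convex_hyperplane closed_hyperplane)
  then show ?thesis by (simp add: p_def)
qed

text \<open>
  For \<open>n = face_normal M F\<close> this is the integral with respect to \<open>face_measure M F\<close>; the normal is kept as
  a parameter, because the cells on the two sides of \<open>F\<close> use opposite normals.
\<close>

definition facet_integral :: "'a::euclidean_space set \<Rightarrow> 'a \<Rightarrow> ('a \<Rightarrow> real) \<Rightarrow> real" where
  "facet_integral F n f =
     (LINT x|distr (lebesgue_on {x + s *\<^sub>R n |x s. x \<in> F \<and> 0 \<le> s \<and> s \<le> 1})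
       (restrict_space borel F) (closest_point (affine hull F)). f x)"

lemma facet_integral_cong:
  assumes "\<And>x. x \<in> F \<Longrightarrow> f x = g x"
  shows "facet_integral F n f = facet_integral F n g"
  unfolding facet_integral_def using assms by (intro Bochner_Integration.integral_cong) (auto simp: space_restrict_space)

lemma facet_integral_zero:
  assumes "\<And>x. x \<in> F \<Longrightarrow> f x = 0"
  shows "facet_integral F n f = 0"
proof -
  have "facet_integral F n f = facet_integral F n (\<lambda>x. 0)" by (rule facet_integral_cong) (rule assms)
  then show ?thesis by (simp add: facet_integral_def)
qed

text \<open>
  The closest point of the hyperplane is the orthogonal projection, so the surface integral is the integral of a
  function that is constant along the normal, over a prism of height 1.
\<close>

lemma facet_integral_prism:
  fixes n :: "'a::euclidean_space"
  assumes n: "norm n = 1" and hull: "affine hull F = {x. n \<bullet> x = c}" and F: "closed F"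
    and f: "continuous_on UNIV f"
  shows "facet_integral F n f = (LINT y|lborel.
     (if 0 \<le> n \<bullet> y - c \<and> n \<bullet> y - c \<le> 1 \<and> y - (n \<bullet> y - c) *\<^sub>R n \<in> F then f (y - (n \<bullet> y - c) *\<^sub>R n) else 0))"
proof -
  have nn: "n \<bullet> n = 1" using n by (simp add: dot_square_norm)
  define P where "P = {x + s *\<^sub>R n |x s. x \<in> F \<and> 0 \<le> s \<and> s \<le> 1}"
  define p where "p y = y - (n \<bullet> y - c) *\<^sub>R n" for y
  have cp: "closest_point (affine hull F) = p"
    by (rule ext) (simp add: hull closest_point_hyperplane[OF n] p_def)
  have FH: "n \<bullet> x = c" if "x \<in> F" for x
    using hull that hull_subset[of F affine] by auto
  have P_iff: "y \<in> P \<longleftrightarrow> 0 \<le> n \<bullet> y - c \<and> n \<bullet> y - c \<le> 1 \<and> p y \<in> F" for y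
  proof
    assume "y \<in> P"
    then obtain x s where "y = x + s *\<^sub>R n" "x \<in> F" "0 \<le> s" "s \<le> 1" by (auto simp: P_def)
    then show "0 \<le> n \<bullet> y - c \<and> n \<bullet> y - c \<le> 1 \<and> p y \<in> F"
      using FH[of x] by (simp add: p_def inner_add_right nn)
  next
    assume "0 \<le> n \<bullet> y - c \<and> n \<bullet> y - c \<le> 1 \<and> p y \<in> F"
    then show "y \<in> P" unfolding P_def by (intro CollectI exI[of _ "p y"] exI[of _ "n \<bullet> y - c"]) (simp add: p_def)
  qed
  have pc: "continuous_on UNIV p" unfolding p_def by (intro continuous_intros)
  have [measurable]: "p \<in> borel_measurable borel" using pc by (rule borel_measurable_continuous_onI)
  have [measurable]: "f \<in> borel_measurable borel" using f by (rule borel_measurable_continuous_onI)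
  have Fb [measurable]: "F \<in> sets borel" using F by simp
  have "P = {y \<in> space borel. 0 \<le> n \<bullet> y - c \<and> n \<bullet> y - c \<le> 1 \<and> p y \<in> F}" using P_iff by auto
  also have "\<dots> \<in> sets borel" by measurable
  finally have Pb [measurable]: "P \<in> sets borel" .
  have pm: "p \<in> measurable (lebesgue_on P) (restrict_space borel F)"
  proof (rule measurable_restrict_space2)
    show "p \<in> space (lebesgue_on P) \<rightarrow> F" using P_iff by (auto simp: space_restrict_space)
    show "p \<in> borel_measurable (lebesgue_on P)"
      by (rule measurable_restrict_space1, rule measurable_completion) measurable
  qed
  have "facet_integral F n f = (LINT x|lebesgue_on P. f (p x))"
    unfolding facet_integral_def P_def[symmetric] cp
    by (rule integral_distr[OF pm]) (rule measurable_restrict_space1, measurable)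
  also have "\<dots> = (LINT x|lebesgue. indicator P x *\<^sub>R f (p x))"
    using Pb by (intro integral_restrict_space) auto
  also have "\<dots> = (LINT x|lborel. indicator P x *\<^sub>R f (p x))"
    by (rule integral_completion) measurable
  also have "\<dots> = (LINT y|lborel. (if 0 \<le> n \<bullet> y - c \<and> n \<bullet> y - c \<le> 1 \<and> p y \<in> F then f (p y) else 0))"
    by (intro Bochner_Integration.integral_cong refl) (auto simp: P_iff indicator_def)
  finally show ?thesis unfolding p_def .
qed

text \<open>
  The prisms on the two sides of the facet are translates of each other.
\<close>

lemma facet_integral_flip:
  fixes n :: "'a::euclidean_space"
  assumes n: "norm n = 1" and hull: "affine hull F = {x. n \<bullet> x = c}" and F: "closed F"
    and f: "continuous_on UNIV f"
  shows "facet_integral F (- n) f = facet_integral F n f"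
proof -
  have nn: "n \<bullet> n = 1" using n by (simp add: dot_square_norm)
  define g where "g y = (if 0 \<le> n \<bullet> y - c \<and> n \<bullet> y - c \<le> 1 \<and> y - (n \<bullet> y - c) *\<^sub>R n \<in> F
     then f (y - (n \<bullet> y - c) *\<^sub>R n) else 0)" for y
  have [measurable]: "f \<in> borel_measurable borel" using f by (rule borel_measurable_continuous_onI)
  have Fb [measurable]: "F \<in> sets borel" using F by simp
  have gm: "g \<in> borel_measurable borel" unfolding g_def[abs_def] by measurable
  have hull': "affine hull F = {x. (- n) \<bullet> x = - c}" using hull by auto
  have "facet_integral F (- n) f = (LINT y|lborel. g (y + n))"
    unfolding facet_integral_prism[OF _ hull' F f, unfolded norm_minus_cancel, OF n]
    by (intro Bochner_Integration.integral_cong refl)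
       (auto simp: g_def inner_add_right nn algebra_simps)
  also have "\<dots> = (LINT y|lborel. g y)" by (rule integral_lborel_translate[OF gm])
  also have "\<dots> = facet_integral F n f"
    unfolding facet_integral_prism[OF n hull F f] g_def ..
  finally show ?thesis .
qed

text \<open>
  An outward unit normal makes the facet a subset of a supporting hyperplane; as the facet has codimension 1, its
  affine hull is the whole hyperplane.
\<close>

lemma outward_normal_halfspace:
  fixes K :: "'a::euclidean_space set"
  assumes K: "convex K" "interior K \<noteq> {}" and F: "F facet_of K" and n: "outward_unit_normal K F n"
  obtains c where "K \<subseteq> {x. n \<bullet> x \<le> c}" "affine hull F = {x. n \<bullet> x = c}" "F = K \<inter> {x. n \<bullet> x = c}"
proof -
  obtain x0 where x0: "x0 \<in> F" using F by (auto simp: facet_of_def)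
  have FK: "F \<subseteq> K" by (rule facet_of_imp_subset[OF F])
  have le: "n \<bullet> y \<le> n \<bullet> x" if "x \<in> F" "y \<in> K" for x y
  proof -
    have "(y - x) \<bullet> n \<le> 0" using n that unfolding outward_unit_normal_def by blast
    then show ?thesis by (simp add: inner_diff_right inner_commute[of _ n])
  qed
  define c where "c = n \<bullet> x0"
  have 1: "K \<subseteq> {x. n \<bullet> x \<le> c}" using le x0 by (auto simp: c_def)
  have 2: "F \<subseteq> {x. n \<bullet> x = c}" 
  proof
    fix x assume x: "x \<in> F"
    then have "x \<in> K" "x0 \<in> K" using x0 FK by auto
    then have "n \<bullet> x = n \<bullet> x0" using le x x0 by (meson order_antisym)
    then show "x \<in> {x. n \<bullet> x = c}" by (simp add: c_def)
  qed
  have n0: "n \<noteq> 0" using n by (auto simp: outward_unit_normal_def)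
  have "aff_dim K = int DIM('a)" using K(2) by (rule aff_dim_nonempty_interior)
  then have "aff_dim (affine hull F) = aff_dim {x. n \<bullet> x = c}"
    using F n0 by (simp add: facet_of_def aff_dim_affine_hull)
  moreover have "affine hull F \<subseteq> {x. n \<bullet> x = c}"
    using 2 by (intro hull_minimal) (simp_all add: affine_hyperplane)
  ultimately have 3: "affine hull F = {x. n \<bullet> x = c}"
    using x0 by (intro affine_dim_equal) (auto simp: affine_hyperplane)
  have "F = affine hull F \<inter> K"
    using face_of_imp_eq_affine_Int[OF K(1) facet_of_imp_face_of[OF F]] .
  then have "F = K \<inter> {x. n \<bullet> x = c}" unfolding 3 by blast
  with 1 3 show ?thesis by (rule that)
qed

lemma outward_normal_exists:
  assumes "polyhedron K" "F facet_of K"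
  obtains n where "outward_unit_normal K F n"
proof -
  obtain a b where ab: "a \<noteq> 0" "K \<subseteq> {x. a \<bullet> x \<le> b}" "F = K \<inter> {x. a \<bullet> x = b}"
    using facet_of_polyhedron[OF assms] by blast
  have "outward_unit_normal K F (a /\<^sub>R norm a)"
    unfolding outward_unit_normal_def
  proof (intro conjI ballI)
    fix x y assume "x \<in> F" "y \<in> K"
    then have "a \<bullet> y \<le> a \<bullet> x" using ab by auto
    then have "(y - x) \<bullet> a \<le> 0" by (simp add: inner_diff_right inner_commute[of _ a])
    then show "(y - x) \<bullet> (a /\<^sub>R norm a) \<le> 0"
      by (simp add: mult_nonneg_nonpos)
  qed (use ab in simp)
  then show ?thesis by (rule that)
qed

lemma hyperplane_normal_unique:
  fixes n n' :: "'a::euclidean_space"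
  assumes "norm n = 1" "norm n' = 1" and eq: "{x. n \<bullet> x = c} = {x. n' \<bullet> x = c'}"
  shows "(n' = n \<and> c' = c) \<or> (n' = - n \<and> c' = - c)"
proof -
  have nn: "n \<bullet> n = 1" "n' \<bullet> n' = 1" using assms by (simp_all add: dot_square_norm)
  define p where "p = c *\<^sub>R n"
  define v where "v = n' - (n' \<bullet> n) *\<^sub>R n"
  have p: "n \<bullet> p = c" by (simp add: p_def nn)
  then have p': "n' \<bullet> p = c'" using eq by blast
  have "n \<bullet> v = 0" by (simp add: v_def inner_diff_right nn inner_commute)
  then have "n \<bullet> (p + v) = c" using p by (simp add: inner_add_right)
  then have "n' \<bullet> (p + v) = c'" using eq by blast
  then have "n' \<bullet> v = 0" using p' by (simp add: inner_add_right)
  then have sq: "(n' \<bullet> n)\<^sup>2 = 1" by (simp add: v_def inner_diff_right nn power2_eq_square)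
  have "v \<bullet> v = n' \<bullet> v - (n' \<bullet> n) * (n \<bullet> v)" by (simp add: v_def inner_diff_left)
  then have "v = 0" using \<open>n' \<bullet> v = 0\<close> \<open>n \<bullet> v = 0\<close> by simp
  then have n': "n' = (n' \<bullet> n) *\<^sub>R n" by (simp add: v_def)
  have "c' = (n' \<bullet> n) * c" using p' by (simp add: p_def mult.commute)
  moreover have "n' \<bullet> n = 1 \<or> n' \<bullet> n = -1" using sq by (simp add: power2_eq_1_iff)
  ultimately show ?thesis using n' by auto
qed

text \<open>
  An interior point can be moved a little in the direction \<open>n\<close>.
\<close>

lemma outward_normal_strict:
  assumes "K \<subseteq> {x. n \<bullet> x \<le> c}" "norm n = 1" "z \<in> interior K"
  shows "n \<bullet> z < c"
proof -
  obtain e where e: "e > 0" "ball z e \<subseteq> K" using assms(3) by (meson mem_interior)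
  have nn: "n \<bullet> n = 1" using assms(2) by (simp add: dot_square_norm)
  have "z + (e/2) *\<^sub>R n \<in> K" using e assms(2) by (intro subsetD[OF e(2)]) (simp add: dist_norm)
  then have "n \<bullet> z + e/2 \<le> c" using assms(1) nn by (auto simp: inner_add_right)
  then show ?thesis using e by simp
qed

lemma outward_normal_unique:
  fixes K :: "'a::euclidean_space set"
  assumes K: "convex K" "interior K \<noteq> {}" and F: "F facet_of K"
    and n: "outward_unit_normal K F n" and n': "outward_unit_normal K F n'"
  shows "n' = n"
proof -
  obtain c where c: "K \<subseteq> {x. n \<bullet> x \<le> c}" "affine hull F = {x. n \<bullet> x = c}"
    using outward_normal_halfspace[OF K F n] by blast
  obtain c' where c': "K \<subseteq> {x. n' \<bullet> x \<le> c'}" "affine hull F = {x. n' \<bullet> x = c'}"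
    using outward_normal_halfspace[OF K F n'] by blast
  have u: "norm n = 1" "norm n' = 1" using n n' unfolding outward_unit_normal_def by blast+
  obtain z where z: "z \<in> interior K" using K by blast
  have "(n' = n \<and> c' = c) \<or> (n' = - n \<and> c' = - c)"
    using c(2) c'(2) by (intro hyperplane_normal_unique u) simp
  then show ?thesis
    using outward_normal_strict[OF c(1) u(1) z] outward_normal_strict[OF c'(1) u(2) z] by (elim disjE) simp_all
qed

locale full_polytope =
  fixes K :: "'a::euclidean_space set"
  assumes poly: "polytope K" and int_ne: "interior K \<noteq> {}"
begin

lemma conv: "convex K" and compact: "compact K" and closed: "closed K"
  using poly polytope_imp_convex polytope_imp_compact polytope_imp_closed by auto

definition facets :: "'a set set" where "facets = {F. F facet_of K}"
definition normal :: "'a set \<Rightarrow> 'a" where "normal F = (SOME n. outward_unit_normal K F n)"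
definition offset :: "'a set \<Rightarrow> real" where "offset F = (SOME c. affine hull F = {x. normal F \<bullet> x = c})"

lemma finite_facets: "finite facets"
  unfolding facets_def by (rule finite_polyhedron_facets) (simp add: poly polytope_imp_polyhedron)

lemma normal: "F \<in> facets \<Longrightarrow> outward_unit_normal K F (normal F)"
  unfolding facets_def normal_def
  using outward_normal_exists[OF polytope_imp_polyhedron[OF poly]] by (metis mem_Collect_eq someI_ex)

lemma normal_eq: "F \<in> facets \<Longrightarrow> outward_unit_normal K F n \<Longrightarrow> normal F = n"
  using outward_normal_unique[OF conv int_ne] normal by (simp add: facets_def)

lemma norm_normal: "F \<in> facets \<Longrightarrow> norm (normal F) = 1"
  using normal by (auto simp: outward_unit_normal_def)

lemma facet:
  assumes "F \<in> facets"
  shows "K \<subseteq> {x. normal F \<bullet> x \<le> offset F}" "affine hull F = {x. normal F \<bullet> x = offset F}"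
    "F = K \<inter> {x. normal F \<bullet> x = offset F}" "F facet_of K" "closed F"
proof -
  show F: "F facet_of K" using assms by (simp add: facets_def)
  obtain c where c: "K \<subseteq> {x. normal F \<bullet> x \<le> c}" "affine hull F = {x. normal F \<bullet> x = c}" "F = K \<inter> {x. normal F \<bullet> x = c}"
    using outward_normal_halfspace[OF conv int_ne F normal[OF assms]] by blast
  then have h: "affine hull F = {x. normal F \<bullet> x = offset F}" unfolding offset_def by (intro someI)
  obtain x where "x \<in> F" using F by (auto simp: facet_of_def)
  then have "x \<in> affine hull F" by (rule hull_inc)
  then have "c = offset F" using c(2) h by auto
  with c show "K \<subseteq> {x. normal F \<bullet> x \<le> offset F}" "affine hull F = {x. normal F \<bullet> x = offset F}"
    "F = K \<inter> {x. normal F \<bullet> x = offset F}" by auto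
  show "closed F" using closed_Int[OF closed closed_hyperplane] c(3) by metis
qed

lemma K_eq: "K = {x. \<forall>F\<in>facets. 0 \<le> offset F - normal F \<bullet> x}"
proof
  show "K \<subseteq> {x. \<forall>F\<in>facets. 0 \<le> offset F - normal F \<bullet> x}"
    using facet(1) by fastforce
  show "{x. \<forall>F\<in>facets. 0 \<le> offset F - normal F \<bullet> x} \<subseteq> K"
  proof (rule subsetI, rule ccontr)
    fix x assume x: "x \<in> {x. \<forall>F\<in>facets. 0 \<le> offset F - normal F \<bullet> x}" "x \<notin> K"
    obtain z where z: "z \<in> interior K" using int_ne by blast
    have "closed_segment z x \<inter> frontier K \<noteq> {}"
      using z x interior_subset[of K]
      by (intro connected_Int_frontier connected_segment) auto
    then obtain p where p: "p \<in> closed_segment z x" "p \<in> frontier K" by blast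
    have "aff_dim K = int DIM('a)" using int_ne by (rule aff_dim_nonempty_interior)
    then have "frontier K = K - rel_interior K"
      using closed by (simp add: frontier_def interior_rel_interior)
    also have "\<dots> = \<Union> {F. F facet_of K}"
      by (rule rel_boundary_of_polyhedron) (simp add: poly polytope_imp_polyhedron)
    finally obtain F where F: "F \<in> facets" "p \<in> F" using p(2) by (auto simp: facets_def)
    have pF: "normal F \<bullet> p = offset F" using F facet(3)[OF F(1)] by blast
    have zF: "normal F \<bullet> z < offset F"
      by (rule outward_normal_strict[OF facet(1)[OF F(1)] norm_normal[OF F(1)] z])
    obtain u where u: "0 \<le> u" "u \<le> 1" "p = (1 - u) *\<^sub>R z + u *\<^sub>R x" using p(1) by (auto simp: in_segment)
    have xF: "normal F \<bullet> x \<le> offset F" using x(1) F(1) by auto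
    have "p \<in> K" using F facet(3) by blast
    then have "u \<noteq> 1" using u x(2) by auto
    then have "(1 - u) * (normal F \<bullet> z) < (1 - u) * offset F" using u zF by simp
    moreover have "u * (normal F \<bullet> x) \<le> u * offset F" using xF u by (intro mult_left_mono) auto
    ultimately have "normal F \<bullet> p < offset F" unfolding u(3) by (simp add: inner_add_right algebra_simps)
    then show False using pF by simp
  qed
qed

lemma interior_eq: "interior K = {x. \<forall>F\<in>facets. 0 < offset F - normal F \<bullet> x}"
proof
  show "interior K \<subseteq> {x. \<forall>F\<in>facets. 0 < offset F - normal F \<bullet> x}"
    using outward_normal_strict[OF facet(1) norm_normal] by fastforce
  have "{x. \<forall>F\<in>facets. 0 < offset F - normal F \<bullet> x} = (\<Inter>F\<in>facets. {x. normal F \<bullet> x < offset F})" by auto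
  also have "open \<dots>" using finite_facets by (intro open_INT) (auto simp: open_halfspace_lt)
  finally have "open {x. \<forall>F\<in>facets. 0 < offset F - normal F \<bullet> x}" .
  then show "{x. \<forall>F\<in>facets. 0 < offset F - normal F \<bullet> x} \<subseteq> interior K"
    by (intro interior_maximal) (auto intro: less_imp_le simp: subset_iff, subst K_eq, force)
qed

sublocale halfspace_body facets normal offset
proof
  show "finite facets" by (rule finite_facets)
  show "norm (normal F) = 1" if "F \<in> facets" for F by (rule norm_normal[OF that])
  show "bounded {x. \<forall>i\<in>facets. 0 \<le> offset i - normal i \<bullet> x}"
    unfolding K_eq[symmetric] using compact by (rule compact_imp_bounded)
  fix i j assume ij: "i \<in> facets" "j \<in> facets" "i \<noteq> j"
  define \<kappa> where "\<kappa> = normal j \<bullet> normal i"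
  have nn: "normal i \<bullet> normal i = 1" "normal j \<bullet> normal j = 1" using ij norm_normal by (simp_all add: dot_square_norm)
  have "normal j - \<kappa> *\<^sub>R normal i \<noteq> 0 \<or> offset j - \<kappa> * offset i \<noteq> 0"
  proof (rule ccontr)
    assume "\<not> ?thesis"
    then have e: "normal j = \<kappa> *\<^sub>R normal i" "offset j = \<kappa> * offset i" by auto
    then have "\<bar>\<kappa>\<bar> = 1" using norm_normal[OF ij(1)] norm_normal[OF ij(2)] by (metis norm_scaleR mult.right_neutral)
    then consider "\<kappa> = 1" | "\<kappa> = -1" by linarith
    then show False
    proof cases
      case 1
      then have "normal j = normal i" "offset j = offset i" using e by auto
      then show False using facet(3)[OF ij(1)] facet(3)[OF ij(2)] ij(3) by metis
    next
      case 2
      obtain z where z: "z \<in> interior K" using int_ne by blast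
      have "normal i \<bullet> z < offset i" "normal j \<bullet> z < offset j"
        using outward_normal_strict[OF facet(1) norm_normal z] ij by auto
      then show False using e 2 by simp
    qed
  qed
  from AE_not_hyperplane[OF this]
  show "AE y in lborel. offset j - normal j \<bullet> (y + (offset i - normal i \<bullet> y) *\<^sub>R normal i) \<noteq> 0"
  proof eventually_elim
    case (elim y)
    then show ?case by (simp add: \<kappa>_def inner_diff_left inner_add_right algebra_simps)
  qed
qed

lemma body_eq: "body = K"
  unfolding body_def slack_def using K_eq by blast

theorem divergence_component:
  assumes f: "smooth_function f" and e: "e \<in> Basis"
  shows "(LINT x|lborel. indicator K x * partial e f x)
    = (\<Sum>F\<in>facets. (normal F \<bullet> e) * facet_integral F (normal F) f)"
proof -
  have "facet_integral F (normal F) f = (LINT y|lborel.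
          (if 0 \<le> slack F y \<and> slack F y \<le> 1 \<and> foot F y \<in> K then f (foot F y) else 0))"
    if F: "F \<in> facets" for F
  proof -
    have c: "continuous_on UNIV f" by (rule smooth_functionD(1)[OF f])
    have hull': "affine hull F = {x. (- normal F) \<bullet> x = - offset F}" using facet(2)[OF F] by auto
    have nn: "normal F \<bullet> normal F = 1" using norm_normal[OF F] by (simp add: dot_square_norm)
    have fF: "foot F y \<in> F \<longleftrightarrow> foot F y \<in> K" for y
    proof -
      have "normal F \<bullet> foot F y = offset F" by (simp add: foot_def slack_def inner_add_right nn)
      then show ?thesis using facet(3)[OF F] by auto
    qed
    have "facet_integral F (normal F) f = facet_integral F (- normal F) f"
      by (rule facet_integral_flip[symmetric, OF norm_normal[OF F] facet(2)[OF F] facet(5)[OF F] c])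
    also have "\<dots> = (LINT y|lborel.
          (if 0 \<le> slack F y \<and> slack F y \<le> 1 \<and> foot F y \<in> F then f (foot F y) else 0))"
      unfolding facet_integral_prism[OF _ hull' facet(5)[OF F] c, unfolded norm_minus_cancel, OF norm_normal[OF F]]
      by (intro Bochner_Integration.integral_cong refl) (simp add: slack_def foot_def)
    finally show ?thesis by (simp only: fF)
  qed
  then show ?thesis
    using divergence_halfspace_body[OF f e] by (simp only: body_eq cong: sum.cong)
qed

text \<open>
  Otherwise \<open>F\<close> would be a proper face of \<open>F'\<close>, although both have the same dimension.
\<close>

lemma facet_eqI:
  assumes "F \<in> facets" "F' \<in> facets" "p \<in> rel_interior F" "p \<in> F'"
  shows "F' = F"
proof (rule ccontr)
  assume ne: "F' \<noteq> F"
  have FK: "F \<subseteq> K" using facet_of_imp_subset[OF facet(4)[OF assms(1)]] .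
  have "F \<subseteq> F'"
  proof (rule subset_of_face_of[OF _ FK])
    show "F' face_of K" using facet_of_imp_face_of[OF facet(4)[OF assms(2)]] .
    show "F' \<inter> rel_interior F \<noteq> {}" using assms(3,4) by blast
  qed
  then have "F face_of F'"
    using face_of_subset[OF facet_of_imp_face_of[OF facet(4)[OF assms(1)]] _
        facet_of_imp_subset[OF facet(4)[OF assms(2)]]] by blast
  then have "aff_dim F < aff_dim F'"
    using facet_of_imp_face_of[OF facet(4)[OF assms(2)]] ne
    by (intro face_of_aff_dim_lt) (auto intro: face_of_imp_convex)
  then show False using facet(4)[OF assms(1)] facet(4)[OF assms(2)] by (simp add: facet_of_def)
qed

text \<open>
  Only the constraint that belongs to \<open>F\<close> is active at \<open>p\<close>, so that \<open>K\<close> is locally a half-space.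
\<close>

lemma facet_neighbourhood:
  assumes F: "F \<in> facets" and p: "p \<in> rel_interior F"
  obtains r where "r > 0" "\<And>x. x \<in> ball p r \<Longrightarrow> normal F \<bullet> x \<le> offset F \<Longrightarrow> x \<in> K"
    "\<And>x. x \<in> ball p r \<Longrightarrow> normal F \<bullet> x < offset F \<Longrightarrow> x \<in> interior K"
    "\<And>F'. F' \<in> facets \<Longrightarrow> F' \<noteq> F \<Longrightarrow> ball p r \<inter> F' = {}"
proof -
  have pF: "p \<in> F" using p rel_interior_subset by blast
  have pK: "p \<in> K" using pF facet(3)[OF F] by blast
  define U where "U = (\<Inter>F'\<in>facets - {F}. {x. normal F' \<bullet> x < offset F'})"
  have "open U" unfolding U_def using finite_facets by (intro open_INT) (auto simp: open_halfspace_lt)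
  moreover have "p \<in> U"
  proof -
    have "normal F' \<bullet> p < offset F'" if "F' \<in> facets" "F' \<noteq> F" for F'
    proof -
      have "p \<notin> F'" using facet_eqI[OF F that(1) p] that(2) by blast
      then show ?thesis using facet(1)[OF that(1)] facet(3)[OF that(1)] pK by force
    qed
    then show ?thesis by (simp add: U_def)
  qed
  ultimately obtain r where r: "r > 0" "ball p r \<subseteq> U" by (meson open_contains_ball)
  have U: "normal F' \<bullet> x < offset F'" if "x \<in> ball p r" "F' \<in> facets" "F' \<noteq> F" for x F'
    using r(2) that by (auto simp: U_def)
  show ?thesis
  proof (rule that[OF r(1)])
    show "x \<in> K" if "x \<in> ball p r" "normal F \<bullet> x \<le> offset F" for x
    proof -
      have "0 \<le> offset F' - normal F' \<bullet> x" if "F' \<in> facets" for F'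
        using U[OF \<open>x \<in> ball p r\<close> that] \<open>normal F \<bullet> x \<le> offset F\<close> by (cases "F' = F") auto
      then show ?thesis using K_eq by blast
    qed
    show "x \<in> interior K" if "x \<in> ball p r" "normal F \<bullet> x < offset F" for x
    proof -
      have "0 < offset F' - normal F' \<bullet> x" if "F' \<in> facets" for F'
        using U[OF \<open>x \<in> ball p r\<close> that] \<open>normal F \<bullet> x < offset F\<close> by (cases "F' = F") auto
      then show ?thesis unfolding interior_eq by blast
    qed
    show "ball p r \<inter> F' = {}" if "F' \<in> facets" "F' \<noteq> F" for F'
    proof -
      have "normal F' \<bullet> x = offset F'" if "x \<in> F'" for x
        using that facet(3)[OF \<open>F' \<in> facets\<close>] by blast
      then show ?thesis using U[OF _ that] by fastforce
    qed
  qed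
qed

end

section \<open>Integrals over facets and the divergence theorem for polytopes\<close>

locale flat_facet =
  fixes F :: "'a::euclidean_space set" and n :: 'a and c :: real
  assumes n: "norm n = 1" and hull: "affine hull F = {x. n \<bullet> x = c}" and compact: "compact F"
begin

definition prism :: "('a \<Rightarrow> real) \<Rightarrow> 'a \<Rightarrow> real" where
  "prism f y = (if 0 \<le> n \<bullet> y - c \<and> n \<bullet> y - c \<le> 1 \<and> y - (n \<bullet> y - c) *\<^sub>R n \<in> F then f (y - (n \<bullet> y - c) *\<^sub>R n) else 0)"

lemma facet_integral_eq: "continuous_on UNIV f \<Longrightarrow> facet_integral F n f = (LINT y|lborel. prism f y)"
  unfolding prism_def using facet_integral_prism[OF n hull compact_imp_closed[OF compact]] by blast

lemma prism_integrable:
  assumes f: "continuous_on UNIV f"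
  shows "integrable lborel (prism f)"
proof -
  obtain B where B: "\<And>x. x \<in> F \<Longrightarrow> norm x \<le> B"
    using compact_imp_bounded[OF compact] by (meson bounded_iff)
  have "bounded (f ` F)"
    using compact_continuous_image[OF continuous_on_subset[OF f] compact] compact_imp_bounded by blast
  then obtain C where C: "C > 0" "\<And>x. x \<in> F \<Longrightarrow> \<bar>f x\<bar> \<le> C" by (auto simp: bounded_pos)
  have [measurable]: "f \<in> borel_measurable borel" using f by (rule borel_measurable_continuous_onI)
  have Fb [measurable]: "F \<in> sets borel" using compact_imp_closed[OF compact] by simp
  show ?thesis
  proof (rule integrable_dominated_on_cball[where C=C and R="B + 1"])
    show "prism f \<in> borel_measurable borel" unfolding prism_def[abs_def] by measurable
    show "\<bar>prism f y\<bar> \<le> C * indicator (cball 0 (B + 1)) y" for y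
    proof (cases "0 \<le> n \<bullet> y - c \<and> n \<bullet> y - c \<le> 1 \<and> y - (n \<bullet> y - c) *\<^sub>R n \<in> F")
      case True
      have "norm y \<le> norm (y - (n \<bullet> y - c) *\<^sub>R n) + norm ((n \<bullet> y - c) *\<^sub>R n)"
        using norm_triangle_ineq[of "y - (n \<bullet> y - c) *\<^sub>R n" "(n \<bullet> y - c) *\<^sub>R n"] by simp
      also have "\<dots> \<le> B + 1" using True B n by (intro add_mono) auto
      finally show ?thesis using True C by (simp add: prism_def)
    next
      case False
      then have "prism f y = 0" unfolding prism_def by (rule if_not_P)
      then show ?thesis using C by simp
    qed
  qed
qed

lemma facet_integral_cmult:
  "continuous_on UNIV f \<Longrightarrow> facet_integral F n (\<lambda>x. r * f x) = r * facet_integral F n f"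
proof -
  assume f: "continuous_on UNIV f"
  have "prism (\<lambda>x. r * f x) = (\<lambda>y. r * prism f y)" by (rule ext) (simp add: prism_def)
  then show ?thesis using f by (simp add: facet_integral_eq continuous_on_mult_left)
qed

lemma facet_integral_add:
  assumes "continuous_on UNIV f" "continuous_on UNIV g"
  shows "facet_integral F n (\<lambda>x. f x + g x) = facet_integral F n f + facet_integral F n g"
proof -
  have "prism (\<lambda>x. f x + g x) = (\<lambda>y. prism f y + prism g y)" by (rule ext) (simp add: prism_def)
  then show ?thesis using assms by (simp add: facet_integral_eq continuous_on_add prism_integrable)
qed

lemma facet_integral_sum:
  assumes "\<And>i. i \<in> I \<Longrightarrow> continuous_on UNIV (f i)"
  shows "facet_integral F n (\<lambda>x. \<Sum>i\<in>I. f i x) = (\<Sum>i\<in>I. facet_integral F n (f i))"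
  using assms
proof (induction I rule: infinite_finite_induct)
  case (insert i I)
  then show ?case by (simp add: facet_integral_add continuous_on_sum)
qed (use facet_integral_cmult[of "\<lambda>x. 0" 0] in auto)

text \<open>
  Where a continuous non-negative function is positive at a relative interior point of the facet, it is positive
  on an open part of the prism.
\<close>

lemma facet_integral_eq_0D:
  assumes f: "continuous_on UNIV f" and nonneg: "\<And>x. x \<in> F \<Longrightarrow> 0 \<le> f x"
    and int: "facet_integral F n f = 0" and p: "p \<in> rel_interior F"
  shows "f p = 0"
proof (rule ccontr)
  assume "f p \<noteq> 0"
  have nn: "n \<bullet> n = 1" using n by (simp add: dot_square_norm)
  have pF: "p \<in> F" using p rel_interior_subset by blast
  have pc: "n \<bullet> p = c" using hull_inc[OF pF, of affine] hull by simp
  have fp: "f p > 0" using nonneg[OF pF] \<open>f p \<noteq> 0\<close> by simp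
  obtain e where e: "e > 0" "ball p e \<inter> affine hull F \<subseteq> F"
    using p by (auto simp: mem_rel_interior_ball)
  define foot where "foot y = y - (n \<bullet> y - c) *\<^sub>R n" for y
  have cont: "continuous_on UNIV foot" unfolding foot_def by (intro continuous_intros)
  define U where "U = {y. 0 < n \<bullet> y - c} \<inter> {y. n \<bullet> y - c < 1} \<inter> {y. dist p (foot y) < e} \<inter> {y. 0 < f (foot y)}"
  have cf: "continuous_on UNIV (\<lambda>y. f (foot y))"
    using continuous_on_compose2[OF f cont] by simp
  have "open U" unfolding U_def
    by (intro open_Int open_Collect_less continuous_intros cont cf)
  moreover have "p + (1/2) *\<^sub>R n \<in> U"
    using fp e pc by (simp add: U_def foot_def inner_add_right nn)
  ultimately have nU: "\<not> negligible U" using open_not_negligible by blast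
  have pos: "0 < prism f y" if "y \<in> U" for y
  proof -
    have "n \<bullet> foot y = c" by (simp add: foot_def inner_diff_right nn)
    then have "foot y \<in> F" using that e(2) hull by (auto simp: U_def)
    then show ?thesis using that by (simp add: prism_def U_def foot_def)
  qed
  have "0 \<le> prism f y" for y by (simp add: prism_def nonneg)
  then have "AE y in lborel. prism f y = 0"
    using integral_nonneg_eq_0_iff_AE[OF prism_integrable[OF f]] int f by (simp add: facet_integral_eq)
  then have "AE y in lborel. y \<notin> U" using pos by (auto elim!: eventually_mono) (metis less_irrefl)
  then have "U \<in> null_sets lebesgue"
    using \<open>open U\<close> by (subst (asm) AE_iff_null_sets[symmetric])
       (auto simp: null_sets_completion_iff)
  then show False using nU by (simp add: negligible_iff_null_sets)
qed

end

context full_polytope begin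

lemma flat_facet: "F \<in> facets \<Longrightarrow> flat_facet F (normal F) (offset F)"
proof
  assume F: "F \<in> facets"
  show "norm (normal F) = 1" "affine hull F = {x. normal F \<bullet> x = offset F}"
    using norm_normal[OF F] facet(2)[OF F] by auto
  have "compact (K \<inter> F)" using compact facet(5)[OF F] by (rule compact_Int_closed)
  moreover have "K \<inter> F = F" using facet(3)[OF F] by blast
  ultimately show "compact F" by simp
qed

end

definition smooth_field :: "('a::euclidean_space \<Rightarrow> 'a) \<Rightarrow> bool" where
  "smooth_field w \<longleftrightarrow> (\<forall>b\<in>Basis. smooth_function (\<lambda>x. w x \<bullet> b))"

definition field_div :: "('a::euclidean_space \<Rightarrow> 'a) \<Rightarrow> 'a \<Rightarrow> real" where
  "field_div w x = (\<Sum>b\<in>Basis. partial b (\<lambda>x. w x \<bullet> b) x)"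

lemma smooth_field_inner:
  assumes "smooth_field w"
  shows "smooth_function (\<lambda>x. w x \<bullet> c)"
proof -
  have "(\<lambda>x. w x \<bullet> c) = (\<lambda>x. \<Sum>b\<in>Basis. (w x \<bullet> b) * (c \<bullet> b))"
    by (rule ext) (rule euclidean_inner)
  then show ?thesis using assms by (auto simp: smooth_field_def intro!: smooth_sum smooth_mult)
qed

lemma smooth_field_inner_field:
  assumes "smooth_field w" "smooth_field v"
  shows "smooth_function (\<lambda>x. w x \<bullet> v x)"
proof -
  have "(\<lambda>x. w x \<bullet> v x) = (\<lambda>x. \<Sum>b\<in>Basis. (w x \<bullet> b) * (v x \<bullet> b))"
    by (rule ext) (rule euclidean_inner)
  then show ?thesis using assms by (auto simp: smooth_field_def intro!: smooth_sum smooth_mult)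
qed

lemma smooth_field_differentiable:
  assumes "smooth_field w"
  shows "w differentiable (at x)"
    "frechet_derivative w (at x) h \<bullet> b = frechet_derivative (\<lambda>x. w x \<bullet> b) (at x) h"
proof -
  have "w differentiable (at x)"
    unfolding differentiable_componentwise_within[of w x UNIV]
    using smooth_functionD(2) assms unfolding smooth_field_def by blast
  then show "w differentiable (at x)" .
  then have "(w has_derivative frechet_derivative w (at x)) (at x)" by (simp add: frechet_derivative_works)
  then have "((\<lambda>x. w x \<bullet> b) has_derivative (\<lambda>h. frechet_derivative w (at x) h \<bullet> b)) (at x)"
    by (rule has_derivative_inner_left)
  then show "frechet_derivative w (at x) h \<bullet> b = frechet_derivative (\<lambda>x. w x \<bullet> b) (at x) h"
    using frechet_derivative_eq by metis
qed

lemma smooth_field_continuous: "smooth_field w \<Longrightarrow> continuous_on UNIV w"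
  using smooth_field_differentiable(1) by (meson continuous_at_imp_continuous_on differentiable_imp_continuous_within)

lemma smooth_field_scale:
  "smooth_function g \<Longrightarrow> smooth_field w \<Longrightarrow> smooth_field (\<lambda>x. g x *\<^sub>R w x)"
  by (auto simp: smooth_field_def intro: smooth_mult)

lemma smooth_field_div: "smooth_field w \<Longrightarrow> smooth_function (field_div w)"
  unfolding field_div_def[abs_def] smooth_field_def by (auto intro!: smooth_sum smooth_partial)

lemma partial_mult:
  assumes "smooth_function f" "smooth_function g"
  shows "frechet_derivative (\<lambda>x. f x * g x) (at x) h = f x * frechet_derivative g (at x) h + frechet_derivative f (at x) h * g x"
  using frechet_derivative_eq[OF has_derivative_mult[OF assms[THEN smooth_has_derivative], of x]] by simp

lemma field_div_scale:
  assumes g: "smooth_function g" and w: "smooth_field w"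
  shows "field_div (\<lambda>x. g x *\<^sub>R w x) x = frechet_derivative g (at x) (w x) + g x * field_div w x"
proof -
  have "field_div (\<lambda>x. g x *\<^sub>R w x) x = (\<Sum>b\<in>Basis. g x * partial b (\<lambda>x. w x \<bullet> b) x + (w x \<bullet> b) * partial b g x)"
    unfolding field_div_def using w
    by (intro sum.cong refl) (simp add: partial_mult[OF g] smooth_field_def mult.commute)
  also have "\<dots> = g x * field_div w x + frechet_derivative g (at x) (w x)"
    by (simp add: sum.distrib sum_distrib_left field_div_def frechet_derivative_basis_sum[OF smooth_functionD(2)[OF g], of x "w x"])
  finally show ?thesis by simp
qed

lemma continuous_integrable_on_compact:
  fixes K :: "'a::euclidean_space set"
  assumes f: "continuous_on UNIV f" and K: "compact K"
  shows "integrable lborel (\<lambda>x. indicator K x * f x :: real)"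
  using borel_integrable_compact[OF K continuous_on_subset[OF f]] by simp

theorem (in full_polytope) divergence_theorem:
  assumes w: "smooth_field w"
  shows "(LINT x|lborel. indicator K x * field_div w x)
    = (\<Sum>F\<in>facets. facet_integral F (normal F) (\<lambda>x. w x \<bullet> normal F))"
proof -
  have c: "continuous_on UNIV (\<lambda>x. w x \<bullet> b)" for b by (rule smooth_functionD(1)[OF smooth_field_inner[OF w]])
  have s: "b \<in> Basis \<Longrightarrow> smooth_function (\<lambda>x. w x \<bullet> b)" for b using w by (simp add: smooth_field_def)
  have "(LINT x|lborel. indicator K x * field_div w x)
     = (LINT x|lborel. (\<Sum>b\<in>Basis. indicator K x * partial b (\<lambda>x. w x \<bullet> b) x))"
    by (simp add: field_div_def sum_distrib_left)
  also have "\<dots> = (\<Sum>b\<in>Basis. (LINT x|lborel. indicator K x * partial b (\<lambda>x. w x \<bullet> b) x))"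
    by (intro Bochner_Integration.integral_sum continuous_integrable_on_compact compact smooth_functionD smooth_partial s)
  also have "\<dots> = (\<Sum>b\<in>Basis. \<Sum>F\<in>facets. (normal F \<bullet> b) * facet_integral F (normal F) (\<lambda>x. w x \<bullet> b))"
    by (intro sum.cong refl divergence_component s)
  also have "\<dots> = (\<Sum>F\<in>facets. \<Sum>b\<in>Basis. (normal F \<bullet> b) * facet_integral F (normal F) (\<lambda>x. w x \<bullet> b))"
    by (rule sum.swap)
  also have "\<dots> = (\<Sum>F\<in>facets. facet_integral F (normal F) (\<lambda>x. w x \<bullet> normal F))"
  proof (intro sum.cong refl)
    fix F assume "F \<in> facets"
    then interpret flat_facet F "normal F" "offset F" by (rule flat_facet)
    have "facet_integral F (normal F) (\<lambda>x. w x \<bullet> normal F)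
      = facet_integral F (normal F) (\<lambda>x. \<Sum>b\<in>Basis. (normal F \<bullet> b) * (w x \<bullet> b))"
      by (rule facet_integral_cong) (rule trans[OF euclidean_inner sum.cong[OF refl mult.commute]])
    then show "(\<Sum>b\<in>Basis. (normal F \<bullet> b) * facet_integral F (normal F) (\<lambda>x. w x \<bullet> b))
      = facet_integral F (normal F) (\<lambda>x. w x \<bullet> normal F)"
      by (subst (asm) facet_integral_sum) (auto simp: facet_integral_cmult c intro!: continuous_on_mult_left c)
  qed
  finally show ?thesis .
qed

section \<open>Simplicial meshes\<close>

locale simplicial_mesh =
  fixes M :: "'a::euclidean_space mesh"
  assumes mesh: "conforming_simplicial_mesh M"
begin

abbreviation nrm :: "'a set \<Rightarrow> 'a set \<Rightarrow> 'a" where "nrm K F \<equiv> full_polytope.normal K F"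

lemma finite_cells: "finite (cells M)"
  and open_region: "open (region M)" and bounded_region: "bounded (region M)" and region_ne: "region M \<noteq> {}"
  and region_regular: "region M = interior (closure (region M))"
  and cells_cover: "\<Union> (cells M) = closure (region M)"
  using mesh by (auto simp: conforming_simplicial_mesh_def)

lemma cell_simplex: "K \<in> cells M \<Longrightarrow> int DIM('a) simplex K"
  and cells_conforming: "K \<in> cells M \<Longrightarrow> K' \<in> cells M \<Longrightarrow> (K \<inter> K') face_of K \<and> (K \<inter> K') face_of K'"
  using mesh unfolding conforming_simplicial_mesh_def by blast+

lemma cell_plus: "F \<in> faces M \<Longrightarrow> cell_plus M F \<in> cells M \<and> F facet_of cell_plus M F \<and>
        outward_unit_normal (cell_plus M F) F (face_normal M F)"
  and cell_minus: "F \<in> interior_faces M \<Longrightarrow> cell_minus M F \<in> cells M \<and> F facet_of cell_minus M F \<and>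
        cell_minus M F \<noteq> cell_plus M F"
  using mesh unfolding conforming_simplicial_mesh_def by blast+

lemma interior_faces_subset: "interior_faces M \<subseteq> faces M"
  by (auto simp: interior_faces_def faces_def)

lemma cell_polytope:
  assumes "K \<in> cells M"
  shows "full_polytope K"
proof
  show "polytope K" using cell_simplex[OF assms] by (rule simplex_imp_polytope)
  have d: "aff_dim K = int DIM('a)" using cell_simplex[OF assms] by (rule aff_dim_simplex)
  then have "K \<noteq> {}" by auto
  moreover have "convex K" using cell_simplex[OF assms] by (rule convex_simplex)
  ultimately show "interior K \<noteq> {}" using d by (metis interior_rel_interior rel_interior_eq_empty)
qed

lemma cell_props:
  assumes "K \<in> cells M"
  shows "convex K" "closed K" "compact K" "interior K \<noteq> {}" "full_polytope.facets K = {F. F facet_of K}"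
    "closure (interior K) = K"
proof -
  interpret full_polytope K by (rule cell_polytope[OF assms])
  show "convex K" "closed K" "compact K" "interior K \<noteq> {}" "full_polytope.facets K = {F. F facet_of K}"
    using conv closed compact int_ne facets_def by auto
  show "closure (interior K) = K" using convex_closure_interior[OF conv int_ne] closed by simp
qed

lemma cell_subset: "K \<in> cells M \<Longrightarrow> K \<subseteq> closure (region M)"
  using cells_cover by blast

lemma interior_cell_subset: "K \<in> cells M \<Longrightarrow> interior K \<subseteq> region M"
  using cell_subset interior_mono region_regular by metis

text \<open>
  Conformity: the intersection of two cells is a face of both, and a face that contains an interior point is
  the whole cell.
\<close>

lemma interior_cell_disjoint:
  assumes "K \<in> cells M" "K' \<in> cells M" "x \<in> interior K" "x \<in> K'"
  shows "K' = K"
proof -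
  have xK: "x \<in> K" using assms interior_subset by blast
  have "K \<inter> K' = K"
    using face_of_disjoint_interior[of "K \<inter> K'" K] cells_conforming[OF assms(1,2)] assms xK by blast
  then have sub: "K \<subseteq> K'" by blast
  then have "x \<in> interior K'" using assms(3) interior_mono by blast
  then have "K \<inter> K' = K'"
    using face_of_disjoint_interior[of "K \<inter> K'" K'] cells_conforming[OF assms(1,2)] assms xK by blast
  then show ?thesis using sub by blast
qed

text \<open>
  The cell is the closure of its interior, so the limit that defines the trace is unique.
\<close>

lemma trace_eq:
  fixes v w :: "'a \<Rightarrow> 'b::euclidean_space"
  assumes K: "K \<in> cells M" and vw: "\<And>x. x \<in> interior K \<Longrightarrow> v x = w x" and w: "continuous_on UNIV w" and x: "x \<in> K"
  shows "trace K v x = w x"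
proof -
  have "x islimpt interior K"
  proof (cases "x \<in> interior K")
    case True
    then show ?thesis by (metis interior_interior interior_limit_point)
  next
    case False
    then show ?thesis using x cell_props(6)[OF K] by (auto simp: closure_def)
  qed
  then have nt: "\<not> trivial_limit (at x within interior K)" by (simp add: trivial_limit_within)
  have "(w \<longlongrightarrow> w x) (at x within interior K)"
    using w by (metis UNIV_I continuous_on_def subset_UNIV tendsto_within_subset)
  then have "(v \<longlongrightarrow> w x) (at x within interior K)"
    by (rule Lim_transform_eventually) (auto simp: eventually_at_filter vw)
  then show ?thesis unfolding trace_def by (rule tendsto_Lim[OF nt])
qed

text \<open>
  The skeleton is a null set and Lebesgue measure is complete, so the values on the skeleton affect neither
  measurability nor the integral.
\<close>

lemma region_integral:
  fixes f :: "'a \<Rightarrow> real"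
  assumes eq: "\<And>K x. K \<in> cells M \<Longrightarrow> x \<in> interior K \<Longrightarrow> f x = g K x"
    and g: "\<And>K. K \<in> cells M \<Longrightarrow> continuous_on UNIV (g K)"
  shows "integrable (lebesgue_on (region M)) f"
    "(LINT x|lebesgue_on (region M). f x) = (\<Sum>K\<in>cells M. (LINT x|lborel. indicator K x * g K x))"
proof -
  define h where "h x = (\<Sum>K\<in>cells M. indicator K x * g K x)" for x
  have gi: "integrable lborel (\<lambda>x. indicator K x * g K x)" if "K \<in> cells M" for K
    by (rule continuous_integrable_on_compact[OF g[OF that] cell_props(3)[OF that]])
  have hi: "integrable lborel h" unfolding h_def[abs_def] by (intro Bochner_Integration.integrable_sum gi)
  have hint: "(LINT x|lborel. h x) = (\<Sum>K\<in>cells M. (LINT x|lborel. indicator K x * g K x))"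
    unfolding h_def by (intro Bochner_Integration.integral_sum gi)
  define N where "N = (\<Union>K\<in>cells M. frontier K)"
  have "negligible N" unfolding N_def
    using finite_cells cell_props(1) by (intro negligible_Union) (auto intro: negligible_convex_frontier)
  then have "AE x in lebesgue. x \<notin> N" by (auto simp: negligible_iff_null_sets intro: AE_not_in)
  then have ae: "AE x in lebesgue. h x = indicator (region M) x *\<^sub>R f x"
  proof eventually_elim
    case (elim x)
    show ?case
    proof (cases "\<exists>K\<in>cells M. x \<in> K")
      case True
      then obtain K where K: "K \<in> cells M" "x \<in> K" by blast
      then have xi: "x \<in> interior K" using elim cell_props(2)[OF K(1)] by (auto simp: N_def frontier_def)
      have "h x = (\<Sum>K'\<in>{K}. indicator K' x * g K' x)"
        unfolding h_def
      proof (rule sum.mono_neutral_right[OF finite_cells])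
        show "\<forall>K'\<in>cells M - {K}. indicator K' x * g K' x = 0"
        proof
          fix K' assume K': "K' \<in> cells M - {K}"
          then have "x \<notin> K'" using interior_cell_disjoint[OF K(1) _ xi, of K'] by blast
          then show "indicator K' x * g K' x = 0" by simp
        qed
      qed (use K in simp)
      then show ?thesis using K xi interior_cell_subset eq by (auto simp: indicator_def)
    next
      case False
      then have "x \<notin> region M" using cells_cover closure_subset by blast
      then show ?thesis using False by (auto simp: h_def indicator_def)
    qed
  qed
  have hm: "h \<in> borel_measurable lebesgue" using hi by (auto intro: measurable_completion)
  have fm: "(\<lambda>x. indicator (region M) x *\<^sub>R f x) \<in> borel_measurable lebesgue"
    by (rule borel_measurable_AE[OF hm ae])
  have R: "region M \<inter> space lebesgue \<in> sets lebesgue" using open_region by auto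
  have hl: "integrable lebesgue h" "(LINT x|lebesgue. h x) = (LINT x|lborel. h x)"
    using hi by (auto simp: integrable_completion integral_completion)
  have "integrable lebesgue (\<lambda>x. indicator (region M) x *\<^sub>R f x)"
    by (rule integrable_cong_AE_imp[OF hl(1) fm]) (use ae in \<open>auto elim: eventually_mono\<close>)
  then show "integrable (lebesgue_on (region M)) f"
    by (simp add: integrable_restrict_space[OF R])
  have "(LINT x|lebesgue_on (region M). f x) = (LINT x|lebesgue. indicator (region M) x *\<^sub>R f x)"
    by (rule integral_restrict_space[OF R])
  also have "\<dots> = (LINT x|lebesgue. h x)"
    by (rule integral_cong_AE[OF fm hm]) (use ae in \<open>auto elim: eventually_mono\<close>)
  finally show "(LINT x|lebesgue_on (region M). f x) = (\<Sum>K\<in>cells M. (LINT x|lborel. indicator K x * g K x))"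
    by (simp only: hl hint)
qed

text \<open>
  If the cells were on the same side of the facet, both would look like the same half-space near a relative
  interior point of it, and their interiors would intersect.
\<close>

lemma shared_facet:
  assumes K: "K \<in> cells M" and K': "K' \<in> cells M" and ne: "K \<noteq> K'" and F: "F facet_of K" "F facet_of K'"
  shows "nrm K' F = - nrm K F" "full_polytope.offset K' F = - full_polytope.offset K F"
proof -
  interpret P: full_polytope K by (rule cell_polytope[OF K])
  interpret P': full_polytope K' by (rule cell_polytope[OF K'])
  have FP: "F \<in> P.facets" "F \<in> P'.facets" using F by (auto simp: P.facets_def P'.facets_def)
  have eq: "{x. nrm K F \<bullet> x = P.offset F} = {x. nrm K' F \<bullet> x = P'.offset F}"
    using P.facet(2)[OF FP(1)] P'.facet(2)[OF FP(2)] by simp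
  have alt: "(nrm K' F = nrm K F \<and> P'.offset F = P.offset F) \<or> (nrm K' F = - nrm K F \<and> P'.offset F = - P.offset F)"
    by (rule hyperplane_normal_unique[OF P.norm_normal[OF FP(1)] P'.norm_normal[OF FP(2)] eq])
  have "\<not> (nrm K' F = nrm K F \<and> P'.offset F = P.offset F)"
  proof
    assume same: "nrm K' F = nrm K F \<and> P'.offset F = P.offset F"
    have "F \<noteq> {}" "convex F" using F P.conv face_of_imp_convex by (auto simp: facet_of_def)
    then obtain p where p: "p \<in> rel_interior F" using rel_interior_eq_empty by blast
    then have "p \<in> F" using rel_interior_subset by blast
    then have pc: "nrm K F \<bullet> p = P.offset F" using P.facet(3)[OF FP(1)] by blast
    obtain r where r: "r > 0" "\<And>x. x \<in> ball p r \<Longrightarrow> nrm K F \<bullet> x < P.offset F \<Longrightarrow> x \<in> interior K"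
      using P.facet_neighbourhood[OF FP(1) p] by metis
    obtain r' where r': "r' > 0" "\<And>x. x \<in> ball p r' \<Longrightarrow> nrm K' F \<bullet> x < P'.offset F \<Longrightarrow> x \<in> interior K'"
      using P'.facet_neighbourhood[OF FP(2) p] by metis
    define x where "x = p - (min r r' / 2) *\<^sub>R nrm K F"
    have nn: "nrm K F \<bullet> nrm K F = 1" using P.norm_normal[OF FP(1)] by (simp add: dot_square_norm)
    have d: "dist p x = min r r' / 2" using r(1) r'(1) P.norm_normal[OF FP(1)] by (simp add: x_def dist_norm)
    have "x \<in> ball p r" "x \<in> ball p r'" using d r(1) r'(1) by auto
    moreover have "nrm K F \<bullet> x < P.offset F" using r(1) r'(1) by (simp add: x_def inner_diff_right nn pc)
    ultimately have "x \<in> interior K" "x \<in> interior K'" using r(2) r'(2) same by auto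
    then have "K' = K" using interior_subset by (intro interior_cell_disjoint[OF K K']) auto
    then show False using ne by simp
  qed
  then show "nrm K' F = - nrm K F" "P'.offset F = - P.offset F" using alt by auto
qed

lemma nrm_cell_plus: "F \<in> faces M \<Longrightarrow> nrm (cell_plus M F) F = face_normal M F"
  using cell_plus full_polytope.normal_eq[OF cell_polytope] cell_props(5) by (metis mem_Collect_eq)

lemma nrm_cell_minus: "F \<in> interior_faces M \<Longrightarrow> nrm (cell_minus M F) F = - face_normal M F"
  using shared_facet(1)[of "cell_plus M F" "cell_minus M F" F] cell_plus cell_minus interior_faces_subset nrm_cell_plus
  by (metis subsetD)

text \<open>
  Of three cells sharing a facet, two would lie on the same side.
\<close>

lemma cells_of_interior_face:
  assumes F: "F \<in> interior_faces M"
  shows "{K \<in> cells M. F facet_of K} = {cell_plus M F, cell_minus M F}"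
proof -
  have Ff: "F \<in> faces M" using F interior_faces_subset by blast
  have "K = cell_plus M F \<or> K = cell_minus M F" if K: "K \<in> cells M" "F facet_of K" for K
  proof (rule ccontr)
    assume ne: "\<not> ?thesis"
    have "nrm K F = - nrm (cell_plus M F) F" "nrm K F = - nrm (cell_minus M F) F"
      using shared_facet(1)[of "cell_plus M F" K F] shared_facet(1)[of "cell_minus M F" K F]
        ne K cell_plus[OF Ff] cell_minus[OF F] by auto
    then have "face_normal M F = - face_normal M F"
      using nrm_cell_plus[OF Ff] nrm_cell_minus[OF F] by simp
    then have "face_normal M F = 0" by (simp add: eq_neg_iff_add_eq_0 scaleR_2[symmetric])
    then show False using cell_plus[OF Ff] by (simp add: outward_unit_normal_def)
  qed
  then show ?thesis using cell_plus[OF Ff] cell_minus[OF F] by auto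
qed

lemma cells_of_boundary_face:
  assumes F: "F \<in> boundary_faces M"
  shows "{K \<in> cells M. F facet_of K} = {cell_plus M F}"
proof -
  have Ff: "F \<in> faces M" "F \<notin> interior_faces M" using F by (auto simp: boundary_faces_def)
  then have "K = cell_plus M F" if K: "K \<in> cells M" "F facet_of K" for K
    using that cell_plus[OF Ff(1)] unfolding interior_faces_def by blast
  then show ?thesis using cell_plus[OF Ff(1)] by auto
qed

lemma finite_faces: "finite (faces M)"
proof -
  have "faces M = (\<Union>K\<in>cells M. full_polytope.facets K)" using cell_props(5) by (auto simp: faces_def)
  also have "finite \<dots>"
    using finite_cells full_polytope.finite_facets[OF cell_polytope] by (intro finite_UN_I)
  finally show ?thesis .
qed

lemma flat_face: "F \<in> faces M \<Longrightarrow> \<exists>c. flat_facet F (face_normal M F) c"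
  using full_polytope.flat_facet[OF cell_polytope, of "cell_plus M F" F] cell_plus cell_props(5) nrm_cell_plus
  by (metis mem_Collect_eq)

lemma facet_integral_uminus_normal:
  "F \<in> faces M \<Longrightarrow> continuous_on UNIV f \<Longrightarrow>
    facet_integral F (- face_normal M F) f = facet_integral F (face_normal M F) f"
  using flat_face[of F] by (auto simp: flat_facet_def compact_imp_closed intro!: facet_integral_flip)

lemma face_subset: "F \<in> faces M \<Longrightarrow> F \<subseteq> cell_plus M F" "F \<in> interior_faces M \<Longrightarrow> F \<subseteq> cell_minus M F"
  using cell_plus cell_minus facet_of_imp_subset by blast+

lemma face_measure_integral:
  "(LINT x|face_measure M F. f x) = facet_integral F (face_normal M F) f"
  by (simp add: face_measure_def facet_integral_def)

text \<open>
  The divergence theorem on each cell, with the double sum over cells and facets rearranged by faces. The two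
  contributions of an interior face combine to the jump, as the outward normals are opposite.
\<close>

theorem broken_divergence_theorem:
  assumes w: "\<And>K. K \<in> cells M \<Longrightarrow> smooth_field (w K)"
  shows "(\<Sum>K\<in>cells M. (LINT x|lborel. indicator K x * field_div (w K) x))
   = (\<Sum>F\<in>interior_faces M. facet_integral F (face_normal M F)
         (\<lambda>x. (w (cell_plus M F) x - w (cell_minus M F) x) \<bullet> face_normal M F))
   + (\<Sum>F\<in>boundary_faces M. facet_integral F (face_normal M F)
         (\<lambda>x. w (cell_plus M F) x \<bullet> face_normal M F))"
proof -
  define T where "T K F = facet_integral F (nrm K F) (\<lambda>x. w K x \<bullet> nrm K F)" for K F
  have "(\<Sum>K\<in>cells M. (LINT x|lborel. indicator K x * field_div (w K) x)) = (\<Sum>K\<in>cells M. \<Sum>F\<in>{F\<in>faces M. F facet_of K}. T K F)"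
  proof (intro sum.cong refl)
    fix K assume K: "K \<in> cells M"
    have "{F\<in>faces M. F facet_of K} = full_polytope.facets K" using K cell_props(5)[OF K] by (auto simp: faces_def)
    then show "(LINT x|lborel. indicator K x * field_div (w K) x) = (\<Sum>F\<in>{F\<in>faces M. F facet_of K}. T K F)"
      using full_polytope.divergence_theorem[OF cell_polytope[OF K] w[OF K]] by (simp add: T_def)
  qed
  also have "\<dots> = (\<Sum>F\<in>faces M. \<Sum>K\<in>{K\<in>cells M. F facet_of K}. T K F)"
    by (rule sum.swap_restrict[OF finite_cells finite_faces])
  also have "faces M = interior_faces M \<union> boundary_faces M"
    using interior_faces_subset by (auto simp: boundary_faces_def)
  also have "(\<Sum>F\<in>interior_faces M \<union> boundary_faces M. \<Sum>K\<in>{K\<in>cells M. F facet_of K}. T K F)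
    = (\<Sum>F\<in>interior_faces M. \<Sum>K\<in>{K\<in>cells M. F facet_of K}. T K F)
    + (\<Sum>F\<in>boundary_faces M. \<Sum>K\<in>{K\<in>cells M. F facet_of K}. T K F)"
    using finite_faces interior_faces_subset
    by (intro sum.union_disjoint) (auto simp: boundary_faces_def intro: finite_subset)
  also have "(\<Sum>F\<in>interior_faces M. \<Sum>K\<in>{K\<in>cells M. F facet_of K}. T K F)
    = (\<Sum>F\<in>interior_faces M. facet_integral F (face_normal M F)
         (\<lambda>x. (w (cell_plus M F) x - w (cell_minus M F) x) \<bullet> face_normal M F))"
  proof (intro sum.cong refl)
    fix F assume F: "F \<in> interior_faces M"
    let ?n = "face_normal M F" and ?p = "w (cell_plus M F)" and ?m = "w (cell_minus M F)"
    have Ff: "F \<in> faces M" using F interior_faces_subset by blast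
    obtain c where "flat_facet F ?n c" using flat_face[OF Ff] by blast
    then interpret flat_facet F ?n c .
    have cp: "continuous_on UNIV (\<lambda>x. ?p x \<bullet> ?n)" and cm: "continuous_on UNIV (\<lambda>x. ?m x \<bullet> ?n)"
      using cell_plus[OF Ff] cell_minus[OF F] w smooth_functionD(1)[OF smooth_field_inner] by blast+
    have "(\<Sum>K\<in>{K\<in>cells M. F facet_of K}. T K F) = T (cell_plus M F) F + T (cell_minus M F) F"
    proof -
      have "cell_plus M F \<noteq> cell_minus M F" using cell_minus[OF F] by metis
      then show ?thesis unfolding cells_of_interior_face[OF F] by simp
    qed
    also have "T (cell_plus M F) F = facet_integral F ?n (\<lambda>x. ?p x \<bullet> ?n)"
      by (simp add: T_def nrm_cell_plus[OF Ff])
    also have "T (cell_minus M F) F = facet_integral F ?n (\<lambda>x. (- 1) * (?m x \<bullet> ?n))"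
      using facet_integral_uminus_normal[OF Ff continuous_on_mult_left[OF cm, of "- 1"]]
      by (simp add: T_def nrm_cell_minus[OF F])
    also have "facet_integral F ?n (\<lambda>x. ?p x \<bullet> ?n) + facet_integral F ?n (\<lambda>x. (- 1) * (?m x \<bullet> ?n))
      = facet_integral F ?n (\<lambda>x. (?p x \<bullet> ?n) + (- 1) * (?m x \<bullet> ?n))"
      by (rule facet_integral_add[symmetric, OF cp continuous_on_mult_left[OF cm]])
    finally show "(\<Sum>K\<in>{K\<in>cells M. F facet_of K}. T K F) = facet_integral F ?n (\<lambda>x. (?p x - ?m x) \<bullet> ?n)"
      by (simp add: inner_diff_left)
  qed
  also have "(\<Sum>F\<in>boundary_faces M. \<Sum>K\<in>{K\<in>cells M. F facet_of K}. T K F)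
    = (\<Sum>F\<in>boundary_faces M. facet_integral F (face_normal M F) (\<lambda>x. w (cell_plus M F) x \<bullet> face_normal M F))"
    by (intro sum.cong refl) (simp add: cells_of_boundary_face T_def nrm_cell_plus boundary_faces_def)
  finally show ?thesis .
qed

end

section \<open>Polynomials and square-integrable functions\<close>

definition monomial :: "('a::euclidean_space \<Rightarrow> nat) \<Rightarrow> 'a \<Rightarrow> real" where
  "monomial \<alpha> x = (\<Prod>b\<in>Basis. (x \<bullet> b) ^ \<alpha> b)"

lemma poly_space_iff: "p \<in> poly_space j \<longleftrightarrow> (\<exists>c. p = (\<lambda>x. \<Sum>\<alpha>\<in>multi_indices j. c \<alpha> * monomial \<alpha> x))"
  by (auto simp: poly_space_def monomial_def fun_eq_iff)

lemma finite_multi_indices: "finite (multi_indices j :: ('a::euclidean_space \<Rightarrow> nat) set)"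
proof (rule finite_subset)
  show "finite {\<alpha> :: 'a \<Rightarrow> nat. \<forall>x. (x \<in> Basis \<longrightarrow> \<alpha> x \<in> {..j}) \<and> (x \<notin> Basis \<longrightarrow> \<alpha> x = 0)}"
    by (rule finite_set_of_finite_funs) auto
  show "multi_indices j \<subseteq> {\<alpha> :: 'a \<Rightarrow> nat. \<forall>x. (x \<in> Basis \<longrightarrow> \<alpha> x \<in> {..j}) \<and> (x \<notin> Basis \<longrightarrow> \<alpha> x = 0)}"
  proof
    fix \<alpha> :: "'a \<Rightarrow> nat" assume a: "\<alpha> \<in> multi_indices j"
    have "\<alpha> b \<le> j" if "b \<in> Basis" for b
    proof -
      have "\<alpha> b \<le> sum \<alpha> Basis" using that by (intro member_le_sum) auto
      then show ?thesis using a by (simp add: multi_indices_def)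
    qed
    then show "\<alpha> \<in> {\<alpha> :: 'a \<Rightarrow> nat. \<forall>x. (x \<in> Basis \<longrightarrow> \<alpha> x \<in> {..j}) \<and> (x \<notin> Basis \<longrightarrow> \<alpha> x = 0)}"
      using a by (auto simp: multi_indices_def)
  qed
qed

lemma poly_space_add: "p \<in> poly_space j \<Longrightarrow> q \<in> poly_space j \<Longrightarrow> (\<lambda>x. p x + q x) \<in> poly_space j"
proof -
  assume "p \<in> poly_space j" "q \<in> poly_space j"
  then obtain c d where "p = (\<lambda>x. \<Sum>\<alpha>\<in>multi_indices j. c \<alpha> * monomial \<alpha> x)" "q = (\<lambda>x. \<Sum>\<alpha>\<in>multi_indices j. d \<alpha> * monomial \<alpha> x)"
    by (auto simp: poly_space_iff)
  then show ?thesis unfolding poly_space_iff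
    by (intro exI[of _ "\<lambda>\<alpha>. c \<alpha> + d \<alpha>"]) (simp add: algebra_simps sum.distrib)
qed

lemma poly_space_cmult: "p \<in> poly_space j \<Longrightarrow> (\<lambda>x. r * p x) \<in> poly_space j"
proof -
  assume "p \<in> poly_space j"
  then obtain c where "p = (\<lambda>x. \<Sum>\<alpha>\<in>multi_indices j. c \<alpha> * monomial \<alpha> x)" by (auto simp: poly_space_iff)
  then show ?thesis unfolding poly_space_iff
    by (intro exI[of _ "\<lambda>\<alpha>. r * c \<alpha>"]) (simp add: sum_distrib_left mult.assoc)
qed

lemma poly_space_zero: "(\<lambda>x. 0) \<in> poly_space j"
  unfolding poly_space_iff by (rule exI[of _ "\<lambda>\<alpha>. 0"]) simp

lemma poly_space_sum: "(\<And>i. i \<in> I \<Longrightarrow> p i \<in> poly_space j) \<Longrightarrow> (\<lambda>x. \<Sum>i\<in>I. p i x) \<in> poly_space j"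
  by (induction I rule: infinite_finite_induct) (auto intro: poly_space_add poly_space_zero)

lemma poly_space_monomial: "\<alpha> \<in> multi_indices j \<Longrightarrow> monomial \<alpha> \<in> poly_space j"
  unfolding poly_space_iff
  by (rule exI[of _ "\<lambda>\<beta>. if \<beta> = \<alpha> then 1 else 0"]) (simp add: finite_multi_indices if_distrib[of "\<lambda>c. c * _"] cong: if_cong)

lemma poly_space_const: "(\<lambda>x. r) \<in> poly_space j"
proof -
  have "monomial (\<lambda>_. 0) \<in> poly_space j" by (rule poly_space_monomial) (simp add: multi_indices_def)
  from poly_space_cmult[OF this, of r] show ?thesis by (simp add: monomial_def)
qed

text \<open>
  A linear operation on polynomials may be checked on monomials.
\<close>

lemma poly_space_linear_image:
  assumes p: "p \<in> poly_space j" and m: "\<And>\<alpha>. \<alpha> \<in> multi_indices j \<Longrightarrow> T \<alpha> \<in> poly_space j'"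
    and eq: "\<And>c x. p = (\<lambda>x. \<Sum>\<alpha>\<in>multi_indices j. c \<alpha> * monomial \<alpha> x) \<Longrightarrow> q x = (\<Sum>\<alpha>\<in>multi_indices j. c \<alpha> * T \<alpha> x)"
  shows "q \<in> poly_space j'"
proof -
  obtain c where "p = (\<lambda>x. \<Sum>\<alpha>\<in>multi_indices j. c \<alpha> * monomial \<alpha> x)" using p by (auto simp: poly_space_iff)
  then have "q = (\<lambda>x. \<Sum>\<alpha>\<in>multi_indices j. c \<alpha> * T \<alpha> x)" using eq by auto
  then show ?thesis using m by (auto intro!: poly_space_sum poly_space_cmult)
qed

lemma poly_space_mono: "p \<in> poly_space j \<Longrightarrow> j \<le> j' \<Longrightarrow> p \<in> poly_space j'"
  by (erule poly_space_linear_image[where T=monomial]) (auto simp: multi_indices_def intro!: poly_space_monomial)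

lemma poly_space_mult_coord:
  assumes "p \<in> poly_space j" and b: "b \<in> Basis"
  shows "(\<lambda>x. p x * (x \<bullet> b)) \<in> poly_space (Suc j)"
  using assms(1)
proof (rule poly_space_linear_image[where T="\<lambda>\<alpha> x. monomial \<alpha> x * (x \<bullet> b)"])
  fix \<alpha> :: "'a \<Rightarrow> nat" assume a: "\<alpha> \<in> multi_indices j"
  define \<beta> where "\<beta> = \<alpha>(b := Suc (\<alpha> b))"
  have r: "sum f Basis = f b + sum f (Basis - {b})" for f :: "'a \<Rightarrow> nat"
    using b by (simp add: sum.remove)
  have r': "prod f Basis = f b * prod f (Basis - {b})" for f :: "'a \<Rightarrow> real"
    using b by (simp add: prod.remove)
  have "sum \<beta> Basis = Suc (sum \<alpha> Basis)"
    using r[of \<alpha>] r[of \<beta>] by (simp add: \<beta>_def)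
  then have "\<beta> \<in> multi_indices (Suc j)" using a b by (auto simp: multi_indices_def \<beta>_def)
  moreover have "monomial \<beta> x = monomial \<alpha> x * (x \<bullet> b)" for x
    using r'[of "\<lambda>c. (x \<bullet> c) ^ \<alpha> c"] r'[of "\<lambda>c. (x \<bullet> c) ^ \<beta> c"] by (simp add: monomial_def \<beta>_def)
  ultimately show "(\<lambda>x. monomial \<alpha> x * (x \<bullet> b)) \<in> poly_space (Suc j)"
    using poly_space_monomial[of \<beta> "Suc j"] by (metis (no_types, lifting) ext)
qed (simp add: sum_distrib_right mult.assoc)

lemma monomial_has_derivative:
  "(monomial \<alpha> has_derivative (\<lambda>h. \<Sum>b\<in>Basis. (real (\<alpha> b) * (h \<bullet> b) * (x \<bullet> b) ^ (\<alpha> b - 1)) * (\<Prod>c\<in>Basis - {b}. (x \<bullet> c) ^ \<alpha> c))) (at x)"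
  unfolding monomial_def[abs_def]
  by (rule has_derivative_prod) (auto intro!: derivative_eq_intros)

lemma monomial_partial:
  assumes e: "e \<in> Basis"
  shows "partial e (monomial \<alpha>) x = real (\<alpha> e) * monomial (\<alpha>(e := \<alpha> e - 1)) x"
proof -
  have "partial e (monomial \<alpha>) x = (\<Sum>b\<in>Basis. (real (\<alpha> b) * (e \<bullet> b) * (x \<bullet> b) ^ (\<alpha> b - 1)) * (\<Prod>c\<in>Basis - {b}. (x \<bullet> c) ^ \<alpha> c))"
    by (simp add: frechet_derivative_eq[OF monomial_has_derivative])
  also have "\<dots> = (\<Sum>b\<in>Basis. if b = e then real (\<alpha> e) * (x \<bullet> e) ^ (\<alpha> e - 1) * (\<Prod>c\<in>Basis - {e}. (x \<bullet> c) ^ \<alpha> c) else 0)"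
    by (intro sum.cong refl) (auto simp: inner_Basis e)
  also have "\<dots> = real (\<alpha> e) * ((x \<bullet> e) ^ (\<alpha> e - 1) * (\<Prod>c\<in>Basis - {e}. (x \<bullet> c) ^ \<alpha> c))"
    using e by simp
  also have "(x \<bullet> e) ^ (\<alpha> e - 1) * (\<Prod>c\<in>Basis - {e}. (x \<bullet> c) ^ \<alpha> c) = monomial (\<alpha>(e := \<alpha> e - 1)) x"
    unfolding monomial_def using e by (subst prod.remove[of Basis e]) auto
  finally show ?thesis .
qed

lemma smooth_monomial: "smooth_function (monomial \<alpha>)"
  unfolding monomial_def[abs_def] by (intro smooth_prod smooth_power smooth_inner)

lemma poly_space_smooth: "p \<in> poly_space j \<Longrightarrow> smooth_function p"
  unfolding poly_space_iff by (auto intro!: smooth_sum smooth_mult smooth_monomial)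

lemma poly_space_partial:
  assumes "p \<in> poly_space (Suc j)" and e: "e \<in> Basis"
  shows "(\<lambda>x. partial e p x) \<in> poly_space j"
  using assms(1)
proof (rule poly_space_linear_image[where T="\<lambda>\<alpha> x. partial e (monomial \<alpha>) x"])
  fix \<alpha> :: "'a \<Rightarrow> nat" assume a: "\<alpha> \<in> multi_indices (Suc j)"
  show "(\<lambda>x. partial e (monomial \<alpha>) x) \<in> poly_space j"
  proof (cases "\<alpha> e = 0")
    case True
    then show ?thesis by (simp add: monomial_partial[OF e] poly_space_zero)
  next
    case False
    have r: "sum f Basis = f e + sum f (Basis - {e})" for f :: "'a \<Rightarrow> nat"
      using e by (simp add: sum.remove)
    have "sum \<alpha> Basis = Suc (sum (\<alpha>(e := \<alpha> e - 1)) Basis)"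
      using r[of \<alpha>] r[of "\<alpha>(e := \<alpha> e - 1)"] False by simp
    then have "\<alpha>(e := \<alpha> e - 1) \<in> multi_indices j" using a e by (auto simp: multi_indices_def)
    then show ?thesis unfolding monomial_partial[OF e] by (intro poly_space_cmult poly_space_monomial)
  qed
next
  fix c x assume p: "p = (\<lambda>x. \<Sum>\<alpha>\<in>multi_indices (Suc j). c \<alpha> * monomial \<alpha> x)"
  have "(p has_derivative (\<lambda>h. \<Sum>\<alpha>\<in>multi_indices (Suc j). c \<alpha> * frechet_derivative (monomial \<alpha>) (at x) h)) (at x)"
    unfolding p by (intro has_derivative_sum has_derivative_mult_right smooth_has_derivative smooth_monomial)
  then show "partial e p x = (\<Sum>\<alpha>\<in>multi_indices (Suc j). c \<alpha> * partial e (monomial \<alpha>) x)"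
    by (simp add: frechet_derivative_eq)
qed

text \<open>
  Raviart-Thomas fields of order \<open>k\<close> and Brezzi-Douglas-Marini fields of order \<open>k\<close> both have components of degree
  at most \<open>k + 1\<close>; this is enough for the divergence to be of degree \<open>k\<close>.
\<close>

lemma local_space_subset: "w \<in> local_space fam k \<Longrightarrow> w \<in> vec_poly_space (Suc k)"
proof (cases fam)
  case Raviart_Thomas
  assume "w \<in> local_space fam k"
  then obtain w' q where w: "w = (\<lambda>x. w' x + q x *\<^sub>R x)" "w' \<in> vec_poly_space k" "q \<in> poly_space k"
    using Raviart_Thomas by auto
  show ?thesis unfolding vec_poly_space_def w(1)
  proof (intro CollectI ballI)
    fix b :: 'a assume b: "b \<in> Basis"
    have 1: "(\<lambda>x. w' x \<bullet> b) \<in> poly_space (Suc k)"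
      using w(2) b by (auto simp: vec_poly_space_def intro: poly_space_mono)
    show "(\<lambda>x. (w' x + q x *\<^sub>R x) \<bullet> b) \<in> poly_space (Suc k)"
      using poly_space_add[OF 1 poly_space_mult_coord[OF w(3) b]] by (simp add: inner_add_left)
  qed
qed auto

lemma vec_poly_smooth: "w \<in> vec_poly_space j \<Longrightarrow> smooth_field w"
  by (auto simp: vec_poly_space_def smooth_field_def intro: poly_space_smooth)

lemma vec_poly_div: "w \<in> vec_poly_space (Suc k) \<Longrightarrow> field_div w \<in> poly_space k"
  unfolding field_div_def[abs_def] by (auto simp: vec_poly_space_def intro!: poly_space_sum poly_space_partial)

lemma L2_mult_integrable:
  fixes f g :: "'a::euclidean_space \<Rightarrow> real"
  assumes "f \<in> L2 \<Omega>" "g \<in> L2 \<Omega>"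
  shows "integrable (lebesgue_on \<Omega>) (\<lambda>x. f x * g x)"
proof (rule Bochner_Integration.integrable_bound)
  show "integrable (lebesgue_on \<Omega>) (\<lambda>x. (norm (f x))\<^sup>2 + (norm (g x))\<^sup>2)"
    using assms by (auto simp: L2_def)
  show "(\<lambda>x. f x * g x) \<in> borel_measurable (lebesgue_on \<Omega>)"
    using assms by (auto simp: L2_def intro: borel_measurable_times)
  have "\<bar>a * b\<bar> \<le> a\<^sup>2 + b\<^sup>2" for a b :: real
  proof -
    have "0 \<le> (\<bar>a\<bar> - \<bar>b\<bar>)\<^sup>2" by simp
    then have "2 * (\<bar>a\<bar> * \<bar>b\<bar>) \<le> a\<^sup>2 + b\<^sup>2" by (simp add: power2_diff)
    moreover have "0 \<le> \<bar>a\<bar> * \<bar>b\<bar>" by simp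
    ultimately show ?thesis unfolding abs_mult by linarith
  qed
  then show "AE x in lebesgue_on \<Omega>. norm (f x * g x) \<le> norm ((norm (f x))\<^sup>2 + (norm (g x))\<^sup>2)" by simp
qed

lemma L2_cmult: "f \<in> L2 \<Omega> \<Longrightarrow> (\<lambda>x. r * f x :: real) \<in> L2 \<Omega>"
  by (auto simp: L2_def power_mult_distrib abs_mult)

lemma L2_add:
  fixes f g :: "'a::euclidean_space \<Rightarrow> real"
  assumes "f \<in> L2 \<Omega>" "g \<in> L2 \<Omega>"
  shows "(\<lambda>x. f x + g x) \<in> L2 \<Omega>"
proof -
  have "integrable (lebesgue_on \<Omega>) (\<lambda>x. (f x)\<^sup>2 + (g x)\<^sup>2 + 2 * (f x * g x))"
    using assms L2_mult_integrable[OF assms] by (auto simp: L2_def intro!: Bochner_Integration.integrable_add)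
  then show ?thesis using assms by (auto simp: L2_def power2_sum algebra_simps)
qed

context simplicial_mesh begin

text \<open>
  \<open>w K\<close> is a smooth extension of the restriction of \<open>v\<close> to the cell \<open>K\<close>; it determines all traces from \<open>K\<close>.
\<close>

definition represents :: "('a \<Rightarrow> 'a) \<Rightarrow> ('a set \<Rightarrow> 'a \<Rightarrow> 'a) \<Rightarrow> bool" where
  "represents v w \<longleftrightarrow> (\<forall>K\<in>cells M. smooth_field (w K) \<and> (\<forall>x\<in>interior K. v x = w K x))"

lemma piecewise_L2:
  fixes f :: "'a \<Rightarrow> real"
  assumes eq: "\<And>K x. K \<in> cells M \<Longrightarrow> x \<in> interior K \<Longrightarrow> f x = g K x"
    and g: "\<And>K. K \<in> cells M \<Longrightarrow> continuous_on UNIV (g K)"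
  shows "f \<in> L2 (region M)"
proof -
  have "integrable (lebesgue_on (region M)) f" by (rule region_integral(1)[OF eq g])
  moreover have "integrable (lebesgue_on (region M)) (\<lambda>x. (f x)\<^sup>2)"
    using eq g by (intro region_integral(1)[where g="\<lambda>K x. (g K x)\<^sup>2"]) (auto intro!: continuous_on_power)
  ultimately show ?thesis by (auto simp: L2_def)
qed

lemma const_L2: "(\<lambda>x. r :: real) \<in> L2 (region M)"
  by (rule piecewise_L2[where g="\<lambda>K x. r"]) auto

lemma L2_integrable: "(f :: 'a \<Rightarrow> real) \<in> L2 (region M) \<Longrightarrow> integrable (lebesgue_on (region M)) f"
  using L2_mult_integrable[OF _ const_L2[of 1]] by simp

text \<open>
  Almost everywhere zero means zero in the cells, by continuity there.
\<close>

lemma piecewise_zero: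
  fixes f :: "'a \<Rightarrow> real"
  assumes eq: "\<And>K x. K \<in> cells M \<Longrightarrow> x \<in> interior K \<Longrightarrow> f x = g K x"
    and g: "\<And>K. K \<in> cells M \<Longrightarrow> continuous_on UNIV (g K)"
    and int: "(LINT x|lebesgue_on (region M). f x * f x) = 0"
    and K: "K \<in> cells M" and x: "x \<in> interior K"
  shows "f x = 0"
proof (rule ccontr)
  assume nz: "f x \<noteq> 0"
  have "f \<in> L2 (region M)" by (rule piecewise_L2[OF eq g])
  then have "AE x in lebesgue_on (region M). f x * f x = 0"
    using int integral_nonneg_eq_0_iff_AE[OF L2_mult_integrable] by force
  then have ae: "AE x in lebesgue. x \<in> region M \<longrightarrow> f x = 0"
    using open_region by (subst (asm) AE_restrict_space_iff) auto
  define U where "U = interior K \<inter> {x. g K x \<noteq> 0}"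
  have oU: "open U" unfolding U_def by (intro open_Int open_interior open_Collect_neq g[OF K] continuous_on_const)
  have "x \<in> U" using nz eq[OF K x] x by (simp add: U_def)
  then have nU: "\<not> negligible U" using oU open_not_negligible by blast
  have "AE x in lebesgue. x \<notin> U"
    using ae by eventually_elim (use interior_cell_subset[OF K] eq[OF K] in \<open>auto simp: U_def\<close>)
  then have "U \<in> null_sets lebesgue"
    using oU by (subst (asm) AE_iff_null_sets[symmetric]) auto
  then show False using nU by (simp add: negligible_iff_null_sets)
qed

lemma broken_deriv_eq:
  assumes "represents v w" and K: "K \<in> cells M" and x: "x \<in> interior K"
  shows "broken_deriv M v x h = frechet_derivative (w K) (at x) h"
proof -
  have "w K differentiable (at x)" using assms smooth_field_differentiable(1) by (auto simp: represents_def)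
  then have "(w K has_derivative frechet_derivative (w K) (at x)) (at x)" by (simp add: frechet_derivative_works)
  then have "(v has_derivative frechet_derivative (w K) (at x)) (at x)"
    by (rule has_derivative_transform_within_open[OF _ open_interior x]) (use assms in \<open>auto simp: represents_def\<close>)
  then show ?thesis using K x by (auto simp: broken_deriv_def frechet_derivative_eq)
qed

lemma broken_div_eq:
  assumes "represents v w" and K: "K \<in> cells M" and x: "x \<in> interior K"
  shows "broken_div M v x = field_div (w K) x"
proof -
  have "smooth_field (w K)" using assms by (auto simp: represents_def)
  then show ?thesis unfolding broken_div_def field_div_def
    by (simp only: broken_deriv_eq[OF assms] smooth_field_differentiable(2))
qed

lemma represents_smooth: "represents v w \<Longrightarrow> K \<in> cells M \<Longrightarrow> smooth_field (w K)"
  and represents_eq: "represents v w \<Longrightarrow> K \<in> cells M \<Longrightarrow> x \<in> interior K \<Longrightarrow> v x = w K x"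
  by (auto simp: represents_def)

lemma broken_div_L2: "represents v w \<Longrightarrow> broken_div M v \<in> L2 (region M)"
  by (rule piecewise_L2[where g="\<lambda>K. field_div (w K)"])
     (auto simp: broken_div_eq intro: smooth_functionD(1)[OF smooth_field_div[OF represents_smooth]])

lemma green:
  assumes v: "represents v w" and \<phi>: "smooth_function \<phi>"
  shows "(LINT x|lebesgue_on (region M). frechet_derivative \<phi> (at x) (v x))
       + (LINT x|lebesgue_on (region M). \<phi> x * broken_div M v x)
     = (\<Sum>K\<in>cells M. (LINT x|lborel. indicator K x * field_div (\<lambda>x. \<phi> x *\<^sub>R w K x) x))"
proof -
  have sd: "smooth_function (\<lambda>x. frechet_derivative \<phi> (at x) (w K x))" if "K \<in> cells M" for K
  proof -
    have "smooth_function (\<lambda>x. \<Sum>b\<in>Basis. (w K x \<bullet> b) * partial b \<phi> x)"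
      using represents_smooth[OF v that] \<phi> by (auto simp: smooth_field_def intro!: smooth_sum smooth_mult smooth_partial)
    then show ?thesis by (simp add: frechet_derivative_basis_sum[OF smooth_functionD(2)[OF \<phi>], of _ "w K _"])
  qed
  have sf: "smooth_function (\<lambda>x. \<phi> x * field_div (w K) x)" if "K \<in> cells M" for K
    using represents_smooth[OF v that] \<phi> by (intro smooth_mult smooth_field_div)
  have 1: "(LINT x|lebesgue_on (region M). frechet_derivative \<phi> (at x) (v x))
     = (\<Sum>K\<in>cells M. (LINT x|lborel. indicator K x * frechet_derivative \<phi> (at x) (w K x)))"
    by (rule region_integral(2)) (auto simp: represents_eq[OF v] intro: smooth_functionD sd)
  have 2: "(LINT x|lebesgue_on (region M). \<phi> x * broken_div M v x)
     = (\<Sum>K\<in>cells M. (LINT x|lborel. indicator K x * (\<phi> x * field_div (w K) x)))"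
    by (rule region_integral(2)) (auto simp: broken_div_eq[OF v] intro: smooth_functionD sf)
  show ?thesis unfolding 1 2 sum.distrib[symmetric]
  proof (intro sum.cong refl)
    fix K assume K: "K \<in> cells M"
    have i: "integrable lborel (\<lambda>x. indicator K x * frechet_derivative \<phi> (at x) (w K x))"
      "integrable lborel (\<lambda>x. indicator K x * (\<phi> x * field_div (w K) x))"
      by (intro continuous_integrable_on_compact cell_props(3)[OF K] smooth_functionD sd sf K)+
    show "(LINT x|lborel. indicator K x * frechet_derivative \<phi> (at x) (w K x)) + (LINT x|lborel. indicator K x * (\<phi> x * field_div (w K) x))
      = (LINT x|lborel. indicator K x * field_div (\<lambda>x. \<phi> x *\<^sub>R w K x) x)"
      unfolding Bochner_Integration.integral_add[OF i, symmetric]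
      by (simp add: field_div_scale[OF \<phi> represents_smooth[OF v K]] algebra_simps)
  qed
qed

text \<open>
  For a test function, the derivative may be moved to \<open>v\<close> weakly on the whole domain and classically on each cell. The
  facet terms measure the difference between the two.
\<close>

lemma green_test:
  assumes v: "represents v w" and g: "has_weak_div (region M) v g"
    and \<phi>: "smooth_function \<phi>" and C: "compact C" "C \<subseteq> region M" "\<And>x. x \<notin> C \<Longrightarrow> \<phi> x = 0"
  shows "(LINT x|lebesgue_on (region M). \<phi> x * (broken_div M v x - g x))
     = (\<Sum>K\<in>cells M. \<Sum>F\<in>full_polytope.facets K. facet_integral F (nrm K F) (\<lambda>x. \<phi> x * (w K x \<bullet> nrm K F)))"
proof -
  have \<phi>L: "\<phi> \<in> L2 (region M)" by (rule piecewise_L2[where g="\<lambda>K. \<phi>"]) (auto intro: smooth_functionD \<phi>)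
  have gL: "g \<in> L2 (region M)" using g by (simp add: has_weak_div_def)
  have DL: "broken_div M v \<in> L2 (region M)" by (rule broken_div_L2[OF v])
  have "test_function (region M) \<phi>" using \<phi> C by (auto simp: test_function_def smooth_function_def)
  then have e: "(LINT x|lebesgue_on (region M). frechet_derivative \<phi> (at x) (v x)) = - (LINT x|lebesgue_on (region M). g x * \<phi> x)"
    using g by (simp add: has_weak_div_def)
  have "(LINT x|lebesgue_on (region M). \<phi> x * (broken_div M v x - g x))
     = (LINT x|lebesgue_on (region M). \<phi> x * broken_div M v x - g x * \<phi> x)"
    by (simp add: algebra_simps)
  also have "\<dots> = (LINT x|lebesgue_on (region M). \<phi> x * broken_div M v x) - (LINT x|lebesgue_on (region M). g x * \<phi> x)"
    by (rule Bochner_Integration.integral_diff[OF L2_mult_integrable[OF \<phi>L DL] L2_mult_integrable[OF gL \<phi>L]])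
  also have "\<dots> = (\<Sum>K\<in>cells M. (LINT x|lborel. indicator K x * field_div (\<lambda>x. \<phi> x *\<^sub>R w K x) x))"
    using green[OF v \<phi>] e by simp
  also have "\<dots> = (\<Sum>K\<in>cells M. \<Sum>F\<in>full_polytope.facets K. facet_integral F (nrm K F) (\<lambda>x. \<phi> x * (w K x \<bullet> nrm K F)))"
    by (intro sum.cong refl)
       (simp add: full_polytope.divergence_theorem[OF cell_polytope smooth_field_scale[OF \<phi> represents_smooth[OF v]]])
  finally show ?thesis .
qed

lemma bounded_test_integral_tendsto:
  fixes \<phi> :: "nat \<Rightarrow> 'a \<Rightarrow> real" and h :: "'a \<Rightarrow> real"
  assumes \<phi>: "\<And>m. smooth_function (\<phi> m)" and bd: "\<And>m x. x \<in> region M \<Longrightarrow> \<bar>\<phi> m x\<bar> \<le> C"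
    and h: "h \<in> L2 (region M)" and lim: "AE x in lborel. (\<lambda>m. \<phi> m x) \<longlonglongrightarrow> \<psi> x"
    and \<psi>: "\<psi> \<in> borel_measurable borel"
  shows "(\<lambda>m. LINT x|lebesgue_on (region M). \<phi> m x * h x) \<longlonglongrightarrow> (LINT x|lebesgue_on (region M). \<psi> x * h x)"
proof (rule integral_dominated_convergence[where w="\<lambda>x. C * \<bar>h x\<bar>"])
  have hm: "h \<in> borel_measurable (lebesgue_on (region M))" using h by (simp add: L2_def)
  have bm: "f \<in> borel_measurable (lebesgue_on (region M))" if "f \<in> borel_measurable borel" for f :: "'a \<Rightarrow> real"
    by (rule measurable_restrict_space1, rule measurable_completion) (use that in simp)
  show "(\<lambda>x. \<psi> x * h x) \<in> borel_measurable (lebesgue_on (region M))"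
    by (intro borel_measurable_times bm \<psi> hm)
  show "(\<lambda>x. \<phi> m x * h x) \<in> borel_measurable (lebesgue_on (region M))" for m
    using smooth_functionD(1)[OF \<phi>] by (intro borel_measurable_times bm hm borel_measurable_continuous_onI)
  show "integrable (lebesgue_on (region M)) (\<lambda>x. C * \<bar>h x\<bar>)"
    using L2_integrable[OF h] by auto
  have "AE x in lebesgue. (\<lambda>m. \<phi> m x) \<longlonglongrightarrow> \<psi> x" using lim by (rule AE_completion)
  then have "AE x in lebesgue_on (region M). (\<lambda>m. \<phi> m x) \<longlonglongrightarrow> \<psi> x"
    using open_region by (subst AE_restrict_space_iff) (auto elim: eventually_mono)
  then show "AE x in lebesgue_on (region M). (\<lambda>m. \<phi> m x * h x) \<longlonglongrightarrow> \<psi> x * h x"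
    by eventually_elim (intro tendsto_intros)
  show "AE x in lebesgue_on (region M). norm (\<phi> m x * h x) \<le> C * \<bar>h x\<bar>" for m
  proof (rule AE_I2)
    fix x assume "x \<in> space (lebesgue_on (region M))"
    then have "x \<in> region M" by (simp add: space_restrict_space)
    then show "norm (\<phi> m x * h x) \<le> C * \<bar>h x\<bar>"
      using bd[of x m] by (simp add: abs_mult mult_right_mono)
  qed
qed

lemma AE_in_cell: "AE x in lebesgue_on (region M). \<exists>K\<in>cells M. x \<in> interior K"
proof -
  define N where "N = (\<Union>K\<in>cells M. frontier K)"
  have "negligible N" unfolding N_def
    using finite_cells cell_props(1) by (intro negligible_Union) (auto intro: negligible_convex_frontier)
  then have "AE x in lebesgue. x \<notin> N" by (auto simp: negligible_iff_null_sets intro: AE_not_in)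
  then have "AE x in lebesgue. x \<in> region M \<longrightarrow> (\<exists>K\<in>cells M. x \<in> interior K)"
  proof eventually_elim
    case (elim x)
    show ?case
    proof
      assume "x \<in> region M"
      then obtain K where K: "K \<in> cells M" "x \<in> K" using cells_cover closure_subset by blast
      then have "x \<in> interior K" using elim cell_props(2)[OF K(1)] by (auto simp: N_def frontier_def)
      then show "\<exists>K\<in>cells M. x \<in> interior K" using K by blast
    qed
  qed
  then show ?thesis using open_region by (subst AE_restrict_space_iff) auto
qed

lemma cellwise_sum:
  fixes a :: "'a set \<Rightarrow> real"
  assumes K: "K \<in> cells M" "x \<in> interior K"
  shows "(\<Sum>L\<in>cells M. indicator (interior L) x * a L) = a K"
proof -
  have "(\<Sum>L\<in>cells M. indicator (interior L) x * a L) = (\<Sum>L\<in>{K}. indicator (interior L) x * a L)"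
  proof (rule sum.mono_neutral_right[OF finite_cells])
    show "\<forall>L\<in>cells M - {K}. indicator (interior L) x * a L = 0"
    proof
      fix L assume L: "L \<in> cells M - {K}"
      then have "x \<notin> interior L" using interior_cell_disjoint[OF K(1) _ K(2), of L] interior_subset by blast
      then show "indicator (interior L) x * a L = 0" by simp
    qed
  qed (use K in simp)
  then show ?thesis using K by simp
qed

lemma integral_cong_cells:
  fixes f g :: "'a \<Rightarrow> real"
  assumes "integrable (lebesgue_on (region M)) f" "integrable (lebesgue_on (region M)) g"
    and eq: "\<And>K x. K \<in> cells M \<Longrightarrow> x \<in> interior K \<Longrightarrow> f x = g x"
  shows "(LINT x|lebesgue_on (region M). f x) = (LINT x|lebesgue_on (region M). g x)"
  using assms AE_in_cell by (intro integral_cong_AE) (auto elim: eventually_mono)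

end

section \<open>Normal continuity and the weak divergence\<close>

context simplicial_mesh begin

text \<open>
  Let \<open>j\<close> be the jump of the normal component, extended smoothly, and \<open>p\<close> a relative interior point of \<open>F\<close>. The
  test functions are \<open>j\<close> times a bump around \<open>p\<close> times a bump in \<open>m (n \<bullet> y - c)\<close>. On \<open>F\<close> they do
  not depend on \<open>m\<close>, so the facet terms of \<open>green_test\<close> are a fixed integral of \<open>j\<^sup>2\<close> times a
  function that is positive at \<open>p\<close>. The supports shrink to a null set as \<open>m\<close> grows, so the volume
  integral tends to zero. Hence \<open>j p = 0\<close>, and \<open>j\<close> vanishes on \<open>F\<close> by continuity.
\<close>

lemma normal_continuous:
  assumes v: "represents v w" and g: "has_weak_div (region M) v g"
    and K: "K \<in> cells M" and K': "K' \<in> cells M" and ne: "K \<noteq> K'" and F: "F facet_of K" "F facet_of K'"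
    and x: "x \<in> F"
  shows "w K x \<bullet> nrm K F = w K' x \<bullet> nrm K F"
proof -
  interpret P: full_polytope K by (rule cell_polytope[OF K])
  interpret P': full_polytope K' by (rule cell_polytope[OF K'])
  have FP: "F \<in> P.facets" "F \<in> P'.facets" using F by (auto simp: P.facets_def P'.facets_def)
  interpret FF: flat_facet F "nrm K F" "P.offset F" by (rule P.flat_facet[OF FP(1)])
  define n where "n = nrm K F"
  define c where "c = P.offset F"
  have n': "nrm K' F = - n" and c': "P'.offset F = - c"
    using shared_facet[OF K K' ne F] by (auto simp: n_def c_def)
  have Fh: "n \<bullet> y = c" if "y \<in> F" for y using P.facet(3)[OF FP(1)] that by (auto simp: n_def c_def)
  have wK: "smooth_field (w K)" "smooth_field (w K')" using represents_smooth[OF v] K K' by auto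
  define j where "j y = (w K y - w K' y) \<bullet> n" for y
  have js: "smooth_function j"
    unfolding j_def[abs_def] inner_diff_left by (intro smooth_diff smooth_field_inner wK)
  have j0: "j p = 0" if p: "p \<in> rel_interior F" for p
  proof -
    obtain r where r: "r > 0" "\<And>y. y \<in> ball p r \<Longrightarrow> n \<bullet> y \<le> c \<Longrightarrow> y \<in> K"
      "\<And>y. y \<in> ball p r \<Longrightarrow> n \<bullet> y < c \<Longrightarrow> y \<in> interior K"
      "\<And>F'. F' \<in> P.facets \<Longrightarrow> F' \<noteq> F \<Longrightarrow> ball p r \<inter> F' = {}"
      using P.facet_neighbourhood[OF FP(1) p] unfolding n_def c_def by metis
    obtain r' where r': "r' > 0" "\<And>y. y \<in> ball p r' \<Longrightarrow> n \<bullet> y \<ge> c \<Longrightarrow> y \<in> K'"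
      "\<And>y. y \<in> ball p r' \<Longrightarrow> n \<bullet> y > c \<Longrightarrow> y \<in> interior K'"
      "\<And>F'. F' \<in> P'.facets \<Longrightarrow> F' \<noteq> F \<Longrightarrow> ball p r' \<inter> F' = {}"
      using P'.facet_neighbourhood[OF FP(2) p] unfolding n' c' by simp metis
    define \<rho> where "\<rho> = min r r' / 2"
    define B where "B = ball p (2 * \<rho>)"
    have \<rho>: "\<rho> > 0" using r(1) r'(1) by (simp add: \<rho>_def)
    have Bsub: "B \<subseteq> ball p r" "B \<subseteq> ball p r'" by (auto simp: B_def \<rho>_def)
    have "B \<subseteq> closure (region M)"
    proof
      fix y assume y: "y \<in> B"
      have "y \<in> K \<or> y \<in> K'" using y Bsub r(2)[of y] r'(2)[of y] by (cases "n \<bullet> y \<le> c") auto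
      then show "y \<in> closure (region M)" using cell_subset K K' by blast
    qed
    then have Breg: "B \<subseteq> region M"
      unfolding B_def by (subst region_regular) (rule interior_maximal, auto)
    \<comment> \<open>The two cells fill the ball up to the hyperplane, which leaves no room for a third one.\<close>
    have Bother: "B \<inter> L = {}" if L: "L \<in> cells M" "L \<noteq> K" "L \<noteq> K'" for L
    proof -
      have "B \<inter> interior L = {}"
      proof (rule ccontr)
        assume ne: "B \<inter> interior L \<noteq> {}"
        have "open (B \<inter> interior L)" by (simp add: B_def open_Int)
        then have "\<not> negligible (B \<inter> interior L)" using ne open_not_negligible by blast
        moreover have "n \<noteq> 0" using P.norm_normal[OF FP(1)] by (auto simp: n_def)
        then have "negligible {y. n \<bullet> y = c}" by (intro negligible_hyperplane) simp
        ultimately have "\<not> B \<inter> interior L \<subseteq> {y. n \<bullet> y = c}" using negligible_subset by blast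
        then obtain y where y: "y \<in> B" "y \<in> interior L" "n \<bullet> y \<noteq> c" by blast
        then have "y \<in> interior K \<or> y \<in> interior K'"
          using Bsub r(3)[of y] r'(3)[of y] by (cases "n \<bullet> y < c") auto
        moreover have "y \<in> K" if "y \<in> interior K" using that interior_subset by blast
        moreover have "y \<in> K'" if "y \<in> interior K'" using that interior_subset by blast
        ultimately show False
          using interior_cell_disjoint[OF L(1) K y(2)] interior_cell_disjoint[OF L(1) K' y(2)] L by auto
      qed
      then have "B \<inter> closure (interior L) = {}" by (simp add: B_def open_Int_closure_eq_empty)
      then show ?thesis using cell_props(6)[OF L(1)] by simp
    qed
    \<comment> \<open>The factor \<open>j\<close> makes the integrand on the facet non-negative.\<close>
    define \<psi> where "\<psi> y = j y * smooth_step (\<rho>\<^sup>2 - (norm (y - p))\<^sup>2)" for y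
    define \<phi> where "\<phi> m y = \<psi> y * smooth_step (1 - (real m * (n \<bullet> y - c))\<^sup>2)" for m y
    have \<psi>s: "smooth_function \<psi>" unfolding \<psi>_def
      by (intro smooth_mult js smooth_flat_step smooth_diff smooth_const smooth_norm_sq)
    have ns: "smooth_function (\<lambda>y. n \<bullet> y)" using smooth_inner[of n] by (simp add: inner_commute)
    have \<phi>s: "smooth_function (\<phi> m)" for m unfolding \<phi>_def
      by (intro smooth_mult \<psi>s smooth_flat_step smooth_diff smooth_const smooth_power ns)
    have \<psi>0: "\<psi> y = 0" if "y \<notin> cball p \<rho>" for y
    proof -
      have "\<rho> < norm (y - p)" using that by (simp add: dist_norm norm_minus_commute)
      then have "\<rho>\<^sup>2 < (norm (y - p))\<^sup>2" using \<rho> by (intro power_strict_mono) auto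
      then show ?thesis by (simp add: \<psi>_def smooth_step_simps)
    qed
    have cB: "cball p \<rho> \<subseteq> B" using \<rho> by (auto simp: B_def)
    have \<psi>B: "\<psi> y = 0" if "y \<notin> B" for y using \<psi>0 cB that by blast
    have \<phi>B: "\<phi> m y = 0" if "y \<notin> B" for m y using \<psi>B[OF that] by (simp add: \<phi>_def)
    define S1 where "S1 = smooth_step 1"
    have S1: "S1 > 0" by (simp add: S1_def smooth_step_simps)
    have \<phi>F: "\<phi> m y = S1 * \<psi> y" if "y \<in> F" for m y using Fh[OF that] by (simp add: \<phi>_def S1_def)
    define h where "h y = broken_div M v y - g y" for y
    have hL: "h \<in> L2 (region M)"
    proof -
      have "g \<in> L2 (region M)" using g by (simp add: has_weak_div_def)
      from L2_add[OF broken_div_L2[OF v] L2_cmult[OF this, of "-1"]] show ?thesis by (simp add: h_def[abs_def])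
    qed
    have cont: "continuous_on UNIV (\<lambda>y. S1 * \<psi> y * (w L y \<bullet> n))" if "L \<in> cells M" for L
      using smooth_functionD(1)[OF smooth_mult[OF smooth_mult[OF smooth_const \<psi>s] smooth_field_inner[OF represents_smooth[OF v that]]]] .
    have eq: "(LINT y|lebesgue_on (region M). \<phi> m y * h y) = S1 * facet_integral F n (\<lambda>y. \<psi> y * j y)" for m
    proof -
      define T where "T L F' = facet_integral F' (nrm L F') (\<lambda>x. \<phi> m x * (w L x \<bullet> nrm L F'))" for L F'
      have T0: "T L F' = 0" if "B \<inter> F' = {}" for L F'
        unfolding T_def using that \<phi>B by (intro facet_integral_zero) auto
      have "(LINT y|lebesgue_on (region M). \<phi> m y * h y) = (\<Sum>L\<in>cells M. \<Sum>F'\<in>full_polytope.facets L. T L F')"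
        unfolding h_def T_def
        by (rule green_test[OF v g \<phi>s, where C="cball p \<rho>"]) (use cB Breg \<psi>0 in \<open>auto simp: \<phi>_def\<close>)
      also have "\<dots> = (\<Sum>L\<in>{K, K'}. \<Sum>F'\<in>full_polytope.facets L. T L F')"
      proof (rule sum.mono_neutral_right[OF finite_cells])
        show "\<forall>L\<in>cells M - {K, K'}. (\<Sum>F'\<in>full_polytope.facets L. T L F') = 0"
        proof
          fix L assume L: "L \<in> cells M - {K, K'}"
          have "T L F' = 0" if "F' \<in> full_polytope.facets L" for F'
          proof (rule T0)
            have "F' \<subseteq> L" using that cell_props(5) L facet_of_imp_subset by blast
            then show "B \<inter> F' = {}" using Bother[of L] L by blast
          qed
          then show "(\<Sum>F'\<in>full_polytope.facets L. T L F') = 0" by simp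
        qed
      qed (use K K' in auto)
      also have "\<dots> = (\<Sum>F'\<in>P.facets. T K F') + (\<Sum>F'\<in>P'.facets. T K' F')" using ne by simp
      also have "(\<Sum>F'\<in>P.facets. T K F') = (\<Sum>F'\<in>{F}. T K F')"
      proof (rule sum.mono_neutral_right[OF P.finite_facets])
        have "B \<inter> F' = {}" if "F' \<in> P.facets" "F' \<noteq> F" for F' using r(4)[OF that] Bsub(1) by blast
        then show "\<forall>F'\<in>P.facets - {F}. T K F' = 0" using T0 by blast
      qed (use FP in auto)
      also have "(\<Sum>F'\<in>P'.facets. T K' F') = (\<Sum>F'\<in>{F}. T K' F')"
      proof (rule sum.mono_neutral_right[OF P'.finite_facets])
        have "B \<inter> F' = {}" if "F' \<in> P'.facets" "F' \<noteq> F" for F' using r'(4)[OF that] Bsub(2) by blast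
        then show "\<forall>F'\<in>P'.facets - {F}. T K' F' = 0" using T0 by blast
      qed (use FP in auto)
      finally have 1: "(LINT y|lebesgue_on (region M). \<phi> m y * h y) = T K F + T K' F" by simp
      have TK: "T K F = facet_integral F n (\<lambda>y. S1 * \<psi> y * (w K y \<bullet> n))"
        unfolding T_def n_def[symmetric] by (rule facet_integral_cong) (simp add: \<phi>F)
      have "T K' F = facet_integral F (- n) (\<lambda>y. (-1) * (S1 * \<psi> y * (w K' y \<bullet> n)))"
        unfolding T_def n' by (rule facet_integral_cong) (simp add: \<phi>F)
      also have "\<dots> = facet_integral F n (\<lambda>y. (-1) * (S1 * \<psi> y * (w K' y \<bullet> n)))"
        unfolding n_def
        by (rule facet_integral_flip[OF FF.n FF.hull compact_imp_closed[OF FF.compact]])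
           (rule continuous_on_mult_left[OF cont[OF K', unfolded n_def]])
      finally have TK': "T K' F = facet_integral F n (\<lambda>y. (-1) * (S1 * \<psi> y * (w K' y \<bullet> n)))" .
      have "T K F + T K' F = facet_integral F n (\<lambda>y. S1 * \<psi> y * (w K y \<bullet> n) + (-1) * (S1 * \<psi> y * (w K' y \<bullet> n)))"
        unfolding TK TK' using FF.facet_integral_add[OF cont[OF K] continuous_on_mult_left[OF cont[OF K']], of "-1"]
        by (simp add: n_def)
      also have "(\<lambda>y. S1 * \<psi> y * (w K y \<bullet> n) + (-1) * (S1 * \<psi> y * (w K' y \<bullet> n))) = (\<lambda>y. S1 * (\<psi> y * j y))"
        by (rule ext) (simp add: j_def inner_diff_left algebra_simps)
      also have "facet_integral F n (\<lambda>y. S1 * (\<psi> y * j y)) = S1 * facet_integral F n (\<lambda>y. \<psi> y * j y)"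
        unfolding n_def by (rule FF.facet_integral_cmult[OF smooth_functionD(1)[OF smooth_mult[OF \<psi>s js]]])
      finally show ?thesis using 1 by simp
    qed
    obtain R where R: "region M \<subseteq> cball 0 R" using bounded_region by (metis bounded_iff mem_cball_0 subsetI)
    obtain C where C: "C \<ge> 0" "\<And>y. y \<in> cball 0 R \<Longrightarrow> \<bar>\<psi> y\<bar> \<le> C"
      using smooth_bounded_on_cball[OF \<psi>s] by blast
    have "(\<lambda>m. LINT y|lebesgue_on (region M). \<phi> m y * h y) \<longlonglongrightarrow> (LINT y|lebesgue_on (region M). 0 * h y)"
    proof (rule bounded_test_integral_tendsto[OF \<phi>s _ hL])
      show "\<bar>\<phi> m y\<bar> \<le> C" if "y \<in> region M" for m y
      proof -
        have "\<bar>\<psi> y\<bar> * \<bar>smooth_step (1 - (real m * (n \<bullet> y - c))\<^sup>2)\<bar> \<le> C * 1"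
          using C that R by (intro mult_mono) (auto simp: smooth_step_simps(4))
        then show ?thesis by (simp add: \<phi>_def abs_mult)
      qed
      have "n \<noteq> 0" using P.norm_normal[OF FP(1)] by (auto simp: n_def)
      then have "AE y in lborel. n \<bullet> y \<noteq> c" by (intro AE_not_hyperplane) simp
      then show "AE y in lborel. (\<lambda>m. \<phi> m y) \<longlonglongrightarrow> 0"
      proof eventually_elim
        case (elim y)
        define s where "s = \<bar>n \<bullet> y - c\<bar>"
        have s: "s > 0" using elim by (simp add: s_def)
        have "eventually (\<lambda>m. 1 / s \<le> real m) sequentially"
          by (rule eventually_ge_at_top[THEN eventually_compose_filterlim, OF filterlim_real_sequentially])
        then have "eventually (\<lambda>m. \<phi> m y = 0) sequentially"
        proof eventually_elim
          case (elim m)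
          then have "1 \<le> real m * s" using s by (simp add: field_simps)
          then have "1 \<le> (real m * s)\<^sup>2" by simp
          then have "1 \<le> (real m * (n \<bullet> y - c))\<^sup>2" by (simp add: s_def power_mult_distrib)
          then show ?case by (simp add: \<phi>_def smooth_step_simps(1))
        qed
        then show ?case by (rule tendsto_eventually)
      qed
    qed simp
    then have "S1 * facet_integral F n (\<lambda>y. \<psi> y * j y) = 0" unfolding eq by (simp add: LIMSEQ_const_iff)
    then have z: "facet_integral F n (\<lambda>y. \<psi> y * j y) = 0" using S1 by simp
    have "\<psi> p * j p = 0"
    proof (rule FF.facet_integral_eq_0D)
      show "continuous_on UNIV (\<lambda>y. \<psi> y * j y)" by (rule smooth_functionD(1)[OF smooth_mult[OF \<psi>s js]])
      show "0 \<le> \<psi> y * j y" for y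
      proof -
        have "\<psi> y * j y = (j y)\<^sup>2 * smooth_step (\<rho>\<^sup>2 - (norm (y - p))\<^sup>2)"
          by (simp add: \<psi>_def power2_eq_square)
        then show ?thesis by (simp add: smooth_step_simps(2))
      qed
      show "facet_integral F (nrm K F) (\<lambda>y. \<psi> y * j y) = 0" using z by (simp add: n_def)
    qed (rule p)
    then show "j p = 0" using \<rho> by (simp add: \<psi>_def smooth_step_simps(1))
  qed
  have "x \<in> closure (rel_interior F)"
  proof -
    have "convex F" using F(1) P.conv face_of_imp_convex by (auto simp: facet_of_def)
    then show ?thesis using convex_closure_rel_interior closure_subset x by blast
  qed
  moreover have "continuous_on (closure (rel_interior F)) j"
    using smooth_functionD(1)[OF js] continuous_on_subset by blast
  ultimately have "j x = 0" using continuous_constant_on_closure[of "rel_interior F" j 0 x] j0 by blast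
  then show ?thesis by (simp add: j_def n_def inner_diff_left)
qed

text \<open>
  On a cell \<open>K\<close>, the function \<open>P\<close> is approximated by test functions \<open>\<phi> m\<close> with support in the interior of \<open>K\<close>, for
  which \<open>green_test\<close> has no facet terms.
\<close>

lemma weak_div_broken_div:
  assumes v: "represents v w" and g: "has_weak_div (region M) v g"
    and P: "\<And>K x. K \<in> cells M \<Longrightarrow> x \<in> interior K \<Longrightarrow> P x = PK K x"
    and PK: "\<And>K. K \<in> cells M \<Longrightarrow> smooth_function (PK K)"
  shows "(LINT x|lebesgue_on (region M). g x * P x) = (LINT x|lebesgue_on (region M). broken_div M v x * P x)"
proof -
  define h where "h y = broken_div M v y - g y" for y
  have DL: "broken_div M v \<in> L2 (region M)" by (rule broken_div_L2[OF v])
  have gL: "g \<in> L2 (region M)" using g by (simp add: has_weak_div_def)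
  have PL: "P \<in> L2 (region M)" by (rule piecewise_L2[OF P]) (auto intro: smooth_functionD PK)
  have hL: "h \<in> L2 (region M)"
    using L2_add[OF DL L2_cmult[OF gL, of "-1"]] by (simp add: h_def[abs_def])
  have bm: "f \<in> borel_measurable (lebesgue_on (region M))" if "f \<in> borel_measurable borel" for f :: "'a \<Rightarrow> real"
    by (rule measurable_restrict_space1, rule measurable_completion) (use that in simp)
  have cell0: "(LINT x|lebesgue_on (region M). (indicator (interior K) x * PK K x) * h x) = 0" if K: "K \<in> cells M" for K
  proof -
    interpret Q: full_polytope K by (rule cell_polytope[OF K])
    define \<phi> where "\<phi> m y = PK K y * (\<Prod>F\<in>Q.facets. smooth_step (real m * Q.slack F y - 1))" for m y
    have sl: "smooth_function (Q.slack F)" for F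
      unfolding Q.slack_def[abs_def] using smooth_inner[of "nrm K F"]
      by (intro smooth_diff smooth_const) (simp add: inner_commute)
    have \<phi>s: "smooth_function (\<phi> m)" for m
      unfolding \<phi>_def by (intro smooth_mult PK K smooth_prod smooth_flat_step smooth_diff smooth_const sl)
    define C where "C m = K \<inter> (\<Inter>F\<in>Q.facets. {y. 1 \<le> real m * Q.slack F y})" for m
    have \<phi>0: "\<phi> m y = 0" if F: "F \<in> Q.facets" "real m * Q.slack F y < 1" for m y F
    proof -
      have "smooth_step (real m * Q.slack F y - 1) = 0" using F by (simp add: smooth_step_simps(1))
      then have "(\<Prod>F\<in>Q.facets. smooth_step (real m * Q.slack F y - 1)) = 0"
        using F(1) Q.finite_facets by (intro prod_zero) auto
      then show ?thesis by (simp add: \<phi>_def)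
    qed
    have "closed (\<Inter>F\<in>Q.facets. {y. 1 \<le> real m * Q.slack F y})" for m
      by (intro closed_INT ballI closed_Collect_le continuous_on_const continuous_on_mult_left smooth_functionD(1)[OF sl])
    then have Cc: "compact (C m)" for m unfolding C_def by (rule compact_Int_closed[OF Q.compact])
    have pos: "0 < Q.slack F y" if "1 \<le> real m * Q.slack F y" for m F y
      using that zero_less_mult_pos[of "real m" "Q.slack F y"] by (cases "m = 0") auto
    have Csub: "C m \<subseteq> interior K" for m
      unfolding Q.interior_eq C_def using pos by (auto simp: Q.slack_def)
    have \<phi>C: "\<phi> m y = 0" if yC: "y \<notin> C m" for m y
    proof (cases "y \<in> K")
      case True
      then obtain F where "F \<in> Q.facets" "\<not> 1 \<le> real m * Q.slack F y" using yC by (auto simp: C_def)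
      then show ?thesis using \<phi>0 by force
    next
      case False
      then obtain F where "F \<in> Q.facets" "Q.slack F y < 0" using Q.K_eq unfolding Q.slack_def by force
      then show ?thesis using mult_nonneg_nonpos[of "real m" "Q.slack F y"] by (intro \<phi>0[of F]) auto
    qed
    have z: "(LINT y|lebesgue_on (region M). \<phi> m y * h y) = 0" for m
    proof -
      have "(LINT y|lebesgue_on (region M). \<phi> m y * h y)
        = (\<Sum>L\<in>cells M. \<Sum>F\<in>full_polytope.facets L. facet_integral F (nrm L F) (\<lambda>x. \<phi> m x * (w L x \<bullet> nrm L F)))"
        unfolding h_def
        by (rule green_test[OF v g \<phi>s, where C="C m"]) (use Cc Csub interior_cell_subset[OF K] \<phi>C in auto)
      also have "\<dots> = 0"
      proof (intro sum.neutral ballI facet_integral_zero)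
        fix L F y assume L: "L \<in> cells M" and F: "F \<in> full_polytope.facets L" and y: "y \<in> F"
        have Ff: "F facet_of L" using F cell_props(5)[OF L] by blast
        have "y \<notin> C m"
        proof
          assume "y \<in> C m"
          then have yi: "y \<in> interior K" using Csub by blast
          moreover have "y \<in> L" using y facet_of_imp_subset[OF Ff] by blast
          ultimately have "L = K" using interior_cell_disjoint[OF K L] by blast
          then have "F face_of K" "F \<noteq> K" using Ff by (auto simp: facet_of_def)
          then show False using face_of_disjoint_interior yi y by blast
        qed
        then show "\<phi> m y * (w L y \<bullet> nrm L F) = 0" by (simp add: \<phi>C)
      qed
      finally show ?thesis .
    qed
    obtain R where R: "region M \<subseteq> cball 0 R" using bounded_region by (metis bounded_iff mem_cball_0 subsetI)
    obtain C1 where C1: "C1 \<ge> 0" "\<And>y. y \<in> cball 0 R \<Longrightarrow> \<bar>PK K y\<bar> \<le> C1"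
      using smooth_bounded_on_cball[OF PK[OF K]] by blast
    have [measurable]: "PK K \<in> borel_measurable borel" using smooth_measurable[OF PK[OF K]] .
    have "(\<lambda>m. LINT y|lebesgue_on (region M). \<phi> m y * h y) \<longlonglongrightarrow> (LINT y|lebesgue_on (region M). (indicator (interior K) y * PK K y) * h y)"
    proof (rule bounded_test_integral_tendsto[OF \<phi>s _ hL])
      show "\<bar>\<phi> m y\<bar> \<le> C1" if "y \<in> region M" for m y
      proof -
        have "\<bar>\<Prod>F\<in>Q.facets. smooth_step (real m * Q.slack F y - 1)\<bar> \<le> 1"
          unfolding abs_prod by (intro prod_le_1) (auto simp: smooth_step_simps(4))
        then have "\<bar>PK K y\<bar> * \<bar>\<Prod>F\<in>Q.facets. smooth_step (real m * Q.slack F y - 1)\<bar> \<le> C1 * 1"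
          using C1 that R by (intro mult_mono) auto
        then show ?thesis by (simp add: \<phi>_def abs_mult)
      qed
      show "(\<lambda>y. indicator (interior K) y * PK K y) \<in> borel_measurable borel" by measurable
      show "AE y in lborel. (\<lambda>m. \<phi> m y) \<longlonglongrightarrow> indicator (interior K) y * PK K y"
      proof (rule AE_I2)
        fix y
        show "(\<lambda>m. \<phi> m y) \<longlonglongrightarrow> indicator (interior K) y * PK K y"
        proof (cases "y \<in> interior K")
          case True
          then have sp: "0 < Q.slack F y" if "F \<in> Q.facets" for F
            using that unfolding Q.interior_eq by (auto simp: Q.slack_def)
          have "(\<lambda>m. PK K y * (\<Prod>F\<in>Q.facets. smooth_step (real m * Q.slack F y - 1))) \<longlonglongrightarrow> PK K y * (\<Prod>F\<in>Q.facets. 1)"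
            by (intro tendsto_mult_left tendsto_prod smooth_step_tendsto_1 sp)
          then show ?thesis using True by (simp add: \<phi>_def)
        next
          case False
          then have "\<phi> m y = 0" for m using \<phi>C Csub by blast
          then show ?thesis using False by simp
        qed
      qed
    qed
    then show ?thesis unfolding z by (simp add: LIMSEQ_const_iff)
  qed
  have int: "integrable (lebesgue_on (region M)) (\<lambda>x. (indicator (interior K) x * PK K x) * h x)" if K: "K \<in> cells M" for K
  proof -
    have [measurable]: "PK K \<in> borel_measurable borel"
      using smooth_functionD(1)[OF PK[OF K]] by (rule borel_measurable_continuous_onI)
    have "(\<lambda>x. indicator (interior K) x * PK K x) \<in> borel_measurable (lebesgue_on (region M))"
      by (rule bm) measurable
    moreover have "integrable (lebesgue_on (region M)) (\<lambda>x. (norm (indicator (interior K) x * PK K x))\<^sup>2)"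
    proof (rule Bochner_Integration.integrable_bound)
      have "PK K \<in> L2 (region M)"
        by (rule piecewise_L2[where g="\<lambda>_. PK K"]) (auto intro: smooth_functionD PK[OF K])
      then show "integrable (lebesgue_on (region M)) (\<lambda>x. (norm (PK K x))\<^sup>2)" by (simp add: L2_def)
      show "(\<lambda>x. (norm (indicator (interior K) x * PK K x))\<^sup>2) \<in> borel_measurable (lebesgue_on (region M))"
        by (rule bm) measurable
    qed (auto simp: indicator_def)
    ultimately have "(\<lambda>x. indicator (interior K) x * PK K x) \<in> L2 (region M)" by (simp add: L2_def)
    then show ?thesis using hL by (rule L2_mult_integrable)
  qed
  have "(LINT x|lebesgue_on (region M). P x * h x)
      = (LINT x|lebesgue_on (region M). (\<Sum>K\<in>cells M. (indicator (interior K) x * PK K x) * h x))"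
  proof (rule integral_cong_cells)
    show "integrable (lebesgue_on (region M)) (\<lambda>x. P x * h x)" by (rule L2_mult_integrable[OF PL hL])
    show "integrable (lebesgue_on (region M)) (\<lambda>x. \<Sum>K\<in>cells M. (indicator (interior K) x * PK K x) * h x)"
      by (intro Bochner_Integration.integrable_sum int)
    show "P x * h x = (\<Sum>K\<in>cells M. (indicator (interior K) x * PK K x) * h x)" if "L \<in> cells M" "x \<in> interior L" for L x
      using cellwise_sum[OF that, of "\<lambda>K. PK K x"] P[OF that] by (simp add: sum_distrib_right[symmetric])
  qed
  also have "\<dots> = 0" by (subst Bochner_Integration.integral_sum) (auto intro: int simp: cell0)
  finally have "(LINT x|lebesgue_on (region M). broken_div M v x * P x - g x * P x) = 0"
    by (simp add: h_def algebra_simps)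
  then show ?thesis
    using Bochner_Integration.integral_diff[OF L2_mult_integrable[OF DL PL] L2_mult_integrable[OF gL PL]] by simp
qed

end

section \<open>Projection onto broken polynomials\<close>

lemma L2_diff:
  fixes f g :: "'a::euclidean_space \<Rightarrow> real"
  shows "f \<in> L2 \<Omega> \<Longrightarrow> g \<in> L2 \<Omega> \<Longrightarrow> (\<lambda>x. f x - g x) \<in> L2 \<Omega>"
  using L2_add[OF _ L2_cmult[of g \<Omega> "-1"], of f] by simp

lemma L2_zero: "(\<lambda>x. 0 :: real) \<in> L2 \<Omega>"
  by (simp add: L2_def)

lemma L2_sum:
  fixes f :: "'i \<Rightarrow> 'a::euclidean_space \<Rightarrow> real"
  shows "(\<And>i. i \<in> I \<Longrightarrow> f i \<in> L2 \<Omega>) \<Longrightarrow> (\<lambda>x. \<Sum>i\<in>I. f i x) \<in> L2 \<Omega>"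
  by (induction I rule: infinite_finite_induct) (auto intro: L2_zero L2_add)

text \<open>
  Gram-Schmidt, one function \<open>a\<close> at a time: \<open>a'\<close> is the part of \<open>a\<close> orthogonal to \<open>E\<close>. If \<open>a'\<close> has norm zero, it
  is zero almost everywhere and orthogonality to \<open>a\<close> comes for free; in this case \<open>t = 0\<close>, because
  division by zero gives zero.
\<close>

lemma L2_projection:
  fixes E :: "('a::euclidean_space \<Rightarrow> real) set"
  assumes "finite E" "\<And>e. e \<in> E \<Longrightarrow> e \<in> L2 \<Omega>" "f \<in> L2 \<Omega>"
  shows "\<exists>c. \<forall>e\<in>E. (LINT x|lebesgue_on \<Omega>. (f x - (\<Sum>e'\<in>E. c e' * e' x)) * e x) = 0"
  using assms
proof (induction E arbitrary: f rule: finite_induct)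
  case empty
  then show ?case by simp
next
  case (insert a E)
  let ?I = "\<lambda>g. (LINT x|lebesgue_on \<Omega>. g x)"
  have E: "e \<in> E \<Longrightarrow> e \<in> L2 \<Omega>" and a: "a \<in> L2 \<Omega>" for e using insert.prems by auto
  have S: "(\<lambda>x. \<Sum>e\<in>E. c e * e x) \<in> L2 \<Omega>" for c by (intro L2_sum L2_cmult E)
  obtain c where c: "\<forall>e\<in>E. ?I (\<lambda>x. (a x - (\<Sum>e'\<in>E. c e' * e' x)) * e x) = 0"
    using insert.IH[OF E a] by blast
  obtain d where d: "\<forall>e\<in>E. ?I (\<lambda>x. (f x - (\<Sum>e'\<in>E. d e' * e' x)) * e x) = 0"
    using insert.IH[OF E insert.prems(2)] by blast
  define a' where "a' x = a x - (\<Sum>e'\<in>E. c e' * e' x)" for x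
  define f' where "f' x = f x - (\<Sum>e'\<in>E. d e' * e' x)" for x
  have a'L: "a' \<in> L2 \<Omega>" and f'L: "f' \<in> L2 \<Omega>"
    unfolding a'_def[abs_def] f'_def[abs_def] by (intro L2_diff a insert.prems S)+
  define t where "t = ?I (\<lambda>x. f' x * a' x) / ?I (\<lambda>x. a' x * a' x)"
  define r where "r x = f' x - t * a' x" for x
  have rL: "r \<in> L2 \<Omega>" unfolding r_def[abs_def] by (intro L2_diff f'L L2_cmult a'L)
  have rint: "?I (\<lambda>x. r x * g x) = ?I (\<lambda>x. f' x * g x) - t * ?I (\<lambda>x. a' x * g x)" if g: "g \<in> L2 \<Omega>" for g
  proof -
    have "?I (\<lambda>x. r x * g x) = ?I (\<lambda>x. f' x * g x - t * (a' x * g x))" by (simp add: r_def algebra_simps)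
    also have "\<dots> = ?I (\<lambda>x. f' x * g x) - ?I (\<lambda>x. t * (a' x * g x))"
      by (intro Bochner_Integration.integral_diff integrable_mult_right L2_mult_integrable f'L a'L g)
    finally show ?thesis by simp
  qed
  have rE: "?I (\<lambda>x. r x * e x) = 0" if "e \<in> E" for e
    using rint[OF E[OF that]] c d that by (simp add: a'_def f'_def)
  have ra': "?I (\<lambda>x. r x * a' x) = 0"
  proof (cases "?I (\<lambda>x. a' x * a' x) = 0")
    case False
    then show ?thesis using rint[OF a'L] by (simp add: t_def)
  next
    case True
    then have "AE x in lebesgue_on \<Omega>. a' x * a' x = 0"
      using integral_nonneg_eq_0_iff_AE[OF L2_mult_integrable[OF a'L a'L]] by simp
    then have "AE x in lebesgue_on \<Omega>. r x * a' x = 0" by eventually_elim simp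
    then show ?thesis by (rule integral_eq_zero_AE)
  qed
  have "?I (\<lambda>x. r x * a x) = ?I (\<lambda>x. r x * a' x + (\<Sum>e\<in>E. c e * (r x * e x)))"
    by (simp add: a'_def algebra_simps sum_distrib_left)
  also have "\<dots> = ?I (\<lambda>x. r x * a' x) + ?I (\<lambda>x. \<Sum>e\<in>E. c e * (r x * e x))"
    by (intro Bochner_Integration.integral_add Bochner_Integration.integrable_sum integrable_mult_right L2_mult_integrable rL a'L E)
  also have "?I (\<lambda>x. \<Sum>e\<in>E. c e * (r x * e x)) = (\<Sum>e\<in>E. c e * ?I (\<lambda>x. r x * e x))"
    by (subst Bochner_Integration.integral_sum) (auto intro!: integrable_mult_right L2_mult_integrable rL E)
  finally have ra: "?I (\<lambda>x. r x * a x) = 0" using ra' rE by simp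
  define k where "k e = (if e = a then t else d e - t * c e)" for e
  have "f x - (\<Sum>e\<in>insert a E. k e * e x) = r x" for x
  proof -
    have "(\<Sum>e\<in>E. k e * e x) = (\<Sum>e\<in>E. (d e - t * c e) * e x)"
      using insert.hyps(2) by (intro sum.cong) (auto simp: k_def)
    also have "\<dots> = (\<Sum>e\<in>E. d e * e x) - t * (\<Sum>e\<in>E. c e * e x)"
      by (simp add: left_diff_distrib sum_subtractf sum_distrib_left mult.assoc)
    finally show ?thesis using insert.hyps by (simp add: r_def f'_def a'_def k_def algebra_simps)
  qed
  then have "\<forall>e\<in>insert a E. ?I (\<lambda>x. (f x - (\<Sum>e'\<in>insert a E. k e' * e' x)) * e x) = 0"
    using ra rE by simp
  then show ?case by blast
qed

context simplicial_mesh begin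

definition broken_poly :: "nat \<Rightarrow> ('a \<Rightarrow> real) \<Rightarrow> bool" where
  "broken_poly k q \<longleftrightarrow> (\<forall>K\<in>cells M. \<exists>p\<in>poly_space k. \<forall>x\<in>interior K. q x = p x)"

lemma broken_polyE:
  assumes "broken_poly k q"
  obtains p where "\<And>K. K \<in> cells M \<Longrightarrow> p K \<in> poly_space k" "\<And>K x. K \<in> cells M \<Longrightarrow> x \<in> interior K \<Longrightarrow> q x = p K x"
  using assms unfolding broken_poly_def by metis

lemma broken_poly_L2: "broken_poly k q \<Longrightarrow> q \<in> L2 (region M)"
  by (erule broken_polyE, rule piecewise_L2) (auto intro: smooth_functionD poly_space_smooth)

lemma Q_h_iff: "q \<in> Q_h M k \<longleftrightarrow> broken_poly k q \<and> (LINT x|lebesgue_on (region M). q x) = 0"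
  using broken_poly_L2 by (auto simp: Q_h_def broken_poly_def)

lemma broken_poly_add: "broken_poly k p \<Longrightarrow> broken_poly k q \<Longrightarrow> broken_poly k (\<lambda>x. p x + q x)"
  unfolding broken_poly_def
proof
  fix K assume h: "\<forall>K\<in>cells M. \<exists>p'\<in>poly_space k. \<forall>x\<in>interior K. p x = p' x"
    "\<forall>K\<in>cells M. \<exists>p\<in>poly_space k. \<forall>x\<in>interior K. q x = p x" "K \<in> cells M"
  then obtain p' q' where "p' \<in> poly_space k" "q' \<in> poly_space k" "\<forall>x\<in>interior K. p x = p' x" "\<forall>x\<in>interior K. q x = q' x" by blast
  then show "\<exists>r\<in>poly_space k. \<forall>x\<in>interior K. p x + q x = r x"
    by (intro bexI[OF _ poly_space_add[of p' k q']]) auto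
qed

lemma broken_poly_cmult: "broken_poly k p \<Longrightarrow> broken_poly k (\<lambda>x. r * p x)"
  unfolding broken_poly_def by (metis (no_types, lifting) poly_space_cmult)

lemma broken_poly_const: "broken_poly k (\<lambda>x. r)"
  unfolding broken_poly_def by (intro ballI bexI[OF _ poly_space_const[of r]]) simp

lemma broken_poly_sum: "(\<And>i. i \<in> I \<Longrightarrow> broken_poly k (p i)) \<Longrightarrow> broken_poly k (\<lambda>x. \<Sum>i\<in>I. p i x)"
  by (induction I rule: infinite_finite_induct) (auto intro: broken_poly_const[of _ 0] broken_poly_add)

lemma Q_h_lincomb:
  assumes "p \<in> Q_h M k" "q \<in> Q_h M k"
  shows "(\<lambda>x. p x + r * q x) \<in> Q_h M k"
proof -
  have "integrable (lebesgue_on (region M)) p" "integrable (lebesgue_on (region M)) (\<lambda>x. r * q x)"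
    using assms by (auto simp: Q_h_def intro!: integrable_mult_right L2_integrable)
  then show ?thesis
    using assms by (auto simp: Q_h_iff intro!: broken_poly_add broken_poly_cmult)
qed

text \<open>
  The projection \<open>q0\<close> onto all broken polynomials exists by \<open>L2_projection\<close>, applied to the monomials on
  the single cells. Subtracting its mean yields an element of \<open>Q_h\<close>, and is harmless against functions
  of mean zero.
\<close>

lemma Q_h_projection:
  assumes f: "f \<in> L2 (region M)"
  obtains proj where "proj \<in> Q_h M k"
    "\<And>q. q \<in> Q_h M k \<Longrightarrow> (LINT x|lebesgue_on (region M). q x * proj x) = (LINT x|lebesgue_on (region M). q x * f x)"
proof -
  let ?I = "\<lambda>g. (LINT x|lebesgue_on (region M). g x)"
  define basis where "basis = (\<lambda>(K :: 'a set, \<alpha>) (x :: 'a). indicator (interior K) x * monomial \<alpha> x :: real)"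
  define E where "E = basis ` (cells M \<times> multi_indices k)"
  have finE: "finite E" unfolding E_def using finite_cells finite_multi_indices by blast
  have bp: "broken_poly k (basis (K, \<alpha>))" if "K \<in> cells M" "\<alpha> \<in> multi_indices k" for K \<alpha>
    unfolding broken_poly_def
  proof
    fix L assume L: "L \<in> cells M"
    show "\<exists>p\<in>poly_space k. \<forall>x\<in>interior L. basis (K, \<alpha>) x = p x"
    proof (cases "L = K")
      case True
      then show ?thesis using poly_space_monomial[OF that(2)] by (intro bexI[of _ "monomial \<alpha>"]) (auto simp: basis_def)
    next
      case False
      have "x \<notin> interior K" if "x \<in> interior L" for x
        using interior_cell_disjoint[OF \<open>K \<in> cells M\<close> L, of x] False that interior_subset by blast
      then show ?thesis using poly_space_zero by (intro bexI[of _ "\<lambda>x. 0"]) (auto simp: basis_def)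
    qed
  qed
  have EB: "broken_poly k e" if "e \<in> E" for e using that bp by (auto simp: E_def)
  obtain c where c: "\<forall>e\<in>E. ?I (\<lambda>x. (f x - (\<Sum>e'\<in>E. c e' * e' x)) * e x) = 0"
    using L2_projection[OF finE broken_poly_L2[OF EB] f] by blast
  define q0 where "q0 x = (\<Sum>e\<in>E. c e * e x)" for x
  have q0: "broken_poly k q0"
    unfolding q0_def[abs_def] by (intro broken_poly_sum broken_poly_cmult EB)
  define h where "h x = f x - q0 x" for x
  have hL: "h \<in> L2 (region M)" unfolding h_def[abs_def] by (intro L2_diff f broken_poly_L2[OF q0])
  have orth: "?I (\<lambda>x. q x * h x) = 0" if q: "broken_poly k q" for q
  proof -
    obtain p where p: "\<And>K. K \<in> cells M \<Longrightarrow> p K \<in> poly_space k" "\<And>K x. K \<in> cells M \<Longrightarrow> x \<in> interior K \<Longrightarrow> q x = p K x"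
      using broken_polyE[OF q] by blast
    then obtain d where d: "\<And>K. K \<in> cells M \<Longrightarrow> p K = (\<lambda>x. \<Sum>\<alpha>\<in>multi_indices k. d K \<alpha> * monomial \<alpha> x)"
      unfolding poly_space_iff by metis
    have i: "integrable (lebesgue_on (region M)) (\<lambda>x. h x * basis (K, \<alpha>) x)" if "K \<in> cells M" "\<alpha> \<in> multi_indices k" for K \<alpha>
      by (intro L2_mult_integrable hL broken_poly_L2[OF bp] that)
    have z: "?I (\<lambda>x. h x * basis (K, \<alpha>) x) = 0" if "K \<in> cells M" "\<alpha> \<in> multi_indices k" for K \<alpha>
      using c that unfolding E_def h_def q0_def by blast
    have "?I (\<lambda>x. q x * h x) = ?I (\<lambda>x. \<Sum>K\<in>cells M. \<Sum>\<alpha>\<in>multi_indices k. d K \<alpha> * (h x * basis (K, \<alpha>) x))"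
    proof (rule integral_cong_cells)
      show "integrable (lebesgue_on (region M)) (\<lambda>x. q x * h x)" by (intro L2_mult_integrable hL broken_poly_L2[OF q])
      show "integrable (lebesgue_on (region M)) (\<lambda>x. \<Sum>K\<in>cells M. \<Sum>\<alpha>\<in>multi_indices k. d K \<alpha> * (h x * basis (K, \<alpha>) x))"
        by (intro Bochner_Integration.integrable_sum integrable_mult_right i)
      fix K x assume K: "K \<in> cells M" "x \<in> interior K"
      have "(\<Sum>L\<in>cells M. \<Sum>\<alpha>\<in>multi_indices k. d L \<alpha> * (h x * basis (L, \<alpha>) x))
         = (\<Sum>L\<in>cells M. indicator (interior L) x * (\<Sum>\<alpha>\<in>multi_indices k. d L \<alpha> * (h x * monomial \<alpha> x)))"
        unfolding sum_distrib_left by (intro sum.cong refl) (simp add: basis_def)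
      also have "\<dots> = (\<Sum>\<alpha>\<in>multi_indices k. d K \<alpha> * (h x * monomial \<alpha> x))"
        by (rule cellwise_sum[OF K])
      also have "\<dots> = q x * h x" by (simp add: p(2)[OF K] d[OF K(1)] sum_distrib_right mult_ac) (simp add: sum_distrib_left mult_ac)
      finally show "q x * h x = (\<Sum>K\<in>cells M. \<Sum>\<alpha>\<in>multi_indices k. d K \<alpha> * (h x * basis (K, \<alpha>) x))" ..
    qed
    also have "\<dots> = (\<Sum>K\<in>cells M. \<Sum>\<alpha>\<in>multi_indices k. d K \<alpha> * ?I (\<lambda>x. h x * basis (K, \<alpha>) x))"
      by (subst Bochner_Integration.integral_sum Bochner_Integration.integral_sum,
          (auto intro!: Bochner_Integration.integrable_sum integrable_mult_right i)[1],
          intro sum.cong refl, subst Bochner_Integration.integral_sum) (auto intro!: integrable_mult_right i)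
    finally show ?thesis using z by simp
  qed
  define V where "V = ?I (\<lambda>x. 1 :: real)"
  have "V \<noteq> 0"
  proof
    assume "V = 0"
    obtain K where "K \<in> cells M" using cells_cover region_ne closure_subset by blast
    moreover obtain x where "x \<in> interior K" using cell_props(4)[OF \<open>K \<in> cells M\<close>] by blast
    moreover have "(LINT x|lebesgue_on (region M). 1 * (1::real)) = 0" using \<open>V = 0\<close> by (simp only: V_def mult_1)
    ultimately show False
      using piecewise_zero[where f="\<lambda>x. 1" and g="\<lambda>K x. 1"] by fastforce
  qed
  define \<mu> where "\<mu> = ?I q0 / V"
  define proj where "proj x = q0 x + (- \<mu>)" for x
  have projB: "broken_poly k proj" unfolding proj_def[abs_def] by (intro broken_poly_add q0 broken_poly_const)
  have c1: "integrable (lebesgue_on (region M)) (\<lambda>x. r :: real)" for r by (rule L2_integrable[OF const_L2])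
  have "?I proj = ?I q0 + ?I (\<lambda>x. - \<mu>)"
    unfolding proj_def by (intro Bochner_Integration.integral_add L2_integrable broken_poly_L2[OF q0] c1)
  also have "?I (\<lambda>x. - \<mu>) = - \<mu> * V" unfolding V_def by (subst integral_mult_right_zero[symmetric]) simp
  finally have "?I proj = 0" using \<open>V \<noteq> 0\<close> by (simp add: \<mu>_def)
  then have projQ: "proj \<in> Q_h M k" using projB by (simp add: Q_h_iff)
  show ?thesis
  proof (rule that[OF projQ])
    fix q assume q: "q \<in> Q_h M k"
    then have qB: "broken_poly k q" and qz: "?I q = 0" by (auto simp: Q_h_iff)
    have i: "integrable (lebesgue_on (region M)) (\<lambda>x. q x * proj x)"
      "integrable (lebesgue_on (region M)) (\<lambda>x. q x * h x)" "integrable (lebesgue_on (region M)) (\<lambda>x. \<mu> * q x)"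
      by (intro L2_mult_integrable broken_poly_L2[OF qB] broken_poly_L2[OF projB] hL
          integrable_mult_right L2_integrable)+
    have "?I (\<lambda>x. q x * f x) = ?I (\<lambda>x. q x * proj x + (q x * h x + \<mu> * q x))"
      by (simp add: h_def proj_def algebra_simps)
    also have "\<dots> = ?I (\<lambda>x. q x * proj x) + (?I (\<lambda>x. q x * h x) + ?I (\<lambda>x. \<mu> * q x))"
      by (simp only: Bochner_Integration.integral_add[OF i(1) Bochner_Integration.integrable_add[OF i(2,3)]]
          Bochner_Integration.integral_add[OF i(2,3)])
    finally show "?I (\<lambda>x. q x * proj x) = ?I (\<lambda>x. q x * f x)" using orth[OF qB] qz by simp
  qed
qed

end

section \<open>The convective forms\<close>

context simplicial_mesh begin

lemma V_div_represents:
  assumes "v \<in> V_div M fam k"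
  obtains w where "represents v w" "\<And>K. K \<in> cells M \<Longrightarrow> w K \<in> vec_poly_space (Suc k)"
proof -
  have "\<forall>K\<in>cells M. \<exists>w. w \<in> local_space fam k \<and> (\<forall>x\<in>interior K. v x = w x)"
    using assms by (auto simp: V_div_def)
  then obtain w where w: "\<And>K. K \<in> cells M \<Longrightarrow> w K \<in> local_space fam k \<and> (\<forall>x\<in>interior K. v x = w K x)"
    by metis
  then have p: "w K \<in> vec_poly_space (Suc k)" if "K \<in> cells M" for K
    using that local_space_subset by blast
  then have "represents v w" using w vec_poly_smooth unfolding represents_def by blast
  then show ?thesis using p by (rule that)
qed

lemma V_div_weak_div: "v \<in> V_div M fam k \<Longrightarrow> has_weak_div (region M) v (weak_div (region M) v)"
proof -
  assume "v \<in> V_div M fam k"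
  then obtain g where "has_weak_div (region M) v g" by (auto simp: V_div_def Hdiv_def)
  then show ?thesis unfolding weak_div_def by (rule someI[of "has_weak_div (region M) v"])
qed

lemma trace_represents:
  assumes v: "represents v w" and K: "K \<in> cells M" and x: "x \<in> K"
  shows "trace K v x = w K x"
  using represents_eq[OF v K] smooth_field_continuous[OF represents_smooth[OF v K]] by (rule trace_eq[OF K _ _ x])

lemma V_div_interior_face:
  assumes v: "v \<in> V_div M fam k" and w: "represents v w" and F: "F \<in> interior_faces M" and x: "x \<in> F"
  shows "w (cell_minus M F) x \<bullet> face_normal M F = w (cell_plus M F) x \<bullet> face_normal M F"
proof -
  have Ff: "F \<in> faces M" using F interior_faces_subset by blast
  have "cell_plus M F \<noteq> cell_minus M F" using cell_minus[OF F] by metis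
  then have "w (cell_plus M F) x \<bullet> nrm (cell_plus M F) F = w (cell_minus M F) x \<bullet> nrm (cell_plus M F) F"
    using cell_plus[OF Ff] cell_minus[OF F] x by (intro normal_continuous[OF w V_div_weak_div[OF v]]) auto
  then show ?thesis by (simp add: nrm_cell_plus[OF Ff])
qed

lemma V_div_boundary_face:
  assumes v: "v \<in> V_div M fam k" and w: "represents v w" and F: "F \<in> boundary_faces M" and x: "x \<in> F"
  shows "w (cell_plus M F) x \<bullet> face_normal M F = 0"
proof -
  have Ff: "F \<in> faces M" using F by (simp add: boundary_faces_def)
  then have "trace (cell_plus M F) v x = w (cell_plus M F) x"
    using trace_represents[OF w] cell_plus face_subset(1) x by blast
  moreover have "trace (cell_plus M F) v x \<bullet> face_normal M F = 0"
    using v F x unfolding V_div_def by blast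
  ultimately show ?thesis by simp
qed

lemma face_values:
  assumes w: "represents v w" and F: "F \<in> interior_faces M" and x: "x \<in> F"
  shows "jump M v F x = w (cell_plus M F) x - w (cell_minus M F) x"
    "avg M v F x = (1/2) *\<^sub>R (w (cell_plus M F) x + w (cell_minus M F) x)"
proof -
  have "F \<in> faces M" using F interior_faces_subset by blast
  then have "trace (cell_plus M F) v x = w (cell_plus M F) x" "trace (cell_minus M F) v x = w (cell_minus M F) x"
    using trace_represents[OF w] cell_plus cell_minus[OF F] face_subset F x by blast+
  then show "jump M v F x = w (cell_plus M F) x - w (cell_minus M F) x"
    "avg M v F x = (1/2) *\<^sub>R (w (cell_plus M F) x + w (cell_minus M F) x)"
    using F by (simp_all add: jump_def avg_def)
qed

lemma V_div_face:
  assumes v: "v \<in> V_div M fam k" and F: "F \<in> interior_faces M" and x: "x \<in> F"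
  shows "jump M v F x \<bullet> face_normal M F = 0"
    "avg M v F x \<bullet> face_normal M F = normal_comp M v F x"
proof -
  obtain w where w: "represents v w" using V_div_represents[OF v] by blast
  let ?n = "face_normal M F"
  have Ff: "F \<in> faces M" using F interior_faces_subset by blast
  note e = V_div_interior_face[OF v w F x]
  show "jump M v F x \<bullet> ?n = 0" by (simp add: face_values[OF w F x] inner_diff_left e)
  have tr: "trace K v x \<bullet> ?n = w (cell_plus M F) x \<bullet> ?n" if "K \<in> cells M" "F facet_of K" for K
  proof -
    have "x \<in> K" using x facet_of_imp_subset[OF that(2)] by blast
    then have "trace K v x = w K x" by (rule trace_represents[OF w that(1)])
    moreover have "K = cell_plus M F \<or> K = cell_minus M F" using cells_of_interior_face[OF F] that by blast
    ultimately show ?thesis using e by auto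
  qed
  have "normal_comp M v F x = w (cell_plus M F) x \<bullet> ?n"
    unfolding normal_comp_def
  proof (rule the_equality)
    show "\<forall>K\<in>cells M. F facet_of K \<longrightarrow> trace K v x \<bullet> ?n = w (cell_plus M F) x \<bullet> ?n" using tr by blast
    fix a assume "\<forall>K\<in>cells M. F facet_of K \<longrightarrow> trace K v x \<bullet> ?n = a"
    then have "trace (cell_plus M F) v x \<bullet> ?n = a" using cell_plus[OF Ff] by blast
    then show "a = w (cell_plus M F) x \<bullet> ?n" using tr cell_plus[OF Ff] by simp
  qed
  then show "avg M v F x \<bullet> ?n = normal_comp M v F x"
    by (simp add: face_values[OF w F x] inner_add_left e)
qed

text \<open>
  The boundary terms vanish by the boundary condition, and across interior faces only the scalar factor
  jumps.
\<close>

lemma V_div_green: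
  assumes v: "v \<in> V_div M fam k" and w: "represents v w"
    and g: "\<And>K. K \<in> cells M \<Longrightarrow> smooth_function (g K)"
  shows "(\<Sum>K\<in>cells M. (LINT x|lborel. indicator K x * field_div (\<lambda>x. g K x *\<^sub>R w K x) x))
   = (\<Sum>F\<in>interior_faces M. facet_integral F (face_normal M F)
         (\<lambda>x. (w (cell_plus M F) x \<bullet> face_normal M F) * (g (cell_plus M F) x - g (cell_minus M F) x)))"
proof -
  have "(\<Sum>F\<in>boundary_faces M. facet_integral F (face_normal M F)
         (\<lambda>x. (g (cell_plus M F) x *\<^sub>R w (cell_plus M F) x) \<bullet> face_normal M F)) = 0"
    by (intro sum.neutral ballI facet_integral_zero) (simp add: V_div_boundary_face[OF v w])
  then show ?thesis
    using broken_divergence_theorem[OF smooth_field_scale[OF g represents_smooth[OF w]]]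
    by (auto intro!: sum.cong facet_integral_cong simp: inner_diff_left V_div_interior_face[OF v w] algebra_simps)
qed

text \<open>
  The mean is zero by the divergence theorem: there is no flux through the boundary, and the fluxes through
  interior faces cancel.
\<close>

lemma broken_div_Q_h:
  assumes v: "v \<in> V_div M fam k"
  shows "broken_div M v \<in> Q_h M k"
proof -
  obtain w where w: "represents v w" "\<And>K. K \<in> cells M \<Longrightarrow> w K \<in> vec_poly_space (Suc k)"
    using V_div_represents[OF v] by blast
  have "broken_poly k (broken_div M v)"
    unfolding broken_poly_def using broken_div_eq[OF w(1)] vec_poly_div[OF w(2)] by blast
  moreover have "(LINT x|lebesgue_on (region M). broken_div M v x) = (\<Sum>K\<in>cells M. (LINT x|lborel. indicator K x * field_div (w K) x))"
    by (rule region_integral(2)) (auto simp: broken_div_eq[OF w(1)] intro: smooth_functionD(1)[OF smooth_field_div[OF represents_smooth[OF w(1)]]])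
  moreover have "\<dots> = 0"
  proof -
    have "(\<Sum>K\<in>cells M. (LINT x|lborel. indicator K x * field_div (\<lambda>x. 1 *\<^sub>R w K x) x)) = 0"
      by (subst V_div_green[OF v w(1), of "\<lambda>K x. 1"]) (auto intro!: sum.neutral facet_integral_zero)
    then show ?thesis by simp
  qed
  ultimately show ?thesis by (simp add: Q_h_iff)
qed

lemma weak_div_pairing:
  assumes v: "v \<in> V_div M fam k" and q: "q \<in> Q_h M k"
  shows "L2_inner (region M) (weak_div (region M) v) q = (LINT x|lebesgue_on (region M). broken_div M v x * q x)"
proof -
  obtain w where w: "represents v w" using V_div_represents[OF v] by blast
  obtain p where p: "\<And>K. K \<in> cells M \<Longrightarrow> p K \<in> poly_space k" "\<And>K x. K \<in> cells M \<Longrightarrow> x \<in> interior K \<Longrightarrow> q x = p K x"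
    using q broken_polyE unfolding Q_h_iff by metis
  show ?thesis unfolding L2_inner_def inner_real_def
    by (rule weak_div_broken_div[OF w V_div_weak_div[OF v] p(2)]) (auto intro: poly_space_smooth p(1))
qed

lemma broken_div_zeroI:
  assumes v: "v \<in> V_div M fam k" and int: "(LINT x|lebesgue_on (region M). broken_div M v x * broken_div M v x) = 0"
  shows "broken_div M v x = 0"
proof (cases "\<exists>K\<in>cells M. x \<in> interior K")
  case True
  then obtain K where K: "K \<in> cells M" "x \<in> interior K" by blast
  obtain w where w: "represents v w" using V_div_represents[OF v] by blast
  show ?thesis
    by (rule piecewise_zero[where g="\<lambda>K. field_div (w K)", OF broken_div_eq[OF w] _ int K])
       (auto intro: smooth_functionD(1)[OF smooth_field_div[OF represents_smooth[OF w]]])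
next
  case False
  then have "broken_deriv M v x h = 0" for h by (simp only: broken_deriv_def if_False)
  then show ?thesis by (simp add: broken_div_def)
qed

lemma Z_div_broken_div:
  assumes v: "v \<in> Z_div M fam k"
  shows "broken_div M v x = 0"
proof -
  have vV: "v \<in> V_div M fam k" and z: "has_weak_div (region M) v (\<lambda>x. 0)" using v by (auto simp: Z_div_def)
  obtain w where w: "represents v w" using V_div_represents[OF vV] by blast
  have "(LINT x|lebesgue_on (region M). 0 * broken_div M v x) = (LINT x|lebesgue_on (region M). broken_div M v x * broken_div M v x)"
    by (rule weak_div_broken_div[OF w z broken_div_eq[OF w]]) (auto intro: smooth_field_div represents_smooth[OF w])
  then show ?thesis by (intro broken_div_zeroI[OF vV]) simp
qed

text \<open>
  Testing with \<open>q = broken_div M v\<close> gives that the elementwise divergence is zero. As the normal components are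
  continuous, this makes the weak divergence zero.
\<close>

lemma Z_divI:
  assumes v: "v \<in> V_div M fam k" and orth: "\<And>q. q \<in> Q_h M k \<Longrightarrow> L2_inner (region M) (weak_div (region M) v) q = 0"
  shows "v \<in> Z_div M fam k"
proof -
  obtain w where w: "represents v w" using V_div_represents[OF v] by blast
  have z: "broken_div M v x = 0" for x
    using weak_div_pairing[OF v broken_div_Q_h[OF v]] orth[OF broken_div_Q_h[OF v]]
    by (intro broken_div_zeroI[OF v]) simp
  have "has_weak_div (region M) v (\<lambda>x. 0)"
    unfolding has_weak_div_def
  proof (intro conjI allI impI)
    show "(\<lambda>x. 0 :: real) \<in> L2 (region M)" by (rule L2_zero)
    fix \<phi> :: "'a \<Rightarrow> real" assume "test_function (region M) \<phi>"
    then have \<phi>: "smooth_function \<phi>" by (simp add: test_function_def smooth_function_def)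
    have "(\<Sum>K\<in>cells M. (LINT x|lborel. indicator K x * field_div (\<lambda>x. \<phi> x *\<^sub>R w K x) x)) = 0"
      by (subst V_div_green[OF v w, of "\<lambda>K. \<phi>"]) (auto intro!: sum.neutral facet_integral_zero \<phi>)
    then show "(LINT x|lebesgue_on (region M). frechet_derivative \<phi> (at x) (v x)) = - (LINT x|lebesgue_on (region M). 0 * \<phi> x)"
      using green[OF w \<phi>] by (simp add: z)
  qed
  then show ?thesis using v by (simp add: Z_div_def)
qed

lemma faces_inner_eq:
  "faces_inner M \<F> f g = (\<Sum>F\<in>\<F>. facet_integral F (face_normal M F) (\<lambda>x. f F x \<bullet> g F x))"
  by (simp add: faces_inner_def face_measure_integral)

lemma faces_inner_cong:
  assumes "\<And>F x. F \<in> \<F> \<Longrightarrow> x \<in> F \<Longrightarrow> f F x \<bullet> g F x = f' F x \<bullet> g' F x"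
  shows "faces_inner M \<F> f g = faces_inner M \<F> f' g'"
  unfolding faces_inner_eq using assms by (intro sum.cong refl facet_integral_cong)

lemma faces_inner_normal_jump:
  assumes "v \<in> V_div M fam k"
  shows "faces_inner M (interior_faces M) (\<lambda>F x. jump M v F x \<bullet> face_normal M F) g = 0"
  unfolding faces_inner_eq by (intro sum.neutral ballI facet_integral_zero) (simp add: V_div_face(1)[OF assms])

lemma c1_c2:
  assumes u: "u \<in> Z_div M fam k" and v: "v \<in> V_div M fam k"
  shows "c1 M \<zeta> \<theta> u v = c2 M \<zeta> \<theta> u v - \<theta>/2 * L2_inner (region M) (\<lambda>x. broken_div M v x *\<^sub>R u x) u"
proof -
  have uV: "u \<in> V_div M fam k" using u by (simp add: Z_div_def)
  have "L2_inner (region M) (\<lambda>x. broken_div M u x *\<^sub>R u x) v = 0"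
    by (simp add: L2_inner_def Z_div_broken_div[OF u])
  then show ?thesis
    by (simp add: c1_def c2_def faces_inner_normal_jump[OF uV] faces_inner_normal_jump[OF v])
qed

text \<open>
  Both sides are Green's formula for \<open>v\<close> and the scalar factor \<open>\<bar>u\<bar>\<^sup>2/2\<close>, called \<open>g\<close>.
\<close>

lemma convective_energy:
  assumes u: "u \<in> V_div M fam k" and v: "v \<in> Z_div M fam k"
  shows "faces_inner M (interior_faces M) (\<lambda>F x. (avg M v F x \<bullet> face_normal M F) *\<^sub>R jump M u F x) (avg M u)
    = L2_inner (region M) (conv M v u) u"
proof -
  have vV: "v \<in> V_div M fam k" using v by (simp add: Z_div_def)
  obtain wu where wu: "represents u wu" using V_div_represents[OF u] by blast
  obtain wv where wv: "represents v wv" using V_div_represents[OF vV] by blast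
  define g where "g K x = 1/2 * (wu K x \<bullet> wu K x)" for K x
  have gs: "smooth_function (g K)" if "K \<in> cells M" for K
    unfolding g_def using represents_smooth[OF wu that] by (intro smooth_mult smooth_const smooth_field_inner_field)
  have gd: "frechet_derivative (g K) (at x) h = frechet_derivative (wu K) (at x) h \<bullet> wu K x" if K: "K \<in> cells M" for K x h
  proof -
    have d: "(wu K has_derivative frechet_derivative (wu K) (at x)) (at x)"
      using smooth_field_differentiable(1)[OF represents_smooth[OF wu K]] by (simp add: frechet_derivative_works)
    have "(g K has_derivative (\<lambda>h. 1/2 * (wu K x \<bullet> frechet_derivative (wu K) (at x) h + frechet_derivative (wu K) (at x) h \<bullet> wu K x))) (at x)"
      unfolding g_def[abs_def] by (intro has_derivative_mult_right has_derivative_inner d)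
    then show ?thesis by (simp add: frechet_derivative_eq inner_commute)
  qed
  have fd: "field_div (\<lambda>x. g K x *\<^sub>R wv K x) x = frechet_derivative (wu K) (at x) (wv K x) \<bullet> wu K x + g K x * field_div (wv K) x"
    if "K \<in> cells M" for K x
    by (simp add: field_div_scale[OF gs[OF that] represents_smooth[OF wv that]] gd[OF that])
  have "L2_inner (region M) (conv M v u) u = (\<Sum>K\<in>cells M. (LINT x|lborel. indicator K x * field_div (\<lambda>x. g K x *\<^sub>R wv K x) x))"
    unfolding L2_inner_def
  proof (rule region_integral(2))
    fix K x assume K: "K \<in> cells M" "x \<in> interior K"
    have "field_div (wv K) x = 0" using broken_div_eq[OF wv K] Z_div_broken_div[OF v] by simp
    then show "conv M v u x \<bullet> u x = field_div (\<lambda>x. g K x *\<^sub>R wv K x) x"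
      using fd[OF K(1)] by (simp add: conv_def broken_deriv_eq[OF wu K] represents_eq[OF wv K] represents_eq[OF wu K])
  next
    fix K assume K: "K \<in> cells M"
    show "continuous_on UNIV (field_div (\<lambda>x. g K x *\<^sub>R wv K x))"
      by (intro smooth_functionD(1) smooth_field_div smooth_field_scale gs represents_smooth[OF wv] K)
  qed
  also have "\<dots> = (\<Sum>F\<in>interior_faces M. facet_integral F (face_normal M F)
         (\<lambda>x. (wv (cell_plus M F) x \<bullet> face_normal M F) * (g (cell_plus M F) x - g (cell_minus M F) x)))"
    by (rule V_div_green[OF vV wv gs])
  also have "\<dots> = faces_inner M (interior_faces M) (\<lambda>F x. (avg M v F x \<bullet> face_normal M F) *\<^sub>R jump M u F x) (avg M u)"
    unfolding faces_inner_eq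
  proof (intro sum.cong refl facet_integral_cong)
    fix F x assume F: "F \<in> interior_faces M" and x: "x \<in> F"
    have "avg M v F x \<bullet> face_normal M F = wv (cell_plus M F) x \<bullet> face_normal M F"
      using V_div_interior_face[OF vV wv F x] by (simp add: face_values[OF wv F x] inner_add_left)
    moreover have "jump M u F x \<bullet> avg M u F x = g (cell_plus M F) x - g (cell_minus M F) x"
      by (simp add: face_values[OF wu F x] g_def inner_diff_left inner_diff_right inner_add_right inner_commute field_simps)
    ultimately show "(wv (cell_plus M F) x \<bullet> face_normal M F) * (g (cell_plus M F) x - g (cell_minus M F) x)
      = (avg M v F x \<bullet> face_normal M F) *\<^sub>R jump M u F x \<bullet> avg M u F x" by simp
  qed
  finally show ?thesis ..
qed

text \<open>
  The stabilization lives on interior faces only, because \<open>u \<bullet> n\<close> is zero on the boundary.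
\<close>

lemma c2_Z_div:
  assumes u: "u \<in> Z_div M fam k" and v: "v \<in> Z_div M fam k"
  shows "c2 M \<zeta> \<theta> u v =
              L2_inner (region M) (conv M u u) v
              - faces_inner M (interior_faces M)
                  (\<lambda>F x. normal_comp M u F x *\<^sub>R jump M u F x) (avg M v)
              + faces_inner M (interior_faces M)
                  (\<lambda>F x. (\<zeta> F * \<bar>normal_comp M u F x\<bar>) *\<^sub>R jump M u F x) (jump M v)"
proof -
  have uV: "u \<in> V_div M fam k" using u by (simp add: Z_div_def)
  obtain w where w: "represents u w" using V_div_represents[OF uV] by blast
  have div: "L2_inner (region M) (\<lambda>x. broken_div M u x *\<^sub>R u x) v = 0"
    by (simp add: L2_inner_def Z_div_broken_div[OF u])
  have 1: "faces_inner M (interior_faces M) (\<lambda>F x. (avg M u F x \<bullet> face_normal M F) *\<^sub>R jump M u F x) (avg M v)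
     = faces_inner M (interior_faces M) (\<lambda>F x. normal_comp M u F x *\<^sub>R jump M u F x) (avg M v)"
    by (rule faces_inner_cong) (simp add: V_div_face(2)[OF uV])
  let ?s = "\<lambda>F x. (\<zeta> F * \<bar>avg M u F x \<bullet> face_normal M F\<bar>) *\<^sub>R jump M u F x"
  have "faces_inner M (faces M) ?s (jump M v) = faces_inner M (interior_faces M) ?s (jump M v)"
    unfolding faces_inner_eq
  proof (rule sum.mono_neutral_right[OF finite_faces interior_faces_subset])
    show "\<forall>F\<in>faces M - interior_faces M. facet_integral F (face_normal M F) (\<lambda>x. ?s F x \<bullet> jump M v F x) = 0"
    proof (intro ballI facet_integral_zero)
      fix F x assume F: "F \<in> faces M - interior_faces M" and x: "x \<in> F"
      then have "avg M u F x \<bullet> face_normal M F = 0"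
        using uV by (auto simp: avg_def V_div_def boundary_faces_def)
      then show "?s F x \<bullet> jump M v F x = 0" by simp
    qed
  qed
  also have "\<dots> = faces_inner M (interior_faces M) (\<lambda>F x. (\<zeta> F * \<bar>normal_comp M u F x\<bar>) *\<^sub>R jump M u F x) (jump M v)"
    by (rule faces_inner_cong) (simp add: V_div_face(2)[OF uV])
  finally show ?thesis
    unfolding c2_def by (simp add: div 1 faces_inner_normal_jump[OF uV] convective_energy[OF uV v])
qed

text \<open>
  The pressure of the new problem is \<open>P + r p\<close>, where \<open>p\<close> is the projection of \<open>\<bar>u\<bar>\<^sup>2\<close> onto \<open>Q_h\<close>. It may stand for
  \<open>\<bar>u\<bar>\<^sup>2\<close> in the pairing with the divergence of a discrete field, which lies in \<open>Q_h\<close>.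
\<close>

lemma solution_transfer:
  assumes sol: "semidiscrete_solution M fam k T c u P"
    and c': "\<And>u v. u \<in> Z_div M fam k \<Longrightarrow> v \<in> V_div M fam k \<Longrightarrow>
      c' u v = c u v + r * L2_inner (region M) (\<lambda>x. broken_div M v x *\<^sub>R u x) u"
  shows "\<exists>P'. semidiscrete_solution M fam k T c' u P'"
proof -
  let ?I = "\<lambda>g. (LINT x|lebesgue_on (region M). g x)"
  have "\<exists>p. p \<in> Q_h M k \<and> (\<exists>w\<in>V_div M fam k. has_time_deriv (region M) T u w t \<and>
           (\<forall>v\<in>V_div M fam k.
              L2_inner (region M) w v + c' (u t) v
                - L2_inner (region M) (weak_div (region M) v) p = 0))" if t: "t \<in> {0<..T}" for t
  proof -
    have V: "u t \<in> V_div M fam k" using sol t by (auto simp: semidiscrete_solution_def)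
    have P: "P t \<in> Q_h M k" and orth: "\<And>q. q \<in> Q_h M k \<Longrightarrow> L2_inner (region M) (weak_div (region M) (u t)) q = 0"
      using sol t by (auto simp: semidiscrete_solution_def)
    obtain w where w: "w \<in> V_div M fam k" "has_time_deriv (region M) T u w t"
      "\<And>v. v \<in> V_div M fam k \<Longrightarrow>
              L2_inner (region M) w v + c (u t) v - L2_inner (region M) (weak_div (region M) v) (P t) = 0"
      using sol t unfolding semidiscrete_solution_def by blast
    have Z: "u t \<in> Z_div M fam k" by (rule Z_divI[OF V orth])
    obtain wu where wu: "represents (u t) wu" using V_div_represents[OF V] by blast
    have "(\<lambda>x. u t x \<bullet> u t x) \<in> L2 (region M)"
      by (rule piecewise_L2[where g="\<lambda>K x. wu K x \<bullet> wu K x"])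
         (auto simp: represents_eq[OF wu] intro!: smooth_functionD smooth_field_inner_field represents_smooth[OF wu])
    then obtain p where p: "p \<in> Q_h M k" "\<And>q. q \<in> Q_h M k \<Longrightarrow> ?I (\<lambda>x. q x * p x) = ?I (\<lambda>x. q x * (u t x \<bullet> u t x))"
      using Q_h_projection by metis
    define P' where "P' x = P t x + r * p x" for x
    have P'Q: "P' \<in> Q_h M k" unfolding P'_def by (rule Q_h_lincomb[OF P p(1)])
    have "L2_inner (region M) w v + c' (u t) v - L2_inner (region M) (weak_div (region M) v) P' = 0"
      if v: "v \<in> V_div M fam k" for v
    proof -
      have L: "broken_div M v \<in> L2 (region M)" "P t \<in> L2 (region M)" "p \<in> L2 (region M)"
        using broken_div_Q_h[OF v] P p(1) by (auto simp: Q_h_def)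
      have "L2_inner (region M) (weak_div (region M) v) P' = ?I (\<lambda>x. broken_div M v x * P t x + r * (broken_div M v x * p x))"
        unfolding weak_div_pairing[OF v P'Q] by (simp add: P'_def algebra_simps)
      also have "\<dots> = ?I (\<lambda>x. broken_div M v x * P t x) + ?I (\<lambda>x. r * (broken_div M v x * p x))"
        by (intro Bochner_Integration.integral_add integrable_mult_right L2_mult_integrable L)
      also have "\<dots> = ?I (\<lambda>x. broken_div M v x * P t x) + r * ?I (\<lambda>x. broken_div M v x * p x)" by simp
      also have "\<dots> = L2_inner (region M) (weak_div (region M) v) (P t)
          + r * L2_inner (region M) (\<lambda>x. broken_div M v x *\<^sub>R u t x) (u t)"
        by (simp only: weak_div_pairing[OF v P] p(2)[OF broken_div_Q_h[OF v]]) (simp add: L2_inner_def)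
      finally show ?thesis using w(3)[OF v] c'[OF Z v] by simp
    qed
    then show ?thesis using P'Q w by blast
  qed
  then obtain P' where "\<forall>t\<in>{0<..T}. P' t \<in> Q_h M k \<and> (\<exists>w\<in>V_div M fam k. has_time_deriv (region M) T u w t \<and>
           (\<forall>v\<in>V_div M fam k.
              L2_inner (region M) w v + c' (u t) v
                - L2_inner (region M) (weak_div (region M) v) (P' t) = 0))"
    by metis
  then have "semidiscrete_solution M fam k T c' u P'"
    using sol unfolding semidiscrete_solution_def by blast
  then show ?thesis by blast
qed

end

theorem mainTheorem5:
  fixes M :: "'a::euclidean_space mesh" and fam :: hdiv_family and k :: nat
    and \<sigma> \<theta> :: real and \<zeta> :: "'a set \<Rightarrow> real"
  assumes "DIM('a) = 2 \<or> DIM('a) = 3"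
    and "conforming_simplicial_mesh M"
    and "shape_regular \<sigma> M"
    and "\<theta> \<in> {0, 1, -1}"
    and "\<forall>F\<in>faces M. 0 \<le> \<zeta> F"
  shows "(\<forall>u\<in>Z_div M fam k. \<forall>v\<in>Z_div M fam k.
            c1 M \<zeta> \<theta> u v = c2 M \<zeta> \<theta> u v \<and>
            c2 M \<zeta> \<theta> u v =
              L2_inner (region M) (conv M u u) v
              - faces_inner M (interior_faces M)
                  (\<lambda>F x. normal_comp M u F x *\<^sub>R jump M u F x) (avg M v)
              + faces_inner M (interior_faces M)
                  (\<lambda>F x. (\<zeta> F * \<bar>normal_comp M u F x\<bar>) *\<^sub>R jump M u F x) (jump M v))
       \<and> (\<forall>(T::real) u. 0 < T \<longrightarrow> (\<forall>t\<in>{0..T}. u t \<in> V_div M fam k) \<longrightarrow>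
            ((\<exists>P. semidiscrete_solution M fam k T (c1 M \<zeta> \<theta>) u P) \<longleftrightarrow>
             (\<exists>P. semidiscrete_solution M fam k T (c2 M \<zeta> \<theta>) u P)))"
proof -
  interpret simplicial_mesh M by standard (rule assms(2))
  have div: "L2_inner (region M) (\<lambda>x. broken_div M v x *\<^sub>R u x) u = 0" if "v \<in> Z_div M fam k" for u v :: "'a \<Rightarrow> 'a"
    by (simp add: L2_inner_def Z_div_broken_div[OF that])
  have Z: "v \<in> V_div M fam k" if "v \<in> Z_div M fam k" for v using that by (simp add: Z_div_def)
  have "c1 M \<zeta> \<theta> u v = c2 M \<zeta> \<theta> u v" if "u \<in> Z_div M fam k" "v \<in> Z_div M fam k" for u v
    using c1_c2[OF that(1) Z[OF that(2)]] div[OF that(2)] by simp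
  then show ?thesis
  proof (intro conjI ballI allI impI iffI, goal_cases)
    case 1
    then show ?case by blast
  next
    case 2
    then show ?case by (intro c2_Z_div)
  next
    case (3 T u)
    then obtain P where P: "semidiscrete_solution M fam k T (c1 M \<zeta> \<theta>) u P" by blast
    show ?case by (rule solution_transfer[OF P, where r="\<theta>/2"]) (simp add: c1_c2)
  next
    case (4 T u)
    then obtain P where P: "semidiscrete_solution M fam k T (c2 M \<zeta> \<theta>) u P" by blast
    show ?case by (rule solution_transfer[OF P, where r="- \<theta>/2"]) (simp add: c1_c2)
  qed
qed

end
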